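(* Fix $\lambda>0$ and $\theta\in(0,1)$. Consider the Bayesian quickest attack-detection problem of minimizing, over all detection policies $\bm\mu$ (equivalently stopping rules $\tau$ based on the observed innovations), the cost $$L(\bm\mu)=\mathbb{E}_{\bm\mu}\big[(\tau-t)^+ + \lambda\,\mathbf 1_{\{\tau<t\}}\big]=\mathbb{E}_{\bm\mu}\Big[\sum_{k=0}^{\tau-1}\pi_k+\lambda(1-\pi_\tau)\Big],$$ viewed as a (partially observable) Markov decision process with state $(\pi_k,\tilde z_1,\dots,\tilde z_k)$ at time $k$. The optimal policy is a threshold policy: for each time $k$ and each history $\tilde z_{1:k}=(\tilde z_1,\dots,\tilde z_k)$ there is a threshold $\Gamma_k(\tilde z_{1:k})\in[0,1]$ such that, if the state at time $k$ is $(\pi_k,\tilde z_1,\dots,\tilde z_k)$, then (i) if $\pi_k>\Gamma_k(\tilde z_{1:k})$, the optimal action is to stop and declare $H_1$ (an attack); (ii) if $\pi_k<\Gamma_k(\tilde z_{1:k})$, the optimal action is to continue collecting observations; (iii) if $\pi_k=\Gamma_k(\tilde z_{1:k})$, either action is optimal.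
   Context: **Process and observations.** $x_{k+1}=Ax_k+w_k$ with $x_k\in\mathbb R^q$, $w_k\sim\mathcal N(0,Q)$ i.i.d. A finite set of sensors is partitioned into safe sensors $\mathcal S$ and potentially unsafe sensors $\mathcal A$. Sensor $i$ observes $y_{k,i}=C_ix_k+v_{k,i}$, $v_{k,i}\sim\mathcal N(0,R_i)$, with noises i.i.d. in $k$ and independent across $i$. Stacking all sensors gives $y_k=Cx_k+v_k$, with $v_k\sim\mathcal N(0,R)$ and $R$ block diagonal with blocks $R_i$ (positive definite). $(A,Q^{1/2})$ is stabilizable and $(A,C_i)$ is detectable for every $i$. **Remote estimator and innovations.** Let $P$ be the fixed point of the Riccati recursion for the one-step prediction error covariance of the Kalman filter for $(A,C,Q,R)$, $\Sigma_z=CPC'+R$ and $K=PC'\Sigma_z^{-1}$. The filter is in steady state when observation starts (so that with no attack the innovations are i.i.d. $\mathcal N(0,\Sigma_z)$) and runs blindly as $\tilde x_k=A\tilde x_{k-1}+K\tilde z_k$, where $\tilde z_k$ is the innovation it receives at time $k\ge1$. **Attack.** The attack starts at a random time $t$, independent of the noises, geometric with parameter $\theta$: $\mathbb P(t\le k)=1-(1-\theta)^k$. With $z_k=y_k-CA\tilde x_{k-1}$, the received innovation is $\tilde z_k=z_k$ if $k<t$ and $\tilde z_k=Tz_k+b_k$ if $k\ge t$. Here $T$ is a known block-diagonal matrix (one block $T_i$ per sensor) with $T_i=I$ for $i\in\mathcal S$ and the part $T_{\mathcal A}$ corresponding to $\mathcal A$ invertible; $b_k$ is i.i.d. zero-mean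 Gaussian, with components zero for sensors in $\mathcal S$ and $b_{k,i}\sim\mathcal N(0,\Sigma_{b_i})$ for $i\in\mathcal A$. **Detection.** At each time $k\ge0$ the detector, having seen $\tilde z_1,\dots,\tilde z_k$, chooses action $0$ (continue) or $1$ (stop and declare $H_1$, "there is an attack"); $\tau$ is the time of stopping. A policy $\bm\mu=\{\mu_k\}_{k\ge0}$ is a sequence of decision rules, $\mu_k$ being a function of the history at time $k$. **Belief and its recursion.** $\pi_k=\mathbb P(t\le k\mid\tilde z_1,\dots,\tilde z_k)$. Write $p_c(\tilde z_{k+1}\mid t\le k+1)$ and $p_c(\tilde z_{k+1}\mid t>k+1)$ for the conditional densities of $\tilde z_{k+1}$ given $\tilde z_{1:k}$ and the indicated event; these are fixed functions of $(\tilde z_1,\dots,\tilde z_{k+1})$ (the second is the $\mathcal N(0,\Sigma_z)$ density). From state $(\pi,\tilde z_{1:k})$ under action $0$, $\tilde z_{k+1}$ has the predictive density $$p_c(\tilde z_{k+1})=(\pi+(1-\pi)\theta)\,p_c(\tilde z_{k+1}\mid t\le k+1)+(1-\pi)(1-\theta)\,p_c(\tilde z_{k+1}\mid t>k+1),$$ and the next belief is $$\pi_{k+1}=\frac{p_c(\tilde z_{k+1}\mid t\le k+1)\,(\pi+(1-\pi)\theta)}{p_c(\tilde z_{k+1})}.$$ States $(\pi,\tilde z_{1:k})$ with arbitrary $\pi\in[0,1]$ are allowed. **Costs and optimality.** The single-stage cost in state $(\pi_k,\tilde z_{1:k})$ is $\pi_k$ for action $0$ and $\lambda(1-\pi_k)$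 for action $1$ (after which the process terminates). $J_k^*(\pi_k,\tilde z_1,\dots,\tilde z_k)$ is the optimal (infimal) expected cost-to-go from the state at time $k$; it satisfies the Bellman equation $$J_k^*(\pi_k,\tilde z_{1:k})=\min\big\{\lambda(1-\pi_k),\ \pi_k+\mathbb E[J_{k+1}^*(\pi_{k+1},\tilde z_{1:k+1})\mid\pi_k,\tilde z_{1:k}]\big\},$$ with the expectation over $\tilde z_{k+1}$ under the predictive density above. An action is optimal in a state if it attains the minimum in this equation (first term: stop; second term: continue). *)

theory Defs
  imports "HOL-Probability.Probability"
begin

section \<open>Matrices and Gaussian vectors\<close>

definition pos_semidef :: "real^'n^'n \<Rightarrow> bool" where
  "pos_semidef S \<longleftrightarrow> transpose S = S \<and> (\<forall>u. 0 \<le> u \<bullet> (S *v u))"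

definition pos_def :: "real^'n^'n \<Rightarrow> bool" where
  "pos_def S \<longleftrightarrow> transpose S = S \<and> (\<forall>u. u \<noteq> 0 \<longrightarrow> 0 < u \<bullet> (S *v u))"

definition schur_stable :: "real^'n^'n \<Rightarrow> bool" where
  "schur_stable F \<longleftrightarrow>
     (\<forall>(c::complex) u. u \<noteq> 0 \<and> (\<chi> i j. complex_of_real (F $ i $ j)) *v u = c *s u \<longrightarrow> cmod c < 1)"

definition stabilizable :: "real^'n^'n \<Rightarrow> real^'k^'n \<Rightarrow> bool" where
  "stabilizable A B \<longleftrightarrow> (\<exists>F. schur_stable (A + B ** F))"

definition detectable :: "real^'n^'n \<Rightarrow> real^'n^'k \<Rightarrow> bool" where
  "detectable A H \<longleftrightarrow> (\<exists>L. schur_stable (A - L ** H))"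

definition std_normal_vec :: "(real^'n) measure" where
  "std_normal_vec = density lborel (\<lambda>g. \<Prod>i\<in>UNIV. ennreal (std_normal_density (g $ i)))"

text \<open>\<open>X\<close> has law \<open>N(0,S)\<close> if it is distributed like \<open>B g\<close> with \<open>g\<close> standard normal and
  \<open>B B' = S\<close>; this allows singular covariances.\<close>

definition gaussian :: "'a measure \<Rightarrow> real^'n^'n \<Rightarrow> ('a \<Rightarrow> real^'n) \<Rightarrow> bool" where
  "gaussian M S X \<longleftrightarrow> X \<in> borel_measurable M \<and>
     (\<exists>B::real^'n^'n. B ** transpose B = S \<and>
        distr M borel X = distr std_normal_vec borel (\<lambda>g. B *v g))"

definition gaussian_density :: "real^'n^'n \<Rightarrow> real^'n \<Rightarrow> real" where
  "gaussian_density S z =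
     exp (- (z \<bullet> (matrix_inv S *v z)) / 2) / sqrt ((2 * pi) ^ CARD('n) * det S)"


section \<open>Sensors and the Kalman filter\<close>

text \<open>Sensors may have different output dimensions: \<open>'m\<close> indexes the components of the stacked
  output and \<open>sensor j\<close> is the sensor to which component \<open>j\<close> belongs. Blocks of the stacked
  matrices are the index sets on which \<open>sensor\<close> is constant.\<close>

definition block_diagonal :: "('m \<Rightarrow> 's) \<Rightarrow> real^'m^'m \<Rightarrow> bool" where
  "block_diagonal sensor S \<longleftrightarrow> (\<forall>i j. sensor i \<noteq> sensor j \<longrightarrow> S $ i $ j = 0)"

text \<open>\<open>C\<^sub>i\<close>, padded with zero rows for the components of the other sensors. The padding has no
  effect on detectability.\<close>

definition sensor_output :: "('m \<Rightarrow> 's) \<Rightarrow> real^'q^'m \<Rightarrow> 's \<Rightarrow> real^'q^'m" where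
  "sensor_output sensor C s = (\<chi> j. if sensor j = s then C $ j else 0)"

definition invertible_part :: "'m set \<Rightarrow> real^'m^'m \<Rightarrow> bool" where
  "invertible_part I S \<longleftrightarrow> (\<exists>U::real^'m^'m. \<forall>i\<in>I. \<forall>j\<in>I.
     (\<Sum>l\<in>I. S $ i $ l * U $ l $ j) = (if i = j then 1 else 0) \<and>
     (\<Sum>l\<in>I. U $ i $ l * S $ l $ j) = (if i = j then 1 else 0))"

definition innovation_cov :: "real^'q^'m \<Rightarrow> real^'m^'m \<Rightarrow> real^'q^'q \<Rightarrow> real^'m^'m" where
  "innovation_cov C R P = C ** P ** transpose C + R"

definition kalman_gain :: "real^'q^'m \<Rightarrow> real^'m^'m \<Rightarrow> real^'q^'q \<Rightarrow> real^'m^'q" where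
  "kalman_gain C R P = P ** transpose C ** matrix_inv (innovation_cov C R P)"

definition riccati ::
    "real^'q^'q \<Rightarrow> real^'q^'m \<Rightarrow> real^'q^'q \<Rightarrow> real^'m^'m \<Rightarrow> real^'q^'q \<Rightarrow> real^'q^'q" where
  "riccati A C Q R P = A ** P ** transpose A + Q
     - A ** P ** transpose C ** matrix_inv (innovation_cov C R P) ** C ** P ** transpose A"

locale sensor_network =
  fixes A Q :: "real^'q^'q" and C :: "real^'q^'m" and R :: "real^'m^'m"
    and sensor :: "'m \<Rightarrow> 's::finite" and P :: "real^'q^'q"
  assumes sensor_surj: "surj sensor"
    and R_pos_def: "pos_def R"
    and R_block: "block_diagonal sensor R"
    and stabilizable_Q_sqrt:
      "\<exists>Qh. pos_semidef Qh \<and> Qh ** Qh = Q \<and> stabilizable A Qh"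
    and detectable_sensor: "\<And>s. detectable A (sensor_output sensor C s)"
    and P_pos_semidef: "pos_semidef P"
    and P_fixed_point: "riccati A C Q R P = P"


section \<open>The attacked system\<close>

text \<open>The independent sources of randomness: the initial pair \<open>(x\<^sub>0, \<tilde>x\<^sub>0)\<close>, the
  noises \<open>w\<^sub>k\<close>, \<open>v\<^sub>k\<close>, \<open>b\<^sub>k\<close>, and the attack time.\<close>

datatype source = Initial | Process_noise nat | Sensor_noise nat | Attack_noise nat | Attack_time

primrec source_events ::
    "'a measure \<Rightarrow> ('a \<Rightarrow> real^'q) \<Rightarrow> ('a \<Rightarrow> real^'q) \<Rightarrow> (nat \<Rightarrow> 'a \<Rightarrow> real^'q) \<Rightarrow>
     (nat \<Rightarrow> 'a \<Rightarrow> real^'m) \<Rightarrow> (nat \<Rightarrow> 'a \<Rightarrow> real^'m) \<Rightarrow> ('a \<Rightarrow> nat) \<Rightarrow> source \<Rightarrow> 'a set set" where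
  "source_events M x0 xt0 w v b t Initial =
     sets (vimage_algebra (space M) (\<lambda>\<omega>. (x0 \<omega>, xt0 \<omega>)) borel)"
| "source_events M x0 xt0 w v b t (Process_noise k) = sets (vimage_algebra (space M) (w k) borel)"
| "source_events M x0 xt0 w v b t (Sensor_noise k) = sets (vimage_algebra (space M) (v k) borel)"
| "source_events M x0 xt0 w v b t (Attack_noise k) = sets (vimage_algebra (space M) (b k) borel)"
| "source_events M x0 xt0 w v b t Attack_time =
     sets (vimage_algebra (space M) t (count_space UNIV))"

text \<open>\<open>x\<close>, \<open>y\<close>: process and observations; \<open>z\<close>: innovation before tampering; \<open>zt\<close>, \<open>xt\<close>: received
  innovation and remote estimate; \<open>zn\<close>, \<open>xn\<close>: innovation and estimate of the same filter when no
  attack takes place. The remote filter is in steady state when observation starts: the one-step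
  prediction error has law \<open>N(0,P)\<close> and the attack-free innovations are i.i.d. \<open>N(0,\<Sigma>\<^sub>z)\<close>.
  Since \<open>R\<close> is block diagonal, \<open>v\<^sub>k \<sim> N(0,R)\<close> makes the sensor noises independent across sensors.
  The covariance \<open>\<Sigma>\<^sub>b\<close> of \<open>b\<^sub>k\<close> is arbitrary apart from what \<open>b_safe\<close> imposes;
  its diagonal blocks are the covariances of the \<open>b\<^sub>k\<^sub>,\<^sub>i\<close>.\<close>

locale attacked_system = prob_space M + sensor_network A Q C R sensor P
  for M :: "'a measure"
    and A Q :: "real^'q^'q" and C :: "real^'q^'m" and R :: "real^'m^'m"
    and sensor :: "'m \<Rightarrow> 's::finite" and P :: "real^'q^'q" +
  fixes safe :: "'s set" and T \<Sigma>\<^sub>b :: "real^'m^'m" and \<theta> :: real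
    and x :: "nat \<Rightarrow> 'a \<Rightarrow> real^'q" and y :: "nat \<Rightarrow> 'a \<Rightarrow> real^'m"
    and w :: "nat \<Rightarrow> 'a \<Rightarrow> real^'q" and v b :: "nat \<Rightarrow> 'a \<Rightarrow> real^'m" and t :: "'a \<Rightarrow> nat"
    and z zt :: "nat \<Rightarrow> 'a \<Rightarrow> real^'m" and xt :: "nat \<Rightarrow> 'a \<Rightarrow> real^'q"
    and zn :: "nat \<Rightarrow> 'a \<Rightarrow> real^'m" and xn :: "nat \<Rightarrow> 'a \<Rightarrow> real^'q"
  assumes T_block: "block_diagonal sensor T"
    and T_safe: "\<And>i j. sensor i = sensor j \<Longrightarrow> sensor i \<in> safe \<Longrightarrow> T $ i $ j = (if i = j then 1 else 0)"
    and T_unsafe: "invertible_part {j. sensor j \<notin> safe} T"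
    and initial_measurable: "x 0 \<in> borel_measurable M" "xt 0 \<in> borel_measurable M"
    and w_gaussian: "\<And>k. gaussian M Q (w k)"
    and v_gaussian: "\<And>k. gaussian M R (v k)"
    and b_gaussian: "\<And>k. gaussian M \<Sigma>\<^sub>b (b k)"
    and b_safe: "\<And>k j \<omega>. \<omega> \<in> space M \<Longrightarrow> sensor j \<in> safe \<Longrightarrow> b k \<omega> $ j = 0"
    and t_measurable: "t \<in> measurable M (count_space UNIV)"
    and t_geometric: "\<And>k. prob {\<omega> \<in> space M. t \<omega> \<le> k} = 1 - (1 - \<theta>) ^ k"
    and sources_indep: "indep_sets (source_events M (x 0) (xt 0) w v b t) UNIV"
    and process: "\<And>k \<omega>. \<omega> \<in> space M \<Longrightarrow> x (Suc k) \<omega> = A *v x k \<omega> + w k \<omega>"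
    and observation: "\<And>k \<omega>. \<omega> \<in> space M \<Longrightarrow> y k \<omega> = C *v x k \<omega> + v k \<omega>"
    and innovation: "\<And>k \<omega>. \<omega> \<in> space M \<Longrightarrow>
          z (Suc k) \<omega> = y (Suc k) \<omega> - C *v (A *v xt k \<omega>)"
    and received: "\<And>k \<omega>. \<omega> \<in> space M \<Longrightarrow>
          zt (Suc k) \<omega> = (if Suc k < t \<omega> then z (Suc k) \<omega> else T *v z (Suc k) \<omega> + b (Suc k) \<omega>)"
    and estimate: "\<And>k \<omega>. \<omega> \<in> space M \<Longrightarrow>
          xt (Suc k) \<omega> = A *v xt k \<omega> + kalman_gain C R P *v zt (Suc k) \<omega>"
    and no_attack_initial: "\<And>\<omega>. \<omega> \<in> space M \<Longrightarrow> xn 0 \<omega> = xt 0 \<omega>"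
    and no_attack_innovation: "\<And>k \<omega>. \<omega> \<in> space M \<Longrightarrow>
          zn (Suc k) \<omega> = y (Suc k) \<omega> - C *v (A *v xn k \<omega>)"
    and no_attack_estimate: "\<And>k \<omega>. \<omega> \<in> space M \<Longrightarrow>
          xn (Suc k) \<omega> = A *v xn k \<omega> + kalman_gain C R P *v zn (Suc k) \<omega>"
    and steady_state_error: "gaussian M P (\<lambda>\<omega>. x 1 \<omega> - A *v xt 0 \<omega>)"
    and steady_state_innovations: "\<And>k. gaussian M (innovation_cov C R P) (zn (Suc k))"
          "indep_vars (\<lambda>_. borel) zn {1..}"


section \<open>Histories, policies and the detection cost\<close>

abbreviation hist_space :: "nat \<Rightarrow> (nat \<Rightarrow> real^'m) measure" where
  "hist_space k \<equiv> PiM {1..k} (\<lambda>_. borel)"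

definition history :: "(nat \<Rightarrow> 'a \<Rightarrow> real^'m) \<Rightarrow> nat \<Rightarrow> 'a \<Rightarrow> nat \<Rightarrow> real^'m" where
  "history zt k \<omega> = (\<lambda>i\<in>{1..k}. zt i \<omega>)"

datatype action = Continue | Stop

definition policies :: "(nat \<Rightarrow> (nat \<Rightarrow> real^'m) \<Rightarrow> action) set" where
  "policies = {\<mu>. \<forall>k. \<mu> k \<in> measurable (hist_space k) (count_space UNIV)}"

text \<open>The value is \<open>\<infinity>\<close> if the policy never stops.\<close>

definition stopping_time ::
    "(nat \<Rightarrow> 'a \<Rightarrow> real^'m) \<Rightarrow> (nat \<Rightarrow> (nat \<Rightarrow> real^'m) \<Rightarrow> action) \<Rightarrow> 'a \<Rightarrow> enat" where
  "stopping_time zt \<mu> \<omega> = (INF k\<in>{k. \<mu> k (history zt k \<omega>) = Stop}. enat k)"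

text \<open>Subtraction on \<^typ>\<open>enat\<close> truncates at zero and so yields the positive part.\<close>

definition detection_cost ::
    "'a measure \<Rightarrow> ('a \<Rightarrow> nat) \<Rightarrow> (nat \<Rightarrow> 'a \<Rightarrow> real^'m) \<Rightarrow> real \<Rightarrow>
     (nat \<Rightarrow> (nat \<Rightarrow> real^'m) \<Rightarrow> action) \<Rightarrow> ennreal" where
  "detection_cost M t zt lam \<mu> =
     (\<integral>\<^sup>+\<omega>. ennreal_of_enat (stopping_time zt \<mu> \<omega> - enat (t \<omega>)) +
           ennreal lam * indicator {\<omega>. stopping_time zt \<mu> \<omega> < enat (t \<omega>)} \<omega> \<partial>M)"

text \<open>The posterior probability \<open>\<pi>\<^sub>k\<close> of \<open>t \<le> k\<close> given the received innovations up to time \<open>k\<close>.\<close>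

definition posterior ::
    "'a measure \<Rightarrow> ('a \<Rightarrow> nat) \<Rightarrow> (nat \<Rightarrow> 'a \<Rightarrow> real^'m) \<Rightarrow> nat \<Rightarrow> 'a \<Rightarrow> real" where
  "posterior M t zt k =
     real_cond_exp M (vimage_algebra (space M) (history zt k) (hist_space k))
       (indicator {\<omega>. t \<omega> \<le> k})"

definition belief_cost ::
    "'a measure \<Rightarrow> ('a \<Rightarrow> nat) \<Rightarrow> (nat \<Rightarrow> 'a \<Rightarrow> real^'m) \<Rightarrow> real \<Rightarrow>
     (nat \<Rightarrow> (nat \<Rightarrow> real^'m) \<Rightarrow> action) \<Rightarrow> ennreal" where
  "belief_cost M t zt lam \<mu> =
     (\<integral>\<^sup>+\<omega>. (\<Sum>k. if enat k < stopping_time zt \<mu> \<omega> then ennreal (posterior M t zt k \<omega>) else 0) +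
           (case stopping_time zt \<mu> \<omega> of
              enat k \<Rightarrow> ennreal (lam * (1 - posterior M t zt k \<omega>)) | \<infinity> \<Rightarrow> 0) \<partial>M)"


section \<open>The decision process on beliefs and histories\<close>

text \<open>\<open>f k h\<close> is, for every history \<open>h\<close> up to time \<open>k\<close>, a density of the next received innovation
  conditionally on that history and the event \<open>E\<close>.\<close>

definition conditional_density ::
    "'a measure \<Rightarrow> (nat \<Rightarrow> 'a \<Rightarrow> real^'m) \<Rightarrow> 'a set \<Rightarrow> nat \<Rightarrow>
     ((nat \<Rightarrow> real^'m) \<Rightarrow> real^'m \<Rightarrow> real) \<Rightarrow> bool" where
  "conditional_density M zt E k f \<longleftrightarrow>
     (\<lambda>(h, u). f h u) \<in> borel_measurable (hist_space k \<Otimes>\<^sub>M borel) \<and>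
     (\<forall>h\<in>space (hist_space k). (\<forall>u. 0 \<le> f h u) \<and> (\<integral>\<^sup>+u. ennreal (f h u) \<partial>lborel) = 1) \<and>
     (\<forall>B\<in>sets (hist_space k). \<forall>D\<in>sets borel.
        emeasure M {\<omega> \<in> space M. \<omega> \<in> E \<and> history zt k \<omega> \<in> B \<and> zt (Suc k) \<omega> \<in> D} =
        (\<integral>\<^sup>+\<omega>. indicator {\<omega>. \<omega> \<in> E \<and> history zt k \<omega> \<in> B} \<omega> *
              (\<integral>\<^sup>+u. indicator D u * ennreal (f (history zt k \<omega>) u) \<partial>lborel) \<partial>M))"

text \<open>In the following, \<open>f\<^sub>1 k h u\<close> and \<open>f\<^sub>0 u\<close> are the conditional densities of the next received
  innovation given \<open>t \<le> k + 1\<close> and \<open>t > k + 1\<close>, respectively.\<close>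

definition predictive_density ::
    "real \<Rightarrow> (nat \<Rightarrow> (nat \<Rightarrow> real^'m) \<Rightarrow> real^'m \<Rightarrow> real) \<Rightarrow> (real^'m \<Rightarrow> real) \<Rightarrow>
     nat \<Rightarrow> real \<Rightarrow> (nat \<Rightarrow> real^'m) \<Rightarrow> real^'m \<Rightarrow> real" where
  "predictive_density \<theta> f\<^sub>1 f\<^sub>0 k \<pi> h u =
     (\<pi> + (1 - \<pi>) * \<theta>) * f\<^sub>1 k h u + (1 - \<pi>) * (1 - \<theta>) * f\<^sub>0 u"

definition next_belief ::
    "real \<Rightarrow> (nat \<Rightarrow> (nat \<Rightarrow> real^'m) \<Rightarrow> real^'m \<Rightarrow> real) \<Rightarrow> (real^'m \<Rightarrow> real) \<Rightarrow>
     nat \<Rightarrow> real \<Rightarrow> (nat \<Rightarrow> real^'m) \<Rightarrow> real^'m \<Rightarrow> real" where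
  "next_belief \<theta> f\<^sub>1 f\<^sub>0 k \<pi> h u =
     f\<^sub>1 k h u * (\<pi> + (1 - \<pi>) * \<theta>) / predictive_density \<theta> f\<^sub>1 f\<^sub>0 k \<pi> h u"

text \<open>Expectation of \<open>F \<pi>\<^sub>k\<^sub>+\<^sub>1 z\<^sub>1\<^sub>:\<^sub>k\<^sub>+\<^sub>1\<close> when action \<^const>\<open>Continue\<close> is taken in state \<open>(\<pi>, h)\<close>
  at time \<open>k\<close>.\<close>

definition next_expectation ::
    "real \<Rightarrow> (nat \<Rightarrow> (nat \<Rightarrow> real^'m) \<Rightarrow> real^'m \<Rightarrow> real) \<Rightarrow> (real^'m \<Rightarrow> real) \<Rightarrow>
     nat \<Rightarrow> real \<Rightarrow> (nat \<Rightarrow> real^'m) \<Rightarrow> (real \<Rightarrow> (nat \<Rightarrow> real^'m) \<Rightarrow> ennreal) \<Rightarrow> ennreal" where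
  "next_expectation \<theta> f\<^sub>1 f\<^sub>0 k \<pi> h F =
     (\<integral>\<^sup>+u. ennreal (predictive_density \<theta> f\<^sub>1 f\<^sub>0 k \<pi> h u) *
           F (next_belief \<theta> f\<^sub>1 f\<^sub>0 k \<pi> h u) (h(Suc k := u)) \<partial>lborel)"

text \<open>Expected cost that policy \<open>\<mu>\<close> incurs during the stages \<open>k, \<dots>, k + n - 1\<close> from state
  \<open>(\<pi>, h)\<close> at time \<open>k\<close>. The stage costs are nonnegative, so the expected total cost is the
  supremum over \<open>n\<close>.\<close>

primrec stages_cost ::
    "real \<Rightarrow> real \<Rightarrow> (nat \<Rightarrow> (nat \<Rightarrow> real^'m) \<Rightarrow> real^'m \<Rightarrow> real) \<Rightarrow> (real^'m \<Rightarrow> real) \<Rightarrow>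
     (nat \<Rightarrow> (nat \<Rightarrow> real^'m) \<Rightarrow> action) \<Rightarrow> nat \<Rightarrow> nat \<Rightarrow> real \<Rightarrow> (nat \<Rightarrow> real^'m) \<Rightarrow> ennreal" where
  "stages_cost lam \<theta> f\<^sub>1 f\<^sub>0 \<mu> 0 k \<pi> h = 0"
| "stages_cost lam \<theta> f\<^sub>1 f\<^sub>0 \<mu> (Suc n) k \<pi> h =
     (case \<mu> k h of
        Stop \<Rightarrow> ennreal (lam * (1 - \<pi>))
      | Continue \<Rightarrow> ennreal \<pi> +
          next_expectation \<theta> f\<^sub>1 f\<^sub>0 k \<pi> h (stages_cost lam \<theta> f\<^sub>1 f\<^sub>0 \<mu> n (Suc k)))"

definition cost_to_go ::
    "real \<Rightarrow> real \<Rightarrow> (nat \<Rightarrow> (nat \<Rightarrow> real^'m) \<Rightarrow> real^'m \<Rightarrow> real) \<Rightarrow> (real^'m \<Rightarrow> real) \<Rightarrow>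
     (nat \<Rightarrow> (nat \<Rightarrow> real^'m) \<Rightarrow> action) \<Rightarrow> nat \<Rightarrow> real \<Rightarrow> (nat \<Rightarrow> real^'m) \<Rightarrow> ennreal" where
  "cost_to_go lam \<theta> f\<^sub>1 f\<^sub>0 \<mu> k \<pi> h = (SUP n. stages_cost lam \<theta> f\<^sub>1 f\<^sub>0 \<mu> n k \<pi> h)"

definition optimal_cost_to_go ::
    "real \<Rightarrow> real \<Rightarrow> (nat \<Rightarrow> (nat \<Rightarrow> real^'m) \<Rightarrow> real^'m \<Rightarrow> real) \<Rightarrow> (real^'m \<Rightarrow> real) \<Rightarrow>
     nat \<Rightarrow> real \<Rightarrow> (nat \<Rightarrow> real^'m) \<Rightarrow> ennreal" where
  "optimal_cost_to_go lam \<theta> f\<^sub>1 f\<^sub>0 k \<pi> h = (INF \<mu>\<in>policies. cost_to_go lam \<theta> f\<^sub>1 f\<^sub>0 \<mu> k \<pi> h)"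

text \<open>The two terms on the right-hand side of the Bellman equation.\<close>

primrec action_value ::
    "real \<Rightarrow> real \<Rightarrow> (nat \<Rightarrow> (nat \<Rightarrow> real^'m) \<Rightarrow> real^'m \<Rightarrow> real) \<Rightarrow> (real^'m \<Rightarrow> real) \<Rightarrow>
     nat \<Rightarrow> real \<Rightarrow> (nat \<Rightarrow> real^'m) \<Rightarrow> action \<Rightarrow> ennreal" where
  "action_value lam \<theta> f\<^sub>1 f\<^sub>0 k \<pi> h Stop = ennreal (lam * (1 - \<pi>))"
| "action_value lam \<theta> f\<^sub>1 f\<^sub>0 k \<pi> h Continue = ennreal \<pi> +
     next_expectation \<theta> f\<^sub>1 f\<^sub>0 k \<pi> h (optimal_cost_to_go lam \<theta> f\<^sub>1 f\<^sub>0 (Suc k))"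

definition optimal_actions ::
    "real \<Rightarrow> real \<Rightarrow> (nat \<Rightarrow> (nat \<Rightarrow> real^'m) \<Rightarrow> real^'m \<Rightarrow> real) \<Rightarrow> (real^'m \<Rightarrow> real) \<Rightarrow>
     nat \<Rightarrow> real \<Rightarrow> (nat \<Rightarrow> real^'m) \<Rightarrow> action set" where
  "optimal_actions lam \<theta> f\<^sub>1 f\<^sub>0 k \<pi> h =
     {a. \<forall>a'. action_value lam \<theta> f\<^sub>1 f\<^sub>0 k \<pi> h a \<le> action_value lam \<theta> f\<^sub>1 f\<^sub>0 k \<pi> h a'}"

text \<open>Policies that compare the posterior with the threshold; the action on ties is free.\<close>

definition threshold_policies ::
    "'a measure \<Rightarrow> ('a \<Rightarrow> nat) \<Rightarrow> (nat \<Rightarrow> 'a \<Rightarrow> real^'m) \<Rightarrow> (nat \<Rightarrow> (nat \<Rightarrow> real^'m) \<Rightarrow> real) \<Rightarrow>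
     (nat \<Rightarrow> (nat \<Rightarrow> real^'m) \<Rightarrow> action) set" where
  "threshold_policies M t zt \<Gamma> = {\<mu> \<in> policies. \<forall>k. AE \<omega> in M.
     (posterior M t zt k \<omega> > \<Gamma> k (history zt k \<omega>) \<longrightarrow> \<mu> k (history zt k \<omega>) = Stop) \<and>
     (posterior M t zt k \<omega> < \<Gamma> k (history zt k \<omega>) \<longrightarrow> \<mu> k (history zt k \<omega>) = Continue)}"

end

theory Submission
  imports Defs
begin

text \<open>Value iteration started at \<open>0\<close> increases to the optimal cost-to-go. By induction its iterates
  are concave in the belief, because the expected value after one more observation is an integral of
  perspectives of a concave function. The difference between continuing and stopping is therefore
  concave in \<open>\<pi>\<close>; it is at most \<open>\<pi> - \<lambda>\<theta>(1 - \<pi>)\<close>, hence negative near \<open>0\<close>, and at least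
  \<open>\<pi> - \<lambda>(1 - \<pi>)\<close>, hence positive near \<open>1\<close>. So it vanishes at exactly one point, the threshold.

  Before the attack the received innovations coincide with those of the attack-free filter, which are
  i.i.d. \<open>N(0,\<Sigma>\<^sub>z)\<close> and independent of the attack time. Hence the belief recursion started at \<open>0\<close> gives
  the posterior probabilities, and both costs of a policy are the sum of its expected stage costs
  along the beliefs. Telescoping the Bellman inequality bounds this sum from below by the optimal
  value of the initial state, and from above when almost surely every action is optimal.\<close>

text \<open>Several obstacles shape the proof. A policy sees the history only, while a state carries
  an arbitrary belief; attaining the optimal value from a given state therefore takes a policy with
  that time and belief built in. Costs live in \<open>ennreal\<close>, where integrals are monotone
  without measurability but subtraction is lost: complementary events are carried along as separate
  identities, and real numbers enter only once the continuation value is known to be finite. The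
  belief recursion divides by a predictive density that may vanish; the arguments work with the
  product of density and next belief, which is affine in the belief and correct even where the
  density is 0.

  The constant \<lambda>\<theta> in the upper bound is the price of observing once more and then
  stopping: the expected false-alarm cost drops from \<lambda>(1 - \<pi>) to \<lambda>(1 - \<pi>)(1
  - \<theta>). The lower bound just drops all cost after the current stage. Concavity gives
  continuity only inside the unit interval, so the zero is located between two interior points. In
  the lower bound on the cost of a policy, finite iterates are telescoped instead of their limit, so
  that the remainder is exactly 0.\<close>

declare One_nat_def [simp del] \<comment> \<open>it would rewrite the index sets \<open>{1..k}\<close> to \<open>{Suc 0..k}\<close>\<close>

section \<open>Densities of Gaussian vectors\<close>

lemma measurable_matrix_vector_mult [measurable]: "(*v) (B::real^'n^'m) \<in> borel_measurable borel"
  by (intro borel_measurable_continuous_onI matrix_vector_mult_linear_continuous_on)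

text \<open>Averaging over the translations along \<open>e\<^sub>m\<close> by an amount in \<open>[0,1]\<close>, which commute with the
  shear, reduces its invariance to translation invariance of Lebesgue measure.\<close>

lemma distr_lborel_shear:
  fixes c :: real and m n :: "'n::finite"
  assumes "m \<noteq> n"
  shows "distr lborel borel (\<lambda>x::real^'n. x + (c * x $ n) *\<^sub>R axis m 1) = lborel" (is "distr _ _ ?T = _")
proof (rule measure_eqI)
  fix X assume "X \<in> sets (distr lborel borel ?T)"
  then have [measurable]: "X \<in> sets borel" by simp
  let ?F = "indicator X :: real^'n \<Rightarrow> ennreal" and ?I = "indicator {0..1} :: real \<Rightarrow> ennreal"
  let ?e = "axis m 1 :: real^'n"
  \<comment> \<open>Here \<open>m \<noteq> n\<close> enters: moving along \<open>?e\<close> leaves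
    coordinate \<open>n\<close>, and hence the amount of shear, unchanged.\<close>
  have e: "?e $ n = 0" using assms by (simp add: axis_def)
  have [measurable]: "(\<lambda>x::real^'n. x $ n) \<in> borel_measurable borel"
    by (intro borel_measurable_continuous_onI continuous_intros)
  have shift: "(\<integral>\<^sup>+x. G (a + x) \<partial>lborel) = (\<integral>\<^sup>+x. G x \<partial>lborel)"
    if [measurable]: "G \<in> borel_measurable borel" for G and a :: "'b::euclidean_space"
    using nn_integral_distr[of "(+) a" lborel borel G] by (simp add: lborel_distr_plus)
  have I1: "(\<integral>\<^sup>+s. ?I (s + a) \<partial>lborel) = 1" for a
    using shift[of ?I a] by (simp add: add.commute)
  have "emeasure (distr lborel borel ?T) X = (\<integral>\<^sup>+x. ?F (?T x) \<partial>lborel)"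
    by (simp add: nn_integral_distr flip: nn_integral_indicator)
  also have "\<dots> = (\<integral>\<^sup>+x. (\<integral>\<^sup>+s. ?I s * ?F (?T x) \<partial>lborel) \<partial>lborel)"
    by (simp add: nn_integral_multc)
  also have "\<dots> = (\<integral>\<^sup>+s. (\<integral>\<^sup>+x. ?I s * ?F (?T x) \<partial>lborel) \<partial>lborel)"
    by (rule lborel_pair.Fubini') measurable
  also have "\<dots> = (\<integral>\<^sup>+s. (\<integral>\<^sup>+x. ?I s * ?F (x + (s + c * x $ n) *\<^sub>R ?e) \<partial>lborel) \<partial>lborel)"
  proof (rule nn_integral_cong)
    fix s :: real
    show "(\<integral>\<^sup>+x. ?I s * ?F (?T x) \<partial>lborel) = (\<integral>\<^sup>+x. ?I s * ?F (x + (s + c * x $ n) *\<^sub>R ?e) \<partial>lborel)"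
      using shift[of "\<lambda>x. ?I s * ?F (?T x)" "s *\<^sub>R ?e"] by (simp add: e algebra_simps)
  qed
  also have "\<dots> = (\<integral>\<^sup>+x. (\<integral>\<^sup>+s. ?I s * ?F (x + (s + c * x $ n) *\<^sub>R ?e) \<partial>lborel) \<partial>lborel)"
    by (rule lborel_pair.Fubini') measurable
  \<comment> \<open>Shifting \<open>s\<close> by \<open>c * x $ n\<close> trades the shear inside
    \<open>?F\<close> for a shifted window. A translation of \<open>x\<close> then removes
    \<open>s\<close> from \<open>?F\<close> as well, and every shifted window has integral
    1.\<close>
  also have "\<dots> = (\<integral>\<^sup>+x. (\<integral>\<^sup>+s. ?I (s - c * x $ n) * ?F (x + s *\<^sub>R ?e) \<partial>lborel) \<partial>lborel)"
  proof (rule nn_integral_cong)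
    fix x :: "real^'n"
    show "(\<integral>\<^sup>+s. ?I s * ?F (x + (s + c * x $ n) *\<^sub>R ?e) \<partial>lborel) =
        (\<integral>\<^sup>+s. ?I (s - c * x $ n) * ?F (x + s *\<^sub>R ?e) \<partial>lborel)"
      using shift[of "\<lambda>s. ?I (s - c * x $ n) * ?F (x + s *\<^sub>R ?e)" "c * x $ n"]
      by (simp add: add.commute)
  qed
  also have "\<dots> = (\<integral>\<^sup>+s. (\<integral>\<^sup>+x. ?I (s - c * x $ n) * ?F (x + s *\<^sub>R ?e) \<partial>lborel) \<partial>lborel)"
    by (rule lborel_pair.Fubini') measurable
  also have "\<dots> = (\<integral>\<^sup>+s. (\<integral>\<^sup>+x. ?I (s - c * x $ n) * ?F x \<partial>lborel) \<partial>lborel)"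
  proof (rule nn_integral_cong)
    fix s :: real
    show "(\<integral>\<^sup>+x. ?I (s - c * x $ n) * ?F (x + s *\<^sub>R ?e) \<partial>lborel) = (\<integral>\<^sup>+x. ?I (s - c * x $ n) * ?F x \<partial>lborel)"
      using shift[of "\<lambda>x. ?I (s - c * x $ n) * ?F x" "s *\<^sub>R ?e"] by (simp add: e add.commute)
  qed
  also have "\<dots> = (\<integral>\<^sup>+x. (\<integral>\<^sup>+s. ?I (s - c * x $ n) * ?F x \<partial>lborel) \<partial>lborel)"
    by (rule lborel_pair.Fubini') measurable
  also have "\<dots> = emeasure lborel X"
    using I1[of "- (c * _ $ n)"] by (simp add: nn_integral_multc)
  finally show "emeasure (distr lborel borel ?T) X = emeasure lborel X" .
qed simp

text \<open>Volumes of boxes determine Lebesgue measure. The preimage of a box is the box with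
  permuted corners, because a transposition is its own inverse, and permuting the side lengths keeps
  their product.\<close>

lemma distr_lborel_swap:
  fixes m n :: "'n::finite"
  shows "distr lborel borel (\<lambda>x::real^'n. \<chi> i. x $ Transposition.transpose m n i) = lborel" (is "distr _ _ ?T = _")
proof (rule lborel_eqI[symmetric])
  have "continuous_on UNIV ?T" by (intro continuous_intros)
  then have [measurable]: "?T \<in> borel_measurable borel" by (rule borel_measurable_continuous_onI)
  fix l u :: "real^'n"
  assume lu: "\<And>b. b \<in> Basis \<Longrightarrow> l \<bullet> b \<le> u \<bullet> b"
  then have lu': "l $ i \<le> u $ i" for i
    using lu[of "axis i 1"] by (auto simp: Basis_vec_def inner_axis)
  have vimg: "?T -` box l u = box (?T l) (?T u)"
    by (auto simp: mem_box_cart) (metis transpose_involutory)+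
  have prodB: "(\<Prod>b\<in>Basis. (u - l) \<bullet> b) = (\<Prod>i\<in>UNIV. (u - l) $ i)" for u l :: "real^'n"
    by (simp add: Basis_vec_def UNION_singleton_eq_range prod.reindex inj_on_def axis_eq_axis inner_axis)
  have T: "?T l \<bullet> b \<le> ?T u \<bullet> b" if "b \<in> Basis" for b
    using that lu' by (auto simp: Basis_vec_def inner_axis)
  have "emeasure (distr lborel borel ?T) (box l u) = ennreal (\<Prod>i\<in>UNIV. (u - l) $ Transposition.transpose m n i)"
    using T prodB[of "?T u" "?T l"] by (simp add: emeasure_distr vimg)
  also have "(\<Prod>i\<in>UNIV. (u - l) $ Transposition.transpose m n i) = (\<Prod>i\<in>UNIV. (u - l) $ i)"
    using prod.permute[OF permutes_swap_id[of m UNIV n], of "\<lambda>i. (u - l) $ i"] by (simp add: o_def)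
  finally show "emeasure (distr lborel borel ?T) (box l u) = (\<Prod>b\<in>Basis. (u - l) \<bullet> b)"
    by (simp add: prodB)
qed simp

text \<open>Checked on elementary matrices and extended by multiplicativity of \<open>det\<close>:
  matrices with a zero row (excluded by the determinant), diagonal matrices (coordinatewise
  scaling), swaps of coordinates and shears generate all square matrices.\<close>

lemma distr_lborel_matrix:
  fixes B :: "real^'n^'n"
  shows "det B \<noteq> 0 \<Longrightarrow> distr lborel borel ((*v) B) = density lborel (\<lambda>_. ennreal (1 / \<bar>det B\<bar>))"
proof (induction rule: induct_matrix_elementary)
  case (1 A B)
  then have d: "det A \<noteq> 0" "det B \<noteq> 0" by (auto simp: det_mul)
  have "distr lborel borel ((*v) (A ** B)) = distr (distr lborel borel ((*v) B)) borel ((*v) A)"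
    by (subst distr_distr) (auto simp: o_def matrix_vector_mul_assoc)
  also have "\<dots> = density (distr lborel borel ((*v) A)) (\<lambda>_. ennreal (1 / \<bar>det B\<bar>))"
    using 1(2)[OF d(2)] by (simp add: density_distr)
  also have "\<dots> = density lborel (\<lambda>_. ennreal (1 / \<bar>det A\<bar>) * ennreal (1 / \<bar>det B\<bar>))"
    using 1(1)[OF d(1)] by (simp add: density_density_eq)
  finally show ?case
    by (simp add: det_mul abs_mult ennreal_mult'[symmetric])
next
  case (2 A i)
  then show ?case by (simp add: det_zero_row)
next
  case (3 A)
  \<comment> \<open>\<open>lborel_affine_euclidean\<close> wants scaling factors indexed by basis
    vectors; \<open>c\<close> carries the diagonal entry \<open>A $ i $ i\<close> over to
    \<open>axis i 1\<close>.\<close>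
  define c where "c b = (\<Sum>i\<in>UNIV. if b = axis i 1 then A $ i $ i else 0)" for b :: "real^'n"
  have c: "c (axis i 1) = A $ i $ i" for i by (simp add: c_def axis_eq_axis)
  have det: "det A = (\<Prod>i\<in>UNIV. A $ i $ i)" using 3(1) by (rule det_diagonal)
  have prodB: "(\<Prod>b\<in>Basis. f b) = (\<Prod>i\<in>UNIV. f (axis i 1))" for f :: "real^'n \<Rightarrow> real"
    by (simp add: Basis_vec_def UNION_singleton_eq_range prod.reindex inj_on_def axis_eq_axis)
  have sumB: "(\<Sum>b\<in>Basis. f b) = (\<Sum>i\<in>UNIV. f (axis i 1))" for f :: "real^'n \<Rightarrow> real^'n"
    by (simp add: Basis_vec_def UNION_singleton_eq_range sum.reindex inj_on_def axis_eq_axis)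
  have nz: "A $ i $ i \<noteq> 0" for i using 3(2) unfolding det by auto
  then have nzc: "c b \<noteq> 0" if "b \<in> Basis" for b using that by (auto simp: Basis_vec_def c)
  have "(\<lambda>x. 0 + (\<Sum>j\<in>Basis. (c j * (x \<bullet> j)) *\<^sub>R j)) = (*v) A"
  proof
    fix x
    have "(A *v x) $ k = A $ k $ k * x $ k" for k
    proof -
      have "(A *v x) $ k = (\<Sum>j\<in>UNIV. if j = k then A $ k $ k * x $ k else 0)"
        unfolding matrix_vector_mult_def vec_lambda_beta by (intro sum.cong) (auto simp: 3(1))
      then show ?thesis by simp
    qed
    then show "0 + (\<Sum>j\<in>Basis. (c j * (x \<bullet> j)) *\<^sub>R j) = A *v x"
      unfolding sumB c inner_axis by (auto simp: vec_eq_iff axis_def if_distrib cong: if_cong)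
  qed
  then have "lborel = density (distr lborel borel ((*v) A)) (\<lambda>_. (\<Prod>j\<in>Basis. \<bar>c j\<bar>))"
    using lborel_affine_euclidean[of c 0, OF nzc] by (simp only:)
  also have "(\<Prod>j\<in>Basis. \<bar>c j\<bar>) = \<bar>det A\<bar>" unfolding prodB c det by (simp add: abs_prod)
  finally have *: "lborel = density (distr lborel borel ((*v) A)) (\<lambda>_. \<bar>det A\<bar>)" .
  have "density lborel (\<lambda>_. ennreal (1 / \<bar>det A\<bar>)) =
      density (density (distr lborel borel ((*v) A)) (\<lambda>_. \<bar>det A\<bar>)) (\<lambda>_. ennreal (1 / \<bar>det A\<bar>))"
    using * by simp
  also have "\<dots> = density (distr lborel borel ((*v) A)) (\<lambda>_. ennreal \<bar>det A\<bar> * ennreal (1 / \<bar>det A\<bar>))"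
    by (subst density_density_eq) auto
  also have "\<dots> = distr lborel borel ((*v) A)"
    using 3(2) by (simp add: ennreal_mult'[symmetric] density_1)
  finally show ?case by simp
next
  case (4 m n)
  let ?A = "(\<chi> i j. mat 1 $ i $ Transposition.transpose m n j) :: real^'n^'n"
  have A: "?A *v x = (\<chi> i. x $ Transposition.transpose m n i)" for x
  proof -
    have "(?A *v x) $ i = (\<Sum>j\<in>UNIV. if j = Transposition.transpose m n i then x $ j else 0)" for i
      unfolding matrix_vector_mult_def vec_lambda_beta
      by (intro sum.cong) (auto simp: mat_def)
    then show ?thesis by (simp add: vec_eq_iff)
  qed
  \<comment> \<open>A swap is an involution, so its determinant squares to 1; only the absolute
    value matters.\<close>
  have "?A ** ?A = mat 1"
    by (simp add: matrix_eq A flip: matrix_vector_mul_assoc)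
  then have "(det ?A)\<^sup>2 = 1" by (metis det_mul det_I power2_eq_square)
  then have "\<bar>det ?A\<bar> = 1" by (auto simp: power2_eq_1_iff)
  then show ?case
    using distr_lborel_swap[of m n] by (simp add: A[abs_def] density_1)
next
  case (5 m n c)
  let ?A = "(\<chi> i j. if i = m \<and> j = n then c else of_bool (i = j)) :: real^'n^'n"
  have "?A = (\<chi> k. if k = m then row m (mat 1) + c *s row n (mat 1) else row k (mat 1))"
    using 5(1) by (auto simp: vec_eq_iff row_def mat_def)
  then have "det ?A = 1"
    using det_row_operation[OF 5(1), of "mat 1" c] by simp
  moreover have "?A *v x = x + (c * x $ n) *\<^sub>R axis m 1" for x
  proof -
    have "(?A *v x) $ i = (\<Sum>j\<in>UNIV. (if j = i then x $ i else 0) + (if j = n \<and> i = m then c * x $ n else 0))" for i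
      unfolding matrix_vector_mult_def vec_lambda_beta
      using 5(1) by (intro sum.cong) auto
    then show ?thesis by (simp add: vec_eq_iff sum.distrib axis_def)
  qed
  ultimately show ?case
    using distr_lborel_shear[OF 5(1), of c] by (simp add: density_1)
qed

section \<open>Explicit densities of nondegenerate Gaussian laws\<close>

text \<open>\<open>matrix_inv\<close> is a choice of a two-sided inverse, so its value has to be
  pinned down; for square matrices a right inverse is also a left one.\<close>

lemma matrix_inv_unique:
  fixes A B :: "real^'n^'n"
  assumes "A ** B = mat 1"
  shows "matrix_inv A = B"
proof -
  have 1: "B ** A = mat 1" using assms by (simp add: matrix_left_right_inverse)
  then have "\<exists>A'. A ** A' = mat 1 \<and> A' ** A = mat 1" using assms by blast
  then have "A ** matrix_inv A = mat 1 \<and> matrix_inv A ** A = mat 1"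
    unfolding matrix_inv_def by (rule someI_ex)
  then have "matrix_inv A = (B ** A) ** matrix_inv A \<and> A ** matrix_inv A = mat 1"
    using 1 by simp
  then show ?thesis by (metis matrix_mul_assoc matrix_mul_rid)
qed

lemma gaussian_density_nonneg: "0 \<le> det S \<Longrightarrow> 0 \<le> gaussian_density S z"
  by (simp add: gaussian_density_def)

lemma gaussian_density_measurable: "gaussian_density S \<in> borel_measurable borel"
proof -
  have "continuous_on UNIV (\<lambda>z. z \<bullet> (matrix_inv S *v z))"
    by (intro continuous_on_inner continuous_on_id matrix_vector_mult_linear_continuous_on)
  then have [measurable]: "(\<lambda>z. z \<bullet> (matrix_inv S *v z)) \<in> borel_measurable borel"
    by (rule borel_measurable_continuous_onI)
  show ?thesis unfolding gaussian_density_def[abs_def] by measurable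
qed

lemma std_normal_prod:
  fixes g :: "real^'n"
  shows "(\<Prod>i\<in>UNIV. ennreal (std_normal_density (g $ i))) =
    ennreal (exp (- (g \<bullet> g) / 2) / sqrt ((2 * pi) ^ CARD('n)))"
proof -
  have "(\<Prod>i\<in>UNIV. ennreal (std_normal_density (g $ i))) = ennreal (\<Prod>i\<in>UNIV. std_normal_density (g $ i))"
    by (rule prod_ennreal) simp
  also have "(\<Prod>i\<in>UNIV. std_normal_density (g $ i)) =
      (\<Prod>i\<in>(UNIV::'n set). 1 / sqrt (2 * pi)) * (\<Prod>i\<in>UNIV. exp (- (g $ i)\<^sup>2 / 2))"
    unfolding std_normal_density_def by (rule prod.distrib)
  also have "(\<Prod>i\<in>UNIV. exp (- (g $ i)\<^sup>2 / 2)) = exp (\<Sum>i\<in>UNIV. - (g $ i)\<^sup>2 / 2)"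
    by (rule exp_sum[symmetric]) simp
  also have "(\<Sum>i\<in>UNIV. - (g $ i)\<^sup>2 / 2) = - (g \<bullet> g) / 2"
    by (simp add: inner_vec_def power2_eq_square sum_negf sum_divide_distrib)
  also have "(\<Prod>i\<in>(UNIV::'n set). 1 / sqrt (2 * pi)) = 1 / sqrt ((2 * pi) ^ CARD('n))"
    by (simp add: power_divide real_sqrt_power[symmetric] power_mult_distrib)
  finally show ?thesis by simp
qed

text \<open>\<open>gaussian\<close> presents \<open>X\<close> as distributed like \<open>B g\<close>
  for a factor \<open>B\<close> of \<open>S\<close>. Since \<open>det S\<close> is the square of
  \<open>det B\<close>, a nonzero determinant makes \<open>B\<close> invertible and the linear
  change of variables produces the density; the same identity gives positivity of
  \<open>det S\<close>.\<close>

lemma gaussian_distr_eq_density: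
  fixes S :: "real^'n^'n"
  assumes "gaussian M S X" and "det S \<noteq> 0"
  shows "distr M borel X = density lborel (gaussian_density S)" and "0 < det S"
proof -
  obtain B :: "real^'n^'n" where S: "B ** transpose B = S"
    and dX: "distr M borel X = distr std_normal_vec borel (\<lambda>g. B *v g)"
    using assms(1) by (auto simp: gaussian_def)
  have detS: "det S = (det B)\<^sup>2"
    using S by (metis det_mul det_transpose power2_eq_square)
  then have B0: "det B \<noteq> 0" using assms(2) by auto
  show "0 < det S" using B0 detS by simp
  obtain B' where B': "B ** B' = mat 1" "B' ** B = mat 1"
    using B0 invertible_det_nz[of B] by (auto simp: invertible_def)
  have inv: "matrix_inv S = transpose B' ** B'"
  proof (rule matrix_inv_unique)
    have "S ** (transpose B' ** B') = B ** (transpose B ** transpose B') ** B'"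
      by (simp add: S[symmetric] matrix_mul_assoc)
    also have "transpose B ** transpose B' = mat 1"
      by (metis B'(2) matrix_transpose_mul transpose_mat)
    finally show "S ** (transpose B' ** B') = mat 1" by (simp add: B')
  qed
  have meas: "(*v) B \<in> borel_measurable borel" "(*v) B' \<in> borel_measurable borel"
    by (intro borel_measurable_continuous_onI matrix_vector_mult_linear_continuous_on)+
  \<comment> \<open>The standard normal density expressed in the variable \<open>z = B g\<close>, so
    that it can be moved through the push-forward.\<close>
  define \<psi> where "\<psi> z = ennreal (exp (- ((B' *v z) \<bullet> (B' *v z)) / 2) / sqrt ((2 * pi) ^ CARD('n)))"
    for z :: "real^'n"
  have [measurable]: "\<psi> \<in> borel_measurable borel"
    unfolding \<psi>_def using meas(2) by measurable
  have "distr std_normal_vec borel (\<lambda>g. B *v g)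
      = distr (density lborel (\<lambda>g. \<psi> (B *v g))) borel (\<lambda>g. B *v g)"
    unfolding std_normal_vec_def std_normal_prod \<psi>_def by (simp add: matrix_vector_mul_assoc B')
  also have "\<dots> = density (distr lborel borel ((*v) B)) \<psi>"
    by (subst density_distr) (use meas in auto)
  also have "\<dots> = density lborel (\<lambda>z. ennreal (1 / \<bar>det B\<bar>) * \<psi> z)"
    unfolding distr_lborel_matrix[OF B0] by (subst density_density_eq) auto
  also have "(\<lambda>z. ennreal (1 / \<bar>det B\<bar>) * \<psi> z) = (\<lambda>z. ennreal (gaussian_density S z))"
  proof
    fix z :: "real^'n"
    have "(B' *v z) \<bullet> (B' *v z) = z \<bullet> (matrix_inv S *v z)"
      unfolding inv by (metis dot_lmul_matrix matrix_vector_mul_assoc transpose_matrix_vector transpose_transpose inner_commute)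
    then show "ennreal (1 / \<bar>det B\<bar>) * \<psi> z = ennreal (gaussian_density S z)"
      by (simp add: \<psi>_def gaussian_density_def ennreal_mult'[symmetric] detS real_sqrt_mult field_simps)
  qed
  finally show "distr M borel X = density lborel (gaussian_density S)" using dX by simp
qed

text \<open>The quadratic form splits into a nonnegative part from \<open>P\<close>, evaluated at
  the transpose of \<open>C\<close> applied to \<open>u\<close> (written \<open>u v* C\<close>), and
  a positive part from \<open>R\<close>; hence the kernel is trivial.\<close>

lemma det_innovation_cov_nonzero:
  assumes "pos_semidef P" "pos_def R"
  shows "det (innovation_cov C R P) \<noteq> 0"
proof -
  have "u = 0" if "innovation_cov C R P *v u = 0" for u
  proof (rule ccontr)
    assume "u \<noteq> 0"
    then have "0 < u \<bullet> (R *v u)" using assms by (auto simp: pos_def_def)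
    moreover have "0 \<le> (u v* C) \<bullet> (P *v (u v* C))" using assms by (auto simp: pos_semidef_def)
    moreover have "u \<bullet> (innovation_cov C R P *v u) = (u v* C) \<bullet> (P *v (u v* C)) + u \<bullet> (R *v u)"
      unfolding innovation_cov_def
      by (simp add: matrix_vector_mult_add_rdistrib inner_right_distrib dot_lmul_matrix
          flip: matrix_vector_mul_assoc)
    ultimately show False using that by simp
  qed
  then show ?thesis
    by (metis invertible_det_nz invertible_left_inverse matrix_left_invertible_ker)
qed

section \<open>Value iteration and thresholds\<close>

text \<open>Concavity yields continuity only in the interior, so the intermediate value theorem is
  applied between two interior points of opposite sign. The endpoint 1, where \<open>g\<close> is at
  least 1, gives uniqueness: once nonnegative, \<open>g\<close> is positive further to the
  right.\<close>

lemma concave_sign_change: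
  fixes g :: "real \<Rightarrow> real"
  assumes concave: "\<And>s p q. s \<in> {0..1} \<Longrightarrow> p \<in> {0..1} \<Longrightarrow> q \<in> {0..1} \<Longrightarrow>
      s * g p + (1 - s) * g q \<le> g (s * p + (1 - s) * q)"
    and upper: "\<And>p. p \<in> {0..1} \<Longrightarrow> g p \<le> p - a * (1 - p)" and a: "0 < a"
    and lower: "\<And>p. p \<in> {0..1} \<Longrightarrow> p - b * (1 - p) \<le> g p" and b: "0 < b"
  shows "\<exists>\<Gamma>\<in>{0..1}. \<forall>p\<in>{0..1}. (p > \<Gamma> \<longrightarrow> g p > 0) \<and> (p < \<Gamma> \<longrightarrow> g p < 0) \<and> (p = \<Gamma> \<longrightarrow> g p = 0)"
proof -
  have "convex_on {0<..<1} (\<lambda>p. - g p)"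
  proof (rule convex_onI)
    fix t p q :: real
    assume "0 < t" "t < 1" "p \<in> {0<..<1}" "q \<in> {0<..<1}"
    then show "- g ((1 - t) *\<^sub>R p + t *\<^sub>R q) \<le> (1 - t) * - g p + t * - g q"
      using concave[of "1 - t" p q] by simp
  qed simp
  then have "continuous_on {0<..<1} (\<lambda>p. - g p)"
    by (intro convex_on_continuous) auto
  then have cont: "continuous_on {0<..<1} g"
    using continuous_on_minus by fastforce
  \<comment> \<open>The affine bounds vanish at \<open>a / (a + 1)\<close> and
    \<open>b / (b + 1)\<close>; \<open>l\<close> lies to the left of the first and \<open>r\<close>
    to the right of the second, both inside the open interval.\<close>
  define l where "l = a / (a + 2)"
  define r where "r = (b + 1) / (b + 2)"
  have l: "0 < l" "l < 1" and r: "0 < r" "r < 1" using a b by (auto simp: l_def r_def)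
  have gl: "g l < 0"
  proof -
    have "1 - l = 2 / (a + 2)" using a by (simp add: l_def field_simps)
    then have "l - a * (1 - l) = - (a / (a + 2))" by (simp add: l_def)
    then have "g l \<le> - (a / (a + 2))" using upper[of l] l by simp
    moreover have "0 < a / (a + 2)" using a by simp
    ultimately show ?thesis by linarith
  qed
  have gr: "0 < g r"
  proof -
    have "r - b * (1 - r) = 1 / (b + 2)" using b by (simp add: r_def field_simps)
    then have "1 / (b + 2) \<le> g r" using lower[of r] r by simp
    moreover have "0 < 1 / (b + 2)" using b by simp
    ultimately show ?thesis by linarith
  qed
  \<comment> \<open>Concavity on the segment from \<open>p\<close> to 1, with a positive weight at
    1. It serves twice: to order \<open>l\<close> and \<open>r\<close>, and to fix the sign on both
    sides of the zero.\<close>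
  have pos_right: "g q > 0" if "p \<in> {0..1}" "q \<in> {0..1}" "p < q" "0 \<le> g p" for p q
  proof -
    define s where "s = (1 - q) / (1 - p)"
    have "s * (1 - p) = 1 - q" using that by (simp add: s_def)
    then have s: "q = s * p + (1 - s) * 1" by (simp add: algebra_simps)
    have s01: "s \<in> {0..<1}" using that by (simp add: s_def)
    have "s * g p + (1 - s) * g 1 \<le> g q"
      using concave[of s p 1] s s01 that by auto
    moreover have "0 < (1 - s) * g 1" using lower[of 1] s01 by (intro mult_pos_pos) auto
    moreover have "0 \<le> s * g p" using s01 that by (intro mult_nonneg_nonneg) auto
    ultimately show ?thesis by linarith
  qed
  have "l < r"
    using pos_right[of r l] gl gr l r by (metis atLeastAtMost_iff less_eq_real_def not_less_iff_gr_or_eq)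
  then have "\<exists>\<Gamma>\<ge>l. \<Gamma> \<le> r \<and> g \<Gamma> = 0"
    using gl gr l r by (intro IVT') (auto intro!: continuous_on_subset[OF cont])
  then obtain \<Gamma> where \<Gamma>: "l \<le> \<Gamma>" "\<Gamma> \<le> r" "g \<Gamma> = 0" by auto
  then have 1: "\<Gamma> \<in> {0..1}" using l r by auto
  have "g p < 0" if "p \<in> {0..1}" "p < \<Gamma>" for p
    using pos_right[of p \<Gamma>] that \<Gamma> 1 by (metis less_irrefl not_le)
  then show ?thesis using pos_right[OF 1] \<Gamma> 1 by (intro bexI[of _ \<Gamma>]) auto
qed

text \<open>Jensen's inequality with the weights \<open>s * c\<close> and
  \<open>(1 - s) * d\<close>, normalized by their sum \<open>e\<close>. The point \<open>r\<close>
  is given only through \<open>e * r\<close>, hence is arbitrary when \<open>e = 0\<close>, where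
  both weights vanish; this covers beliefs obtained by dividing by a zero density.\<close>

lemma concave_perspective:
  fixes F :: "real \<Rightarrow> ennreal"
  assumes F: "\<And>s p q. s \<in> {0..1} \<Longrightarrow> p \<in> {0..1} \<Longrightarrow> q \<in> {0..1} \<Longrightarrow>
      ennreal s * F p + ennreal (1 - s) * F q \<le> F (s * p + (1 - s) * q)"
    and s: "s \<in> {0..1}" and p: "p \<in> {0..1}" and q: "q \<in> {0..1}" and nonneg: "0 \<le> c" "0 \<le> d"
    and e: "e = s * c + (1 - s) * d" and r: "e * r = s * (c * p) + (1 - s) * (d * q)"
  shows "ennreal s * (ennreal c * F p) + ennreal (1 - s) * (ennreal d * F q) \<le> ennreal e * F r"
proof -
  have sc: "0 \<le> s * c" "0 \<le> (1 - s) * d" using s nonneg by auto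
  have lhs: "ennreal s * (ennreal c * F p) + ennreal (1 - s) * (ennreal d * F q) =
      ennreal (s * c) * F p + ennreal ((1 - s) * d) * F q"
    using s by (simp add: ennreal_mult' mult.assoc)
  show ?thesis
  proof (cases "e = 0")
    case True
    then have "s * c = 0" "(1 - s) * d = 0" using e sc by linarith+
    then show ?thesis unfolding lhs by (simp only: ennreal_0 mult_zero_left add_0_left zero_le)
  next
    case False
    then have e0: "0 < e" using e sc by linarith
    define \<sigma> where "\<sigma> = s * c / e"
    have c: "s * c = e * \<sigma>" using e0 by (simp add: \<sigma>_def)
    have d: "(1 - s) * d = e * (1 - \<sigma>)" using e c by (simp add: algebra_simps)
    have \<sigma>: "\<sigma> \<in> {0..1}" using sc e0 unfolding c d by (simp add: zero_le_mult_iff)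
    have "e * r = (s * c) * p + ((1 - s) * d) * q" using r by (simp add: algebra_simps)
    then have "e * r = e * (\<sigma> * p + (1 - \<sigma>) * q)" unfolding c d by (simp add: algebra_simps)
    then have r': "r = \<sigma> * p + (1 - \<sigma>) * q" using e0 by simp
    have "ennreal (s * c) * F p + ennreal ((1 - s) * d) * F q =
        ennreal e * (ennreal \<sigma> * F p + ennreal (1 - \<sigma>) * F q)"
      unfolding c d using e0 \<sigma> by (simp add: ennreal_mult' distrib_left mult.assoc)
    also have "\<dots> \<le> ennreal e * F r"
      unfolding r' by (intro mult_left_mono F \<sigma> p q) simp
    finally show ?thesis unfolding lhs .
  qed
qed

section \<open>Histories and the controlled belief process\<close>

lemma extend_history:
  "h \<in> space (hist_space k) \<Longrightarrow> h(Suc k := u) \<in> space (hist_space (Suc k))"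
  by (auto simp: space_PiM PiE_def extensional_def)

lemma restrict_history:
  "h \<in> space (hist_space k) \<Longrightarrow> restrict h {1..k} = h"
  by (auto simp: space_PiM PiE_def extensional_def restrict_def)

lemma measurable_extend_history [measurable (raw)]:
  assumes [measurable]: "g \<in> measurable N (hist_space k)" "u \<in> borel_measurable N"
  shows "(\<lambda>x. (g x)(Suc k := u x)) \<in> measurable N (hist_space (Suc k))"
proof -
  have "(\<lambda>x. (\<lambda>(h, y). h(Suc k := y)) (g x, u x)) \<in> measurable N (PiM (insert (Suc k) {1..k}) (\<lambda>_. borel))"
    by (rule measurable_compose[OF _ measurable_add_dim]) measurable
  moreover have "insert (Suc k) {1..k} = {1..Suc k}" by auto
  ultimately show ?thesis by simp
qed

text \<open>Two-point concavity spelled out in \<open>ennreal\<close>, where the values are not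
  elements of a vector space; only genuine beliefs and histories are considered, since only there
  are the recursions controlled.\<close>

definition concave_belief :: "nat \<Rightarrow> (real \<Rightarrow> (nat \<Rightarrow> real^'m) \<Rightarrow> ennreal) \<Rightarrow> bool" where
  "concave_belief k F \<longleftrightarrow> (\<forall>h\<in>space (hist_space k). \<forall>s\<in>{0..1}. \<forall>p\<in>{0..1}. \<forall>q\<in>{0..1}.
     ennreal s * F p h + ennreal (1 - s) * F q h \<le> F (s * p + (1 - s) * q) h)"

text \<open>The decision process is determined by the cost parameter, the hazard and the two
  densities, so dynamic programming is done without reference to an underlying probability
  space.\<close>

locale detection_process =
  fixes lam \<theta> :: real
    and f\<^sub>1 :: "nat \<Rightarrow> (nat \<Rightarrow> real^'m) \<Rightarrow> real^'m \<Rightarrow> real" and f\<^sub>0 :: "real^'m \<Rightarrow> real"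
  assumes lam: "0 < lam" and \<theta>: "0 < \<theta>" "\<theta> < 1"
    and f\<^sub>1_measurable: "\<And>k. (\<lambda>(h, u). f\<^sub>1 k h u) \<in> borel_measurable (hist_space k \<Otimes>\<^sub>M borel)"
    and f\<^sub>1_nonneg: "\<And>k h u. h \<in> space (hist_space k) \<Longrightarrow> 0 \<le> f\<^sub>1 k h u"
    and f\<^sub>1_integral: "\<And>k h. h \<in> space (hist_space k) \<Longrightarrow> (\<integral>\<^sup>+u. ennreal (f\<^sub>1 k h u) \<partial>lborel) = 1"
    and f\<^sub>0_measurable [measurable]: "f\<^sub>0 \<in> borel_measurable borel"
    and f\<^sub>0_nonneg: "\<And>u. 0 \<le> f\<^sub>0 u"
    and f\<^sub>0_integral: "(\<integral>\<^sup>+u. ennreal (f\<^sub>0 u) \<partial>lborel) = 1"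
begin

lemma measurable_f\<^sub>1 [measurable (raw)]:
  assumes [measurable]: "g \<in> measurable N (hist_space k)" "u \<in> borel_measurable N"
  shows "(\<lambda>x. f\<^sub>1 k (g x) (u x)) \<in> borel_measurable N"
  using measurable_compose[OF measurable_Pair[OF assms] f\<^sub>1_measurable[of k]] by simp

lemma measurable_predictive_density [measurable (raw)]:
  assumes [measurable]: "p \<in> borel_measurable N" "g \<in> measurable N (hist_space k)" "u \<in> borel_measurable N"
  shows "(\<lambda>x. predictive_density \<theta> f\<^sub>1 f\<^sub>0 k (p x) (g x) (u x)) \<in> borel_measurable N"
  unfolding predictive_density_def by measurable

lemma measurable_next_belief [measurable (raw)]:
  assumes [measurable]: "p \<in> borel_measurable N" "g \<in> measurable N (hist_space k)" "u \<in> borel_measurable N"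
  shows "(\<lambda>x. next_belief \<theta> f\<^sub>1 f\<^sub>0 k (p x) (g x) (u x)) \<in> borel_measurable N"
  unfolding next_belief_def by measurable

lemma predictive_density_ge:
  assumes "\<pi> \<in> {0..1}" "h \<in> space (hist_space k)"
  shows "0 \<le> f\<^sub>1 k h u * (\<pi> + (1 - \<pi>) * \<theta>)"
    and "f\<^sub>1 k h u * (\<pi> + (1 - \<pi>) * \<theta>) \<le> predictive_density \<theta> f\<^sub>1 f\<^sub>0 k \<pi> h u"
    and "0 \<le> predictive_density \<theta> f\<^sub>1 f\<^sub>0 k \<pi> h u"
  using assms \<theta> f\<^sub>1_nonneg[OF assms(2), of u] f\<^sub>0_nonneg[of u]
  by (auto simp: predictive_density_def mult.commute)

lemma next_belief_bounds:
  assumes "\<pi> \<in> {0..1}" "h \<in> space (hist_space k)"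
  shows "next_belief \<theta> f\<^sub>1 f\<^sub>0 k \<pi> h u \<in> {0..1}"
  using predictive_density_ge[OF assms, of u] by (auto simp: next_belief_def divide_le_eq_1)

text \<open>Bayes' rule with the denominator cleared. It holds also where the predictive density is
  0, because the numerator lies between 0 and that density.\<close>

lemma predictive_density_mult_next_belief:
  assumes "\<pi> \<in> {0..1}" "h \<in> space (hist_space k)"
  shows "predictive_density \<theta> f\<^sub>1 f\<^sub>0 k \<pi> h u * next_belief \<theta> f\<^sub>1 f\<^sub>0 k \<pi> h u = f\<^sub>1 k h u * (\<pi> + (1 - \<pi>) * \<theta>)"
  using predictive_density_ge[OF assms, of u] by (auto simp: next_belief_def)

text \<open>\<open>nn_integral\<close> is monotone without measurability, so stage costs of
  arbitrary policies and infima over policies may be inserted for \<open>F\<close> and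
  \<open>G\<close>.\<close>

lemma next_expectation_mono:
  assumes "\<pi> \<in> {0..1}" "h \<in> space (hist_space k)"
    and "\<And>\<pi> h. \<pi> \<in> {0..1} \<Longrightarrow> h \<in> space (hist_space (Suc k)) \<Longrightarrow> F \<pi> h \<le> G \<pi> h"
  shows "next_expectation \<theta> f\<^sub>1 f\<^sub>0 k \<pi> h F \<le> next_expectation \<theta> f\<^sub>1 f\<^sub>0 k \<pi> h G"
  unfolding next_expectation_def
  using assms by (intro nn_integral_mono mult_left_mono assms next_belief_bounds extend_history) auto

lemma next_expectation_cong:
  assumes "\<pi> \<in> {0..1}" "h \<in> space (hist_space k)"
    and "\<And>\<pi> h. \<pi> \<in> {0..1} \<Longrightarrow> h \<in> space (hist_space (Suc k)) \<Longrightarrow> F \<pi> h = G \<pi> h"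
  shows "next_expectation \<theta> f\<^sub>1 f\<^sub>0 k \<pi> h F = next_expectation \<theta> f\<^sub>1 f\<^sub>0 k \<pi> h G"
  using assms by (intro antisym next_expectation_mono) auto

lemma measurable_next_expectation [measurable (raw)]:
  assumes F: "(\<lambda>(\<pi>, h). F \<pi> h) \<in> borel_measurable (borel \<Otimes>\<^sub>M hist_space (Suc k))"
    and [measurable]: "p \<in> borel_measurable N" "g \<in> measurable N (hist_space k)"
  shows "(\<lambda>x. next_expectation \<theta> f\<^sub>1 f\<^sub>0 k (p x) (g x) F) \<in> borel_measurable N"
proof -
  have [measurable]: "(\<lambda>x. F (p' x) (g' x)) \<in> borel_measurable N'"
    if "p' \<in> borel_measurable N'" "g' \<in> measurable N' (hist_space (Suc k))" for p' g' and N' :: "'b measure"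
    using measurable_compose[OF measurable_Pair[OF that] F] by simp
  show ?thesis
    unfolding next_expectation_def by measurable
qed

section \<open>Value iteration, the Bellman equation and concavity in the belief\<close>

primrec value_iteration :: "nat \<Rightarrow> nat \<Rightarrow> real \<Rightarrow> (nat \<Rightarrow> real^'m) \<Rightarrow> ennreal" where
  "value_iteration 0 k \<pi> h = 0"
| "value_iteration (Suc n) k \<pi> h = min (ennreal (lam * (1 - \<pi>)))
     (ennreal \<pi> + next_expectation \<theta> f\<^sub>1 f\<^sub>0 k \<pi> h (value_iteration n (Suc k)))"

definition value_limit :: "nat \<Rightarrow> real \<Rightarrow> (nat \<Rightarrow> real^'m) \<Rightarrow> ennreal" where
  "value_limit k \<pi> h = (SUP n. value_iteration n k \<pi> h)"

text \<open>The second Bellman term with \<open>value_limit\<close> in place of the optimal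
  cost-to-go; the two agree once the limit is identified with the infimum over policies.\<close>

definition continuation :: "nat \<Rightarrow> real \<Rightarrow> (nat \<Rightarrow> real^'m) \<Rightarrow> ennreal" where
  "continuation k \<pi> h = ennreal \<pi> + next_expectation \<theta> f\<^sub>1 f\<^sub>0 k \<pi> h (value_limit (Suc k))"

lemma value_iteration_measurable:
  "(\<lambda>(\<pi>, h). value_iteration n k \<pi> h) \<in> borel_measurable (borel \<Otimes>\<^sub>M hist_space k)"
proof (induction n arbitrary: k)
  case (Suc n)
  note Suc.IH[of "Suc k", measurable]
  show ?case by (simp add: split_beta')
qed (simp add: split_beta')

lemma value_limit_measurable:
  "(\<lambda>(\<pi>, h). value_limit k \<pi> h) \<in> borel_measurable (borel \<Otimes>\<^sub>M hist_space k)"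
  unfolding value_limit_def split_beta'
  using value_iteration_measurable[unfolded split_beta'] by (intro borel_measurable_SUP) auto

lemma measurable_continuation [measurable (raw)]:
  assumes [measurable]: "p \<in> borel_measurable N" "g \<in> measurable N (hist_space k)"
  shows "(\<lambda>x. continuation k (p x) (g x)) \<in> borel_measurable N"
  unfolding continuation_def using value_limit_measurable[of "Suc k"] by measurable

lemma measurable_value_iteration [measurable (raw)]:
  assumes [measurable]: "p \<in> borel_measurable N" "g \<in> measurable N (hist_space k)"
  shows "(\<lambda>x. value_iteration n k (p x) (g x)) \<in> borel_measurable N"
  using measurable_compose[OF measurable_Pair[OF assms] value_iteration_measurable[of n k]] by simp

lemma value_iteration_mono:
  assumes "\<pi> \<in> {0..1}" "h \<in> space (hist_space k)"
  shows "value_iteration n k \<pi> h \<le> value_iteration (Suc n) k \<pi> h"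
  using assms
proof (induction n arbitrary: k \<pi> h)
  case (Suc n)
  have "ennreal \<pi> + next_expectation \<theta> f\<^sub>1 f\<^sub>0 k \<pi> h (value_iteration n (Suc k)) \<le>
      ennreal \<pi> + next_expectation \<theta> f\<^sub>1 f\<^sub>0 k \<pi> h (value_iteration (Suc n) (Suc k))"
    by (intro add_left_mono next_expectation_mono Suc)
  then show ?case
    by (simp only: value_iteration.simps(2)) (rule min.mono[OF order_refl])
qed simp

lemma incseq_value_iteration:
  "\<pi> \<in> {0..1} \<Longrightarrow> h \<in> space (hist_space k) \<Longrightarrow> incseq (\<lambda>n. value_iteration n k \<pi> h)"
  using value_iteration_mono by (intro incseq_SucI)

lemma value_limit_le_stop: "value_limit k \<pi> h \<le> ennreal (lam * (1 - \<pi>))"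
  unfolding value_limit_def
proof (rule SUP_least)
  show "value_iteration n k \<pi> h \<le> ennreal (lam * (1 - \<pi>))" for n by (cases n) auto
qed

lemma next_expectation_value_limit:
  assumes "\<pi> \<in> {0..1}" and [measurable]: "h \<in> space (hist_space k)"
  shows "next_expectation \<theta> f\<^sub>1 f\<^sub>0 k \<pi> h (value_limit (Suc k)) =
    (SUP n. next_expectation \<theta> f\<^sub>1 f\<^sub>0 k \<pi> h (value_iteration n (Suc k)))"
  unfolding next_expectation_def value_limit_def SUP_mult_left_ennreal
proof (rule nn_integral_monotone_convergence_SUP)
  show "incseq (\<lambda>n u. ennreal (predictive_density \<theta> f\<^sub>1 f\<^sub>0 k \<pi> h u) *
      value_iteration n (Suc k) (next_belief \<theta> f\<^sub>1 f\<^sub>0 k \<pi> h u) (h(Suc k := u)))"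
    using assms by (intro incseq_SucI le_funI mult_left_mono value_iteration_mono next_belief_bounds extend_history) auto
qed measurable

text \<open>The shifted iterates converge to both sides. On the right, monotone convergence carries
  the increasing limit through the integral, and the minimum is continuous.\<close>

lemma bellman:
  assumes "\<pi> \<in> {0..1}" "h \<in> space (hist_space k)"
  shows "value_limit k \<pi> h = min (ennreal (lam * (1 - \<pi>))) (continuation k \<pi> h)"
proof (rule LIMSEQ_unique)
  have inc: "incseq (\<lambda>n. next_expectation \<theta> f\<^sub>1 f\<^sub>0 k \<pi> h (value_iteration n (Suc k)))"
    using assms by (intro incseq_SucI next_expectation_mono value_iteration_mono)
  show "(\<lambda>n. value_iteration (Suc n) k \<pi> h) \<longlonglongrightarrow> value_limit k \<pi> h"
    unfolding value_limit_def by (intro LIMSEQ_Suc LIMSEQ_SUP incseq_value_iteration assms)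
  show "(\<lambda>n. value_iteration (Suc n) k \<pi> h) \<longlonglongrightarrow> min (ennreal (lam * (1 - \<pi>))) (continuation k \<pi> h)"
    unfolding value_iteration.simps continuation_def next_expectation_value_limit[OF assms]
    by (intro tendsto_min tendsto_const tendsto_add LIMSEQ_SUP inc)
qed

text \<open>The continuation value is an integral of perspectives \<open>c F(a / c)\<close> of a concave function, where
  the numerator \<open>a\<close> and the density \<open>c\<close> are affine in the belief.\<close>

lemma concave_next_expectation:
  fixes F :: "real \<Rightarrow> (nat \<Rightarrow> real^'m) \<Rightarrow> ennreal"
  assumes F: "concave_belief (Suc k) F"
    and Fm: "(\<lambda>(\<pi>, h). F \<pi> h) \<in> borel_measurable (borel \<Otimes>\<^sub>M hist_space (Suc k))"
  shows "concave_belief k (\<lambda>\<pi> h. ennreal \<pi> + next_expectation \<theta> f\<^sub>1 f\<^sub>0 k \<pi> h F)"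
  unfolding concave_belief_def
proof (intro ballI)
  fix h :: "nat \<Rightarrow> real^'m" and s p q :: real
  assume [measurable]: "h \<in> space (hist_space k)" and s: "s \<in> {0..1}" and p: "p \<in> {0..1}" and q: "q \<in> {0..1}"
  define r where "r = s * p + (1 - s) * q"
  have r: "r \<in> {0..1}"
    using convexD[OF convex_real_interval(5)[of 0 1], of p q s "1 - s"] s p q by (auto simp: r_def)
  let ?c = "\<lambda>\<pi> u. predictive_density \<theta> f\<^sub>1 f\<^sub>0 k \<pi> h u" and ?b = "\<lambda>\<pi> u. next_belief \<theta> f\<^sub>1 f\<^sub>0 k \<pi> h u"
  let ?F = "\<lambda>\<pi> u. F (?b \<pi> u) (h(Suc k := u))"
  have [measurable]: "(\<lambda>u. ?F \<pi> u) \<in> borel_measurable borel" for \<pi>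
  proof -
    have "(\<lambda>u. (?b \<pi> u, h(Suc k := u))) \<in> measurable borel (borel \<Otimes>\<^sub>M hist_space (Suc k))" by measurable
    from measurable_compose[OF this Fm] show ?thesis by simp
  qed
  have h: "h \<in> space (hist_space k)" by fact
  have "ennreal s * next_expectation \<theta> f\<^sub>1 f\<^sub>0 k p h F + ennreal (1 - s) * next_expectation \<theta> f\<^sub>1 f\<^sub>0 k q h F =
      (\<integral>\<^sup>+u. ennreal s * (ennreal (?c p u) * ?F p u) + ennreal (1 - s) * (ennreal (?c q u) * ?F q u) \<partial>lborel)"
    unfolding next_expectation_def by (simp add: nn_integral_add nn_integral_cmult)
  also have "\<dots> \<le> next_expectation \<theta> f\<^sub>1 f\<^sub>0 k r h F"
    unfolding next_expectation_def
  proof (rule nn_integral_mono)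
    fix u
    have cp: "0 \<le> ?c p u" and cq: "0 \<le> ?c q u" and cr: "0 \<le> ?c r u"
      using h p q r by (auto intro: predictive_density_ge)
    have c: "?c r u = s * ?c p u + (1 - s) * ?c q u"
      by (simp add: predictive_density_def r_def algebra_simps)
    have a: "?c r u * ?b r u = s * (?c p u * ?b p u) + (1 - s) * (?c q u * ?b q u)"
      using h p q r by (simp add: predictive_density_mult_next_belief) (simp add: r_def algebra_simps)
    show "ennreal s * (ennreal (?c p u) * ?F p u) + ennreal (1 - s) * (ennreal (?c q u) * ?F q u) \<le>
        ennreal (?c r u) * ?F r u"
      using F[unfolded concave_belief_def, rule_format, OF extend_history[OF h]]
      by (rule concave_perspective[OF _ s _ _ cp cq c a]) (use h p q next_belief_bounds in simp_all)
  qed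
  finally have "ennreal s * next_expectation \<theta> f\<^sub>1 f\<^sub>0 k p h F + ennreal (1 - s) * next_expectation \<theta> f\<^sub>1 f\<^sub>0 k q h F
      \<le> next_expectation \<theta> f\<^sub>1 f\<^sub>0 k r h F" .
  moreover have "ennreal s * ennreal p + ennreal (1 - s) * ennreal q = ennreal r"
    using s p q by (simp add: r_def ennreal_mult'[symmetric] ennreal_plus[symmetric] del: ennreal_plus)
  moreover have "ennreal s * (ennreal p + x) + ennreal (1 - s) * (ennreal q + y) =
      (ennreal s * ennreal p + ennreal (1 - s) * ennreal q) + (ennreal s * x + ennreal (1 - s) * y)" for x y
    by (simp only: distrib_left add_ac)
  ultimately show "ennreal s * (ennreal p + next_expectation \<theta> f\<^sub>1 f\<^sub>0 k p h F) +
      ennreal (1 - s) * (ennreal q + next_expectation \<theta> f\<^sub>1 f\<^sub>0 k q h F)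
    \<le> ennreal (s * p + (1 - s) * q) + next_expectation \<theta> f\<^sub>1 f\<^sub>0 k (s * p + (1 - s) * q) h F"
    unfolding r_def[symmetric] by (simp only: add_left_mono)
qed

text \<open>The stopping cost is affine in the belief, and the minimum of an affine and a concave
  function is concave.\<close>

lemma concave_value_iteration: "concave_belief k (value_iteration n k)"
proof (induction n arbitrary: k)
  case 0
  then show ?case by (simp add: concave_belief_def)
next
  case (Suc n)
  have IH: "concave_belief k (\<lambda>\<pi> h. ennreal \<pi> + next_expectation \<theta> f\<^sub>1 f\<^sub>0 k \<pi> h (value_iteration n (Suc k)))"
    by (intro concave_next_expectation Suc value_iteration_measurable)
  show ?case
    unfolding concave_belief_def
  proof (intro ballI)
    fix h :: "nat \<Rightarrow> real^'m" and s p q :: real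
    assume h: "h \<in> space (hist_space k)" and s: "s \<in> {0..1}" and p: "p \<in> {0..1}" and q: "q \<in> {0..1}"
    have "ennreal s * ennreal (lam * (1 - p)) + ennreal (1 - s) * ennreal (lam * (1 - q)) =
        ennreal (lam * (1 - (s * p + (1 - s) * q)))"
      using s p q lam
      by (simp add: ennreal_mult'[symmetric] ennreal_plus[symmetric] del: ennreal_plus) (simp add: algebra_simps)
    moreover have "ennreal s * value_iteration (Suc n) k p h + ennreal (1 - s) * value_iteration (Suc n) k q h
        \<le> ennreal s * ennreal (lam * (1 - p)) + ennreal (1 - s) * ennreal (lam * (1 - q))"
      by (intro add_mono mult_left_mono) auto
    moreover have "ennreal s * value_iteration (Suc n) k p h + ennreal (1 - s) * value_iteration (Suc n) k q h
        \<le> ennreal s * (ennreal p + next_expectation \<theta> f\<^sub>1 f\<^sub>0 k p h (value_iteration n (Suc k))) +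
          ennreal (1 - s) * (ennreal q + next_expectation \<theta> f\<^sub>1 f\<^sub>0 k q h (value_iteration n (Suc k)))"
      by (intro add_mono mult_left_mono) auto
    ultimately show "ennreal s * value_iteration (Suc n) k p h + ennreal (1 - s) * value_iteration (Suc n) k q h
        \<le> value_iteration (Suc n) k (s * p + (1 - s) * q) h"
      using IH[unfolded concave_belief_def, rule_format, OF h s p q] by (auto intro: order_trans)
  qed
qed

text \<open>A supremum of concave functions need not be concave; here the iterates increase, so a
  sum of suprema is the supremum of the sums.\<close>

lemma concave_value_limit: "concave_belief k (value_limit k)"
  unfolding concave_belief_def
proof (intro ballI)
  fix h :: "nat \<Rightarrow> real^'m" and s p q :: real
  assume h: "h \<in> space (hist_space k)" and s: "s \<in> {0..1}" and p: "p \<in> {0..1}" and q: "q \<in> {0..1}"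
  have inc: "incseq (\<lambda>n. ennreal s * value_iteration n k p h)" "incseq (\<lambda>n. ennreal (1 - s) * value_iteration n k q h)"
    using h p q by (auto intro!: incseq_SucI mult_left_mono value_iteration_mono simp del: value_iteration.simps)
  have "ennreal s * value_limit k p h + ennreal (1 - s) * value_limit k q h =
      (SUP n. ennreal s * value_iteration n k p h + ennreal (1 - s) * value_iteration n k q h)"
    unfolding value_limit_def SUP_mult_left_ennreal by (rule ennreal_SUP_add[OF inc, symmetric])
  also have "\<dots> \<le> value_limit k (s * p + (1 - s) * q) h"
    unfolding value_limit_def using concave_value_iteration[of k] h s p q
    by (intro SUP_mono') (simp add: concave_belief_def)
  finally show "ennreal s * value_limit k p h + ennreal (1 - s) * value_limit k q h
      \<le> value_limit k (s * p + (1 - s) * q) h" .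
qed

lemma concave_continuation: "concave_belief k (continuation k)"
  unfolding continuation_def[abs_def]
  by (intro concave_next_expectation concave_value_limit value_limit_measurable)

section \<open>Bounds on the continuation value and the threshold\<close>

text \<open>Stopping right after the next observation is one option. Its false-alarm cost integrates
  to \<open>lam\<close> times the predicted probability \<open>(1 - \<pi>) * (1 - \<theta>)\<close>
  that the attack has still not begun.\<close>

lemma continuation_le:
  assumes \<pi>: "\<pi> \<in> {0..1}" and h[measurable]: "h \<in> space (hist_space k)"
  shows "continuation k \<pi> h \<le> ennreal (\<pi> + lam * (1 - \<pi>) * (1 - \<theta>))"
proof -
  let ?c = "\<lambda>u. predictive_density \<theta> f\<^sub>1 f\<^sub>0 k \<pi> h u" and ?b = "\<lambda>u. next_belief \<theta> f\<^sub>1 f\<^sub>0 k \<pi> h u"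
  have "next_expectation \<theta> f\<^sub>1 f\<^sub>0 k \<pi> h (value_limit (Suc k)) \<le>
      (\<integral>\<^sup>+u. ennreal (?c u) * ennreal (lam * (1 - ?b u)) \<partial>lborel)"
    unfolding next_expectation_def by (intro nn_integral_mono mult_left_mono value_limit_le_stop) auto
  also have "\<dots> = (\<integral>\<^sup>+u. ennreal (lam * (1 - \<pi>) * (1 - \<theta>)) * ennreal (f\<^sub>0 u) \<partial>lborel)"
  proof (rule nn_integral_cong)
    fix u
    have "?c u * (lam * (1 - ?b u)) = lam * (?c u - ?c u * ?b u)" by (simp add: algebra_simps)
    also have "\<dots> = lam * (1 - \<pi>) * (1 - \<theta>) * f\<^sub>0 u"
      unfolding predictive_density_mult_next_belief[OF \<pi> h] by (simp add: predictive_density_def algebra_simps)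
    finally show "ennreal (?c u) * ennreal (lam * (1 - ?b u)) = ennreal (lam * (1 - \<pi>) * (1 - \<theta>)) * ennreal (f\<^sub>0 u)"
      using predictive_density_ge(3)[OF \<pi> h, of u] lam \<theta> \<pi> f\<^sub>0_nonneg[of u] next_belief_bounds[OF \<pi> h, of u]
      by (simp add: ennreal_mult''[symmetric])
  qed
  also have "\<dots> = ennreal (lam * (1 - \<pi>) * (1 - \<theta>))"
    by (simp add: nn_integral_cmult f\<^sub>0_integral)
  finally show ?thesis
    using lam \<theta> \<pi> by (simp add: continuation_def ennreal_plus add_left_mono)
qed

text \<open>Permits passing to real numbers, where the difference from the stopping cost can be
  formed.\<close>

lemma continuation_finite:
  assumes "\<pi> \<in> {0..1}" "h \<in> space (hist_space k)"
  shows "continuation k \<pi> h = ennreal (enn2real (continuation k \<pi> h))"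
  using continuation_le[OF assms] by (metis ennreal_enn2real infinity_ennreal_def ennreal_less_top order_le_less_trans)

lemma exists_threshold:
  assumes h: "h \<in> space (hist_space k)"
  shows "\<exists>\<Gamma>\<in>{0..1}. \<forall>\<pi>\<in>{0..1}.
    (\<pi> > \<Gamma> \<longrightarrow> ennreal (lam * (1 - \<pi>)) < continuation k \<pi> h) \<and>
    (\<pi> < \<Gamma> \<longrightarrow> continuation k \<pi> h < ennreal (lam * (1 - \<pi>))) \<and>
    (\<pi> = \<Gamma> \<longrightarrow> continuation k \<pi> h = ennreal (lam * (1 - \<pi>)))"
proof -
  define c where "c \<pi> = enn2real (continuation k \<pi> h)" for \<pi>
  have c: "continuation k \<pi> h = ennreal (c \<pi>)" if "\<pi> \<in> {0..1}" for \<pi>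
    using continuation_finite[OF that h] by (simp add: c_def)
  have c0: "0 \<le> c \<pi>" for \<pi> by (simp add: c_def)
  have up: "c \<pi> \<le> \<pi> + lam * (1 - \<pi>) * (1 - \<theta>)" if "\<pi> \<in> {0..1}" for \<pi>
  proof -
    have "0 \<le> \<pi> + lam * (1 - \<pi>) * (1 - \<theta>)" using that lam \<theta> by (intro add_nonneg_nonneg mult_nonneg_nonneg) auto
    then show ?thesis using continuation_le[OF that h] by (simp add: c[OF that])
  qed
  have low: "\<pi> \<le> c \<pi>" if "\<pi> \<in> {0..1}" for \<pi>
  proof -
    have "ennreal \<pi> \<le> continuation k \<pi> h" by (simp add: continuation_def)
    then show ?thesis using that by (simp add: c[OF that] c0)
  qed
  have conc: "s * c p + (1 - s) * c q \<le> c (s * p + (1 - s) * q)"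
    if "s \<in> {0..1}" "p \<in> {0..1}" "q \<in> {0..1}" for s p q
  proof -
    have "s * p + (1 - s) * q \<in> {0..1}"
      using convexD[OF convex_real_interval(5)[of 0 1], of p q s "1 - s"] that by auto
    then have "ennreal s * ennreal (c p) + ennreal (1 - s) * ennreal (c q) \<le> ennreal (c (s * p + (1 - s) * q))"
      using concave_continuation[of k, unfolded concave_belief_def, rule_format, OF h that] that
      by (simp add: c)
    then show ?thesis
      using that c0 by (simp add: ennreal_mult'[symmetric] ennreal_plus[symmetric] del: ennreal_plus)
  qed
  have "\<exists>\<Gamma>\<in>{0..1}. \<forall>p\<in>{0..1}. (p > \<Gamma> \<longrightarrow> c p - lam * (1 - p) > 0) \<and>
      (p < \<Gamma> \<longrightarrow> c p - lam * (1 - p) < 0) \<and> (p = \<Gamma> \<longrightarrow> c p - lam * (1 - p) = 0)"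
  \<comment> \<open>\<open>lam * \<theta>\<close> is the coefficient left after subtracting the
    stopping cost from the one-step bound; \<open>lam\<close> results from bounding the continuation
    value below by the current stage cost alone.\<close>
  proof (rule concave_sign_change[of "\<lambda>p. c p - lam * (1 - p)" "lam * \<theta>" lam])
    fix s p q :: real assume "s \<in> {0..1}" "p \<in> {0..1}" "q \<in> {0..1}"
    from conc[OF this] show "s * (c p - lam * (1 - p)) + (1 - s) * (c q - lam * (1 - q))
        \<le> c (s * p + (1 - s) * q) - lam * (1 - (s * p + (1 - s) * q))"
      by (simp add: algebra_simps)
  next
    fix p :: real assume "p \<in> {0..1}"
    from up[OF this] show "c p - lam * (1 - p) \<le> p - lam * \<theta> * (1 - p)" by (simp add: algebra_simps)
  next
    fix p :: real assume "p \<in> {0..1}"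
    from low[OF this] show "p - lam * (1 - p) \<le> c p - lam * (1 - p)" by simp
  qed (use lam \<theta> in auto)
  then obtain \<Gamma> where \<Gamma>: "\<Gamma> \<in> {0..1}"
    and sgn: "\<forall>p\<in>{0..1}. (p > \<Gamma> \<longrightarrow> c p - lam * (1 - p) > 0) \<and>
      (p < \<Gamma> \<longrightarrow> c p - lam * (1 - p) < 0) \<and> (p = \<Gamma> \<longrightarrow> c p - lam * (1 - p) = 0)" ..
  show ?thesis
  proof (intro bexI[of _ \<Gamma>] ballI \<Gamma>)
    fix \<pi> :: real assume \<pi>: "\<pi> \<in> {0..1}"
    have "ennreal (lam * (1 - \<pi>)) < continuation k \<pi> h \<longleftrightarrow> c \<pi> - lam * (1 - \<pi>) > 0"
      "continuation k \<pi> h < ennreal (lam * (1 - \<pi>)) \<longleftrightarrow> c \<pi> - lam * (1 - \<pi>) < 0"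
      "continuation k \<pi> h = ennreal (lam * (1 - \<pi>)) \<longleftrightarrow> c \<pi> - lam * (1 - \<pi>) = 0"
      using \<pi> lam c0[of \<pi>] by (simp_all add: c[OF \<pi>] ennreal_less_iff)
    then show "(\<pi> > \<Gamma> \<longrightarrow> ennreal (lam * (1 - \<pi>)) < continuation k \<pi> h) \<and>
        (\<pi> < \<Gamma> \<longrightarrow> continuation k \<pi> h < ennreal (lam * (1 - \<pi>))) \<and>
        (\<pi> = \<Gamma> \<longrightarrow> continuation k \<pi> h = ennreal (lam * (1 - \<pi>)))"
      using sgn \<pi> by blast
  qed
qed

section \<open>Policies attaining the optimal cost-to-go\<close>

text \<open>Policies see only the history, so a policy for the state \<open>(\<pi>, h)\<close> at time \<open>k\<close> has to
  recompute the current belief from \<open>\<pi>\<close> and the observations made after time \<open>k\<close>.\<close>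

primrec belief_from :: "nat \<Rightarrow> real \<Rightarrow> nat \<Rightarrow> (nat \<Rightarrow> real^'m) \<Rightarrow> real" where
  "belief_from k \<pi> 0 h = \<pi>"
| "belief_from k \<pi> (Suc j) h = (if j < k then \<pi> else
     next_belief \<theta> f\<^sub>1 f\<^sub>0 j (belief_from k \<pi> j (restrict h {1..j})) (restrict h {1..j}) (h (Suc j)))"

text \<open>Compares the two Bellman terms, with ties resolved towards \<open>Stop\<close>.
  Comparing costs rather than a belief with a threshold lets measurability follow from that of
  \<open>continuation\<close>.\<close>

definition greedy :: "nat \<Rightarrow> real \<Rightarrow> nat \<Rightarrow> (nat \<Rightarrow> real^'m) \<Rightarrow> action" where
  "greedy k \<pi> j h = (if ennreal (lam * (1 - belief_from k \<pi> j h)) \<le> continuation j (belief_from k \<pi> j h) h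
     then Stop else Continue)"

lemma belief_from_start: "belief_from k \<pi> k h = \<pi>"
  by (cases k) auto

lemma belief_from_extend:
  "k \<le> j \<Longrightarrow> h \<in> space (hist_space j) \<Longrightarrow>
    belief_from k \<pi> (Suc j) (h(Suc j := u)) = next_belief \<theta> f\<^sub>1 f\<^sub>0 j (belief_from k \<pi> j h) h u"
  by (simp add: restrict_history)

lemma belief_from_bounds:
  "\<pi> \<in> {0..1} \<Longrightarrow> h \<in> space (hist_space j) \<Longrightarrow> belief_from k \<pi> j h \<in> {0..1}"
proof (induction j arbitrary: h)
  case (Suc j)
  have "restrict h {1..j} \<in> space (hist_space j)" using Suc.prems by (auto simp: space_PiM)
  then show ?case using Suc by (auto simp: next_belief_bounds[simplified])
qed simp

lemma belief_from_measurable [measurable]: "belief_from k \<pi> j \<in> borel_measurable (hist_space j)"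
proof (induction j)
  case (Suc j)
  note [measurable] = Suc
  have [measurable]: "(\<lambda>h. h (Suc j)) \<in> borel_measurable (hist_space (Suc j))"
    by (rule measurable_component_singleton) simp
  show ?case by (simp add: measurable_If[OF measurable_const])
qed (simp add: belief_from.simps(1)[abs_def])

lemma greedy_policy: "greedy k \<pi> \<in> policies"
  unfolding policies_def greedy_def[abs_def] by auto measurable

text \<open>Along the recomputed beliefs every greedy action attains the Bellman minimum, and
  cutting off after \<open>n\<close> stages can only lower the cost.\<close>

lemma stages_cost_greedy_le:
  assumes "k \<le> j" "\<pi> \<in> {0..1}" "h \<in> space (hist_space j)"
  shows "stages_cost lam \<theta> f\<^sub>1 f\<^sub>0 (greedy k \<pi>) n j (belief_from k \<pi> j h) h \<le> value_limit j (belief_from k \<pi> j h) h"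
  using assms
proof (induction n arbitrary: j h)
  case (Suc n)
  let ?p = "belief_from k \<pi> j h"
  have p: "?p \<in> {0..1}" using Suc.prems by (intro belief_from_bounds)
  have "next_expectation \<theta> f\<^sub>1 f\<^sub>0 j ?p h (stages_cost lam \<theta> f\<^sub>1 f\<^sub>0 (greedy k \<pi>) n (Suc j)) \<le>
      next_expectation \<theta> f\<^sub>1 f\<^sub>0 j ?p h (value_limit (Suc j))"
    unfolding next_expectation_def
  proof (intro nn_integral_mono mult_left_mono)
    fix u
    show "stages_cost lam \<theta> f\<^sub>1 f\<^sub>0 (greedy k \<pi>) n (Suc j) (next_belief \<theta> f\<^sub>1 f\<^sub>0 j ?p h u) (h(Suc j := u))
        \<le> value_limit (Suc j) (next_belief \<theta> f\<^sub>1 f\<^sub>0 j ?p h u) (h(Suc j := u))"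
      unfolding belief_from_extend[OF Suc.prems(1,3), symmetric]
      by (rule Suc.IH[OF _ _ extend_history]) (use Suc.prems in simp_all)
  qed simp
  then have "ennreal ?p + next_expectation \<theta> f\<^sub>1 f\<^sub>0 j ?p h (stages_cost lam \<theta> f\<^sub>1 f\<^sub>0 (greedy k \<pi>) n (Suc j))
      \<le> continuation j ?p h"
    unfolding continuation_def by (rule add_left_mono)
  then show ?case
    unfolding bellman[OF p Suc.prems(3)] by (auto simp: greedy_def[of k \<pi> j h] not_le min_def)
qed simp

text \<open>Each stage of a policy incurs one of the two terms whose minimum defines the
  iterate.\<close>

lemma stages_cost_ge:
  assumes "\<pi> \<in> {0..1}" "h \<in> space (hist_space k)"
  shows "value_iteration n k \<pi> h \<le> stages_cost lam \<theta> f\<^sub>1 f\<^sub>0 \<mu> n k \<pi> h"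
  using assms
proof (induction n arbitrary: k \<pi> h)
  case (Suc n)
  have "next_expectation \<theta> f\<^sub>1 f\<^sub>0 k \<pi> h (value_iteration n (Suc k)) \<le>
      next_expectation \<theta> f\<^sub>1 f\<^sub>0 k \<pi> h (stages_cost lam \<theta> f\<^sub>1 f\<^sub>0 \<mu> n (Suc k))"
    by (intro next_expectation_mono Suc)
  then show ?case
    by (cases "\<mu> k h") (auto intro: min.coboundedI2 add_left_mono)
qed simp

text \<open>The infimum is attained by the greedy policy built for this particular state; the belief
  being invisible to policies, other states have their own greedy policies.\<close>

lemma optimal_cost_to_go_eq:
  assumes "\<pi> \<in> {0..1}" "h \<in> space (hist_space k)"
  shows "optimal_cost_to_go lam \<theta> f\<^sub>1 f\<^sub>0 k \<pi> h = value_limit k \<pi> h"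
proof (rule antisym)
  have "cost_to_go lam \<theta> f\<^sub>1 f\<^sub>0 (greedy k \<pi>) k \<pi> h \<le> value_limit k \<pi> h"
    using stages_cost_greedy_le[of k k \<pi> h] assms
    by (auto simp: cost_to_go_def belief_from_start intro!: SUP_least)
  then show "optimal_cost_to_go lam \<theta> f\<^sub>1 f\<^sub>0 k \<pi> h \<le> value_limit k \<pi> h"
    unfolding optimal_cost_to_go_def by (rule INF_lower2[OF greedy_policy])
  show "value_limit k \<pi> h \<le> optimal_cost_to_go lam \<theta> f\<^sub>1 f\<^sub>0 k \<pi> h"
    unfolding optimal_cost_to_go_def cost_to_go_def value_limit_def
    by (intro INF_greatest SUP_mono) (use stages_cost_ge[OF assms] in auto)
qed

lemma action_value_Continue:
  assumes "\<pi> \<in> {0..1}" "h \<in> space (hist_space k)"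
  shows "action_value lam \<theta> f\<^sub>1 f\<^sub>0 k \<pi> h Continue = continuation k \<pi> h"
  using next_expectation_cong[OF assms optimal_cost_to_go_eq] by (simp add: continuation_def)

lemma optimal_actions_eq:
  assumes "\<pi> \<in> {0..1}" "h \<in> space (hist_space k)"
  shows "optimal_actions lam \<theta> f\<^sub>1 f\<^sub>0 k \<pi> h =
    (if ennreal (lam * (1 - \<pi>)) < continuation k \<pi> h then {Stop}
     else if continuation k \<pi> h < ennreal (lam * (1 - \<pi>)) then {Continue} else {Stop, Continue})"
proof -
  have all: "(\<forall>a. P a) \<longleftrightarrow> P Stop \<and> P Continue" for P by (metis action.exhaust)
  show ?thesis
    unfolding optimal_actions_def all action_value_Continue[OF assms] action_value.simps(1)
    by (auto simp: set_eq_iff all action_value_Continue[OF assms] simp del: action_value.simps(2))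
qed

lemma optimal_action_value:
  assumes "\<pi> \<in> {0..1}" "h \<in> space (hist_space k)" "a \<in> optimal_actions lam \<theta> f\<^sub>1 f\<^sub>0 k \<pi> h"
  shows "(case a of Continue \<Rightarrow> continuation k \<pi> h | Stop \<Rightarrow> ennreal (lam * (1 - \<pi>))) = value_limit k \<pi> h"
  using assms(3) unfolding optimal_actions_eq[OF assms(1,2)] bellman[OF assms(1,2)]
  by (auto split: if_splits simp: min_def)

end

section \<open>Costs of policies as expectations over beliefs\<close>

text \<open>\<open>conditional_density\<close> tests the density on rectangles only. Rectangles form
  an intersection-stable generator, so two joint laws of history and next innovation coincide, and
  with them all integrals. Measurability is asked of the indicator because \<open>E\<close> may
  reach outside \<open>space M\<close>.\<close>

lemma nn_integral_conditional_density:
  fixes zt :: "nat \<Rightarrow> 'a \<Rightarrow> real^'m" and G :: "(nat \<Rightarrow> real^'m) \<Rightarrow> real^'m \<Rightarrow> ennreal"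
  assumes "prob_space M" and f: "conditional_density M zt E k f"
    and E[measurable]: "(indicator E :: 'a \<Rightarrow> ennreal) \<in> borel_measurable M"
    and hist[measurable]: "history zt k \<in> measurable M (hist_space k)" and [measurable]: "zt (Suc k) \<in> borel_measurable M"
    and G: "(\<lambda>(h, u). G h u) \<in> borel_measurable (hist_space k \<Otimes>\<^sub>M borel)"
  shows "(\<integral>\<^sup>+\<omega>. indicator E \<omega> * G (history zt k \<omega>) (zt (Suc k) \<omega>) \<partial>M) =
    (\<integral>\<^sup>+\<omega>. indicator E \<omega> * (\<integral>\<^sup>+u. ennreal (f (history zt k \<omega>) u) * G (history zt k \<omega>) u \<partial>lborel) \<partial>M)"
proof -
  interpret prob_space M by fact
  have f_meas: "(\<lambda>(h, u). f h u) \<in> borel_measurable (hist_space k \<Otimes>\<^sub>M borel)"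
    and f_law: "\<And>B D. B \<in> sets (hist_space k) \<Longrightarrow> D \<in> sets borel \<Longrightarrow>
        emeasure M {\<omega> \<in> space M. \<omega> \<in> E \<and> history zt k \<omega> \<in> B \<and> zt (Suc k) \<omega> \<in> D} =
        (\<integral>\<^sup>+\<omega>. indicator {\<omega>. \<omega> \<in> E \<and> history zt k \<omega> \<in> B} \<omega> *
              (\<integral>\<^sup>+u. indicator D u * ennreal (f (history zt k \<omega>) u) \<partial>lborel) \<partial>M)"
    using f by (auto simp: conditional_density_def)
  have [measurable]: "(\<lambda>x. f (fst x) (snd x)) \<in> borel_measurable (hist_space k \<Otimes>\<^sub>M borel)"
    using f_meas by (simp add: split_beta')
  have [measurable]: "(\<lambda>x. G (fst x) (snd x)) \<in> borel_measurable (hist_space k \<Otimes>\<^sub>M borel)"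
    using G by (simp add: split_beta')
  have [measurable]: "(\<lambda>x. f (g x) (u x)) \<in> borel_measurable N"
    if "g \<in> measurable N (hist_space k)" "u \<in> borel_measurable N" for g u and N :: "'b measure"
    using measurable_compose[OF measurable_Pair[OF that] f_meas] by simp
  have [measurable]: "(\<lambda>x. G (g x) (u x)) \<in> borel_measurable N"
    if "g \<in> measurable N (hist_space k)" "u \<in> borel_measurable N" for g u and N :: "'b measure"
    using measurable_compose[OF measurable_Pair[OF that] G] by simp
  \<comment> \<open>\<open>M\<close> restricted to \<open>E\<close> without normalization, since the
    probability of \<open>E\<close> might be 0.\<close>
  define N where "N = density M (indicator E)"
  have N[measurable_cong, simp]: "sets N = sets M" "space N = space M" by (simp_all add: N_def)
  have nnN: "(\<integral>\<^sup>+\<omega>. g \<omega> \<partial>N) = (\<integral>\<^sup>+\<omega>. indicator E \<omega> * g \<omega> \<partial>M)" if "g \<in> borel_measurable M" for g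
    unfolding N_def using that by (simp add: nn_integral_density)
  have Nfin: "emeasure N (space M) \<noteq> \<infinity>"
  proof -
    have "emeasure N (space M) = (\<integral>\<^sup>+\<omega>. 1 \<partial>N)" by simp
    also have "\<dots> = (\<integral>\<^sup>+\<omega>. indicator E \<omega> * 1 \<partial>M)" by (rule nnN) simp
    also have "\<dots> \<le> (\<integral>\<^sup>+\<omega>. 1 \<partial>M)" by (intro nn_integral_mono) (simp add: indicator_def)
    finally have "emeasure N (space M) \<le> 1" by (simp add: emeasure_space_1)
    then show ?thesis by (metis ennreal_one_less_top infinity_ennreal_def not_less)
  qed
  define \<rho> where "\<rho> = distr N (hist_space k) (history zt k)"
  have [measurable_cong, simp]: "sets \<rho> = sets (hist_space k)" by (simp add: \<rho>_def)
  have sp[simp]: "space \<rho> = space (hist_space k)" by (simp add: \<rho>_def)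
  interpret \<rho>: finite_measure \<rho>
  proof
    have "history zt k -` space (hist_space k) \<inter> space M = space M"
      using measurable_space[OF hist] by auto
    then show "emeasure \<rho> (space \<rho>) \<noteq> \<infinity>"
      using Nfin unfolding \<rho>_def by (simp add: emeasure_distr)
  qed
  interpret pair_sigma_finite \<rho> lborel ..
  let ?L = "distr N (hist_space k \<Otimes>\<^sub>M borel) (\<lambda>\<omega>. (history zt k \<omega>, zt (Suc k) \<omega>))"
  let ?R = "density (\<rho> \<Otimes>\<^sub>M lborel) (\<lambda>x. ennreal (f (fst x) (snd x)))"
  have "?L = ?R"
  proof (rule measure_eqI_generator_eq[OF Int_stable_pair_measure_generator[of "hist_space k" borel]])
    let ?E = "{B \<times> D |B D. B \<in> sets (hist_space k :: (nat \<Rightarrow> real^'m) measure) \<and> D \<in> sets (borel :: (real^'m) measure)}"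
    let ?\<Omega> = "space (hist_space k :: (nat \<Rightarrow> real^'m) measure) \<times> (UNIV :: (real^'m) set)"
    show "?E \<subseteq> Pow ?\<Omega>" using sets.space_closed[of "hist_space k"] by auto
    show "sets ?L = sigma_sets ?\<Omega> ?E" by (simp add: sets_pair_measure)
    have "sets (\<rho> \<Otimes>\<^sub>M lborel) = sets (hist_space k \<Otimes>\<^sub>M borel)" by (rule sets_pair_measure_cong) auto
    then show "sets ?R = sigma_sets ?\<Omega> ?E" by (simp add: sets_pair_measure)
    have "?\<Omega> \<in> ?E"
      by (intro CollectI exI[of _ "space (hist_space k)"] exI[of _ UNIV] conjI refl sets.top) simp
    then show "range (\<lambda>_::nat. ?\<Omega>) \<subseteq> ?E" by blast
    show "(\<Union>i::nat. ?\<Omega>) = ?\<Omega>" by auto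
    show "emeasure ?L ?\<Omega> \<noteq> \<infinity>" for i :: nat
    proof -
      have "(\<lambda>\<omega>. (history zt k \<omega>, zt (Suc k) \<omega>)) -` ?\<Omega> \<inter> space M = space M"
        using measurable_space[OF hist] by auto
      then show ?thesis using Nfin by (subst emeasure_distr) simp_all
    qed
    fix X assume "X \<in> ?E"
    then obtain B D where X: "X = B \<times> D" and [measurable]: "B \<in> sets (hist_space k)" "D \<in> sets borel" by auto
    have "emeasure ?L X = (\<integral>\<^sup>+\<omega>. indicator B (history zt k \<omega>) * indicator D (zt (Suc k) \<omega>) \<partial>N)"
      unfolding X
      by (subst nn_integral_indicator[symmetric], simp, subst nn_integral_distr) (auto simp: indicator_times)
    also have "\<dots> = (\<integral>\<^sup>+\<omega>. indicator {\<omega> \<in> space M. \<omega> \<in> E \<and> history zt k \<omega> \<in> B \<and> zt (Suc k) \<omega> \<in> D} \<omega> \<partial>M)"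
      by (subst nnN) (auto intro!: nn_integral_cong simp: indicator_def)
    also have "\<dots> = emeasure M {\<omega> \<in> space M. \<omega> \<in> E \<and> history zt k \<omega> \<in> B \<and> zt (Suc k) \<omega> \<in> D}"
    proof (rule nn_integral_indicator)
      have "{\<omega> \<in> space M. \<omega> \<in> E \<and> history zt k \<omega> \<in> B \<and> zt (Suc k) \<omega> \<in> D} =
        {\<omega> \<in> space M. indicator E \<omega> = (1::ennreal) \<and> history zt k \<omega> \<in> B \<and> zt (Suc k) \<omega> \<in> D}"
        by (auto simp: indicator_def)
      also have "\<dots> \<in> sets M" by measurable
      finally show "{\<omega> \<in> space M. \<omega> \<in> E \<and> history zt k \<omega> \<in> B \<and> zt (Suc k) \<omega> \<in> D} \<in> sets M" .
    qed
    also have "\<dots> = (\<integral>\<^sup>+\<omega>. indicator E \<omega> * (indicator B (history zt k \<omega>) *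
              (\<integral>\<^sup>+u. indicator D u * ennreal (f (history zt k \<omega>) u) \<partial>lborel)) \<partial>M)"
      by (subst f_law) (auto intro!: nn_integral_cong simp: indicator_def)
    also have "\<dots> = (\<integral>\<^sup>+h. indicator B h * (\<integral>\<^sup>+u. indicator D u * ennreal (f h u) \<partial>lborel) \<partial>\<rho>)"
      unfolding \<rho>_def by (subst nn_integral_distr) (auto simp: nnN)
    also have "\<dots> = (\<integral>\<^sup>+h. (\<integral>\<^sup>+u. indicator B h * (indicator D u * ennreal (f h u)) \<partial>lborel) \<partial>\<rho>)"
      by (intro nn_integral_cong nn_integral_cmult[symmetric]) measurable
    also have "\<dots> = (\<integral>\<^sup>+x. indicator B (fst x) * (indicator D (snd x) * ennreal (f (fst x) (snd x))) \<partial>(\<rho> \<Otimes>\<^sub>M lborel))"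
      by (subst lborel.nn_integral_fst[symmetric]) auto
    also have "\<dots> = emeasure ?R X"
      unfolding X by (subst emeasure_density) (auto intro!: nn_integral_cong simp: indicator_def)
    finally show "emeasure ?L X = emeasure ?R X" .
  qed
  have "(\<integral>\<^sup>+\<omega>. indicator E \<omega> * G (history zt k \<omega>) (zt (Suc k) \<omega>) \<partial>M) = (\<integral>\<^sup>+x. G (fst x) (snd x) \<partial>?L)"
    by (subst nn_integral_distr) (auto simp: nnN)
  also have "\<dots> = (\<integral>\<^sup>+x. ennreal (f (fst x) (snd x)) * G (fst x) (snd x) \<partial>(\<rho> \<Otimes>\<^sub>M lborel))"
    unfolding \<open>?L = ?R\<close> by (subst nn_integral_density) auto
  also have "\<dots> = (\<integral>\<^sup>+h. (\<integral>\<^sup>+u. ennreal (f h u) * G h u \<partial>lborel) \<partial>\<rho>)"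
    by (subst lborel.nn_integral_fst[symmetric]) auto
  also have "\<dots> = (\<integral>\<^sup>+\<omega>. indicator E \<omega> * (\<integral>\<^sup>+u. ennreal (f (history zt k \<omega>) u) * G (history zt k \<omega>) u \<partial>lborel) \<partial>M)"
    unfolding \<rho>_def by (subst nn_integral_distr) (auto simp: nnN)
  finally show ?thesis .
qed

section \<open>Stopping times and costs as sums over stages\<close>

lemma history_Suc: "history zt (Suc k) \<omega> = (history zt k \<omega>)(Suc k := zt (Suc k) \<omega>)"
  by (auto simp: history_def fun_eq_iff restrict_def)

lemma restrict_history_le: "j \<le> k \<Longrightarrow> restrict (history zt k \<omega>) {1..j} = history zt j \<omega>"
  by (auto simp: history_def fun_eq_iff restrict_def)

lemma not_Stop_iff: "a \<noteq> Stop \<longleftrightarrow> a = Continue"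
  by (cases a) auto

lemma stopping_time_greater_iff:
  "enat k < stopping_time zt \<mu> \<omega> \<longleftrightarrow> (\<forall>j\<le>k. \<mu> j (history zt j \<omega>) = Continue)"
proof -
  have "enat k < stopping_time zt \<mu> \<omega> \<longleftrightarrow> \<not> (\<exists>j. \<mu> j (history zt j \<omega>) = Stop \<and> j \<le> k)"
  proof (cases "\<exists>j. \<mu> j (history zt j \<omega>) = Stop")
    case True
    let ?K = "{j. \<mu> j (history zt j \<omega>) = Stop}"
    define n where "n = (LEAST j. \<mu> j (history zt j \<omega>) = Stop)"
    have n: "\<mu> n (history zt n \<omega>) = Stop" "\<And>j. \<mu> j (history zt j \<omega>) = Stop \<Longrightarrow> n \<le> j"
      using True by (auto simp: n_def intro: LeastI_ex Least_le)
    have "stopping_time zt \<mu> \<omega> = enat n"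
      unfolding stopping_time_def using n by (intro antisym INF_lower INF_greatest) auto
    then show ?thesis using n by (auto simp: not_le intro: less_le_trans)
  qed (auto simp: stopping_time_def top_enat_def)
  then show ?thesis by (auto simp flip: not_Stop_iff)
qed

lemma stopping_time_eq_iff:
  "stopping_time zt \<mu> \<omega> = enat k \<longleftrightarrow>
    (\<forall>j<k. \<mu> j (history zt j \<omega>) = Continue) \<and> \<mu> k (history zt k \<omega>) = Stop"
proof -
  have "stopping_time zt \<mu> \<omega> = enat k \<longleftrightarrow> \<not> enat k < stopping_time zt \<mu> \<omega> \<and> (\<forall>j<k. enat j < stopping_time zt \<mu> \<omega>)"
  proof (cases "stopping_time zt \<mu> \<omega>")
    case (enat n)
    then show ?thesis by auto (meson not_less_iff_gr_or_eq)
  qed auto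
  moreover have "(\<forall>j<k. \<forall>i\<le>j. \<mu> i (history zt i \<omega>) = Continue) \<longleftrightarrow> (\<forall>j<k. \<mu> j (history zt j \<omega>) = Continue)"
    by (meson le_less_trans order_refl)
  ultimately show ?thesis
    unfolding stopping_time_greater_iff by (auto simp: le_less simp flip: not_Stop_iff)
qed

text \<open>Running cost \<open>a\<close> and stopping cost \<open>b\<close> are left open so that
  both costs of a policy, the one with the attack time and the one with the posterior, become sums
  of stages.\<close>

definition stage :: "(nat \<Rightarrow> 'a \<Rightarrow> real^'m) \<Rightarrow> (nat \<Rightarrow> (nat \<Rightarrow> real^'m) \<Rightarrow> action) \<Rightarrow>
    (nat \<Rightarrow> ennreal) \<Rightarrow> (nat \<Rightarrow> ennreal) \<Rightarrow> nat \<Rightarrow> 'a \<Rightarrow> ennreal" where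
  "stage zt \<mu> a b k \<omega> = (if \<forall>j<k. \<mu> j (history zt j \<omega>) = Continue
     then (case \<mu> k (history zt k \<omega>) of Continue \<Rightarrow> a k | Stop \<Rightarrow> b k) else 0)"

lemma suminf_stage:
  "(\<Sum>k. stage zt \<mu> a b k \<omega>) =
    (\<Sum>k. if enat k < stopping_time zt \<mu> \<omega> then a k else 0) +
    (case stopping_time zt \<mu> \<omega> of enat k \<Rightarrow> b k | \<infinity> \<Rightarrow> 0)"
proof -
  have eq: "stage zt \<mu> a b k \<omega> = (if enat k < stopping_time zt \<mu> \<omega> then a k else 0) +
      (if stopping_time zt \<mu> \<omega> = enat k then b k else 0)" for k
    unfolding stage_def stopping_time_greater_iff stopping_time_eq_iff
    by (cases "\<mu> k (history zt k \<omega>)") (auto simp: le_less)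
  have "(\<Sum>k. if stopping_time zt \<mu> \<omega> = enat k then b k else 0) =
      (case stopping_time zt \<mu> \<omega> of enat k \<Rightarrow> b k | \<infinity> \<Rightarrow> 0)"
  proof (cases "stopping_time zt \<mu> \<omega>")
    case (enat n)
    then show ?thesis by (subst suminf_finite[of "{n}"]) auto
  qed simp
  then show ?thesis
    unfolding eq by (subst suminf_add[symmetric]) auto
qed

text \<open>The delay is the number of stages \<open>k\<close> before \<tau> with
  \<open>n \<le> k\<close>; for infinite \<tau> there are infinitely many.\<close>

lemma suminf_detection_delay:
  "(\<Sum>k. if enat k < \<tau> then indicator {..k} n else 0) = ennreal_of_enat (\<tau> - enat n)"
proof (cases \<tau>)
  case (enat m)
  have "(\<Sum>k. if enat k < \<tau> then indicator {..k} n else 0) = (\<Sum>k<m. if enat k < \<tau> then indicator {..k} n else (0::ennreal))"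
    by (rule suminf_finite) (auto simp: enat)
  also have "\<dots> = (\<Sum>k\<in>{n..<m}. 1)"
    by (rule sum.mono_neutral_cong_right) (auto simp: enat indicator_def split: if_splits)
  finally show ?thesis by (simp add: enat)
next
  case infinity
  have "of_nat j \<le> (\<Sum>k. indicator {..k} n :: ennreal)" for j
  proof -
    have "(of_nat j :: ennreal) = (\<Sum>k\<in>{n..<n+j}. indicator {..k} n)" by simp
    also have "\<dots> \<le> (\<Sum>k. indicator {..k} n)" by (rule sum_le_suminf) auto
    finally show ?thesis .
  qed
  then have "(\<Sum>k. indicator {..k} n :: ennreal) = top"
    by (metis SUP_least ennreal_SUP_of_nat_eq_top top_unique)
  then show ?thesis by (simp add: infinity)
qed

lemma detection_cost_integrand:
  "ennreal_of_enat (stopping_time zt \<mu> \<omega> - enat (t \<omega>)) + c * indicator {\<omega>. stopping_time zt \<mu> \<omega> < enat (t \<omega>)} \<omega> =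
    (\<Sum>k. stage zt \<mu> (\<lambda>k. indicator {..k} (t \<omega>)) (\<lambda>k. c * indicator {k<..} (t \<omega>)) k \<omega>)"
  unfolding suminf_stage suminf_detection_delay
  by (auto split: enat.split simp: indicator_def)

lemma measurable_extension:
  assumes F: "F \<in> borel_measurable (hist_space (Suc k))"
    and [measurable]: "g \<in> measurable N (hist_space k)" "u \<in> borel_measurable N"
  shows "(\<lambda>x. F ((g x)(Suc k := u x))) \<in> borel_measurable N"
  by (rule measurable_compose[OF _ F]) measurable

section \<open>The belief recursion as a filter\<close>

text \<open>\<open>hazard\<close> and \<open>survival\<close> express that, as long as no attack has
  begun, the history carries no information on the attack time: it starts at the next step with
  probability \<theta>. They are tested against functions of the history, the form in which the
  filter induction uses them.\<close>

locale filtered_detection = prob_space M + detection_process lam \<theta> f\<^sub>1 f\<^sub>0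
  for M :: "'a measure" and lam \<theta> :: real
    and f\<^sub>1 :: "nat \<Rightarrow> (nat \<Rightarrow> real^'m) \<Rightarrow> real^'m \<Rightarrow> real" and f\<^sub>0 :: "real^'m \<Rightarrow> real" +
  fixes t :: "'a \<Rightarrow> nat" and zt :: "nat \<Rightarrow> 'a \<Rightarrow> real^'m"
  assumes t_measurable [measurable]: "t \<in> measurable M (count_space UNIV)"
    and t_positive: "AE \<omega> in M. 0 < t \<omega>"
    and zt_measurable [measurable]: "\<And>k. zt (Suc k) \<in> borel_measurable M"
    and hazard: "\<And>k G. G \<in> borel_measurable (hist_space k) \<Longrightarrow>
      (\<integral>\<^sup>+\<omega>. indicator {Suc k} (t \<omega>) * G (history zt k \<omega>) \<partial>M) =
      ennreal \<theta> * (\<integral>\<^sup>+\<omega>. indicator {k<..} (t \<omega>) * G (history zt k \<omega>) \<partial>M)"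
    and survival: "\<And>k G. G \<in> borel_measurable (hist_space k) \<Longrightarrow>
      (\<integral>\<^sup>+\<omega>. indicator {Suc k<..} (t \<omega>) * G (history zt k \<omega>) \<partial>M) =
      ennreal (1 - \<theta>) * (\<integral>\<^sup>+\<omega>. indicator {k<..} (t \<omega>) * G (history zt k \<omega>) \<partial>M)"
    and density_attack: "\<And>k. conditional_density M zt {\<omega>. t \<omega> \<le> Suc k} k (f\<^sub>1 k)"
    and density_no_attack: "\<And>k. conditional_density M zt {\<omega>. Suc k < t \<omega>} k (\<lambda>_. f\<^sub>0)"
begin

lemma measurable_history [measurable]: "history zt k \<in> measurable M (hist_space k)"
  unfolding history_def[abs_def]
proof (rule measurable_restrict)
  fix i :: nat assume "i \<in> {1..k}"
  then show "zt i \<in> borel_measurable M" using zt_measurable[of "i - 1"] by auto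
qed

lemma history_in_space: "\<omega> \<in> space M \<Longrightarrow> history zt k \<omega> \<in> space (hist_space k)"
  by (rule measurable_space[OF measurable_history])

text \<open>The initial value is 0 because the attack time is almost surely positive.\<close>

abbreviation belief :: "nat \<Rightarrow> (nat \<Rightarrow> real^'m) \<Rightarrow> real" where
  "belief \<equiv> belief_from 0 0"

lemma belief_bounds: "h \<in> space (hist_space k) \<Longrightarrow> 0 \<le> belief k h \<and> belief k h \<le> 1"
  using belief_from_bounds[of 0 h k 0] by simp

lemma measurable_indicator_t [measurable]: "(\<lambda>\<omega>. indicator S (t \<omega>) :: ennreal) \<in> borel_measurable M"
  by (rule measurable_compose[OF t_measurable]) simp

lemma integral_attack:
  assumes F: "F \<in> borel_measurable (hist_space (Suc k))"
  shows "(\<integral>\<^sup>+\<omega>. indicator {..Suc k} (t \<omega>) * F (history zt (Suc k) \<omega>) \<partial>M) =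
    (\<integral>\<^sup>+\<omega>. indicator {..Suc k} (t \<omega>) *
      (\<integral>\<^sup>+u. ennreal (f\<^sub>1 k (history zt k \<omega>) u) * F ((history zt k \<omega>)(Suc k := u)) \<partial>lborel) \<partial>M)"
proof -
  have ind: "indicator {\<omega>. t \<omega> \<le> Suc k} = (\<lambda>\<omega>. indicator {..Suc k} (t \<omega>) :: ennreal)"
    by (auto simp: indicator_def fun_eq_iff)
  have "(\<lambda>x. F ((fst x)(Suc k := snd x))) \<in> borel_measurable (hist_space k \<Otimes>\<^sub>M borel)"
    by (rule measurable_compose[OF _ F]) measurable
  then show ?thesis
    using nn_integral_conditional_density[OF prob_space_axioms density_attack[of k] _ _ _, of "\<lambda>h u. F (h(Suc k := u))"]
    unfolding ind history_Suc by (simp add: split_beta')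
qed

lemma integral_no_attack:
  assumes F: "F \<in> borel_measurable (hist_space (Suc k))"
  shows "(\<integral>\<^sup>+\<omega>. indicator {Suc k<..} (t \<omega>) * F (history zt (Suc k) \<omega>) \<partial>M) =
    (\<integral>\<^sup>+\<omega>. indicator {Suc k<..} (t \<omega>) *
      (\<integral>\<^sup>+u. ennreal (f\<^sub>0 u) * F ((history zt k \<omega>)(Suc k := u)) \<partial>lborel) \<partial>M)"
proof -
  have ind: "indicator {\<omega>. Suc k < t \<omega>} = (\<lambda>\<omega>. indicator {Suc k<..} (t \<omega>) :: ennreal)"
    by (auto simp: indicator_def fun_eq_iff)
  have "(\<lambda>x. F ((fst x)(Suc k := snd x))) \<in> borel_measurable (hist_space k \<Otimes>\<^sub>M borel)"
    by (rule measurable_compose[OF _ F]) measurable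
  then show ?thesis
    using nn_integral_conditional_density[OF prob_space_axioms density_no_attack[of k] _ _ _, of "\<lambda>h u. F (h(Suc k := u))"]
    unfolding ind history_Suc by (simp add: split_beta')
qed

text \<open>Says that the belief is the conditional probability of \<open>t \<le> k\<close> given
  the history. The complementary event has its own equation, as it cannot be obtained by subtracting
  in \<open>ennreal\<close>.\<close>

definition is_filter :: "nat \<Rightarrow> bool" where
  "is_filter k \<longleftrightarrow> (\<forall>G\<in>borel_measurable (hist_space k).
     (\<integral>\<^sup>+\<omega>. indicator {..k} (t \<omega>) * G (history zt k \<omega>) \<partial>M) =
       (\<integral>\<^sup>+\<omega>. ennreal (belief k (history zt k \<omega>)) * G (history zt k \<omega>) \<partial>M) \<and>
     (\<integral>\<^sup>+\<omega>. indicator {k<..} (t \<omega>) * G (history zt k \<omega>) \<partial>M) =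
       (\<integral>\<^sup>+\<omega>. ennreal (1 - belief k (history zt k \<omega>)) * G (history zt k \<omega>) \<partial>M))"

text \<open>An attack by time \<open>Suc k\<close> either has begun by time \<open>k\<close>, which
  contributes the belief, or begins at \<open>Suc k\<close>, which contributes \<theta> times its
  complement; the next innovation then has density \<open>f\<^sub>1\<close>.\<close>

lemma filter_attack:
  assumes filt: "is_filter k" and F: "F \<in> borel_measurable (hist_space (Suc k))"
  shows "(\<integral>\<^sup>+\<omega>. indicator {..Suc k} (t \<omega>) * F (history zt (Suc k) \<omega>) \<partial>M) =
    (\<integral>\<^sup>+\<omega>. (\<integral>\<^sup>+u. ennreal (f\<^sub>1 k (history zt k \<omega>) u *
        (belief k (history zt k \<omega>) + (1 - belief k (history zt k \<omega>)) * \<theta>)) *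
      F ((history zt k \<omega>)(Suc k := u)) \<partial>lborel) \<partial>M)"
proof -
  note [measurable] = F and [measurable (raw)] = measurable_extension[OF F]
  define G where "G h = (\<integral>\<^sup>+u. ennreal (f\<^sub>1 k h u) * F (h(Suc k := u)) \<partial>lborel)" for h
  have G[measurable]: "G \<in> borel_measurable (hist_space k)" unfolding G_def[abs_def] by measurable
  have "(\<integral>\<^sup>+\<omega>. indicator {..Suc k} (t \<omega>) * F (history zt (Suc k) \<omega>) \<partial>M) =
      (\<integral>\<^sup>+\<omega>. indicator {..k} (t \<omega>) * G (history zt k \<omega>) + indicator {Suc k} (t \<omega>) * G (history zt k \<omega>) \<partial>M)"
    unfolding integral_attack[OF F] G_def[symmetric]
    by (intro nn_integral_cong) (auto simp: indicator_def le_Suc_eq)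
  also have "\<dots> = (\<integral>\<^sup>+\<omega>. indicator {..k} (t \<omega>) * G (history zt k \<omega>) \<partial>M) +
      ennreal \<theta> * (\<integral>\<^sup>+\<omega>. indicator {k<..} (t \<omega>) * G (history zt k \<omega>) \<partial>M)"
    by (subst nn_integral_add) (auto simp: hazard)
  also have "\<dots> = (\<integral>\<^sup>+\<omega>. ennreal (belief k (history zt k \<omega>)) * G (history zt k \<omega>) \<partial>M) +
      ennreal \<theta> * (\<integral>\<^sup>+\<omega>. ennreal (1 - belief k (history zt k \<omega>)) * G (history zt k \<omega>) \<partial>M)"
    using filt G by (simp add: is_filter_def)
  also have "\<dots> = (\<integral>\<^sup>+\<omega>. ennreal (belief k (history zt k \<omega>)) * G (history zt k \<omega>) +
      ennreal \<theta> * (ennreal (1 - belief k (history zt k \<omega>)) * G (history zt k \<omega>)) \<partial>M)"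
    by (simp add: nn_integral_add nn_integral_cmult)
  also have "\<dots> = (\<integral>\<^sup>+\<omega>. (\<integral>\<^sup>+u. ennreal (f\<^sub>1 k (history zt k \<omega>) u *
        (belief k (history zt k \<omega>) + (1 - belief k (history zt k \<omega>)) * \<theta>)) *
      F ((history zt k \<omega>)(Suc k := u)) \<partial>lborel) \<partial>M)"
  proof (rule nn_integral_cong)
    fix \<omega> assume "\<omega> \<in> space M"
    then have h[measurable]: "history zt k \<omega> \<in> space (hist_space k)" by (rule history_in_space)
    let ?h = "history zt k \<omega>"
    let ?p = "belief k ?h"
    have p: "0 \<le> ?p" "?p \<le> 1" using belief_bounds[OF h] by auto
    have "ennreal ?p * G ?h + ennreal \<theta> * (ennreal (1 - ?p) * G ?h) = ennreal (?p + (1 - ?p) * \<theta>) * G ?h"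
      using p \<theta> by (simp add: ennreal_plus ennreal_mult'' distrib_left distrib_right mult_ac)
    also have "\<dots> = (\<integral>\<^sup>+u. ennreal (?p + (1 - ?p) * \<theta>) * (ennreal (f\<^sub>1 k ?h u) * F (?h(Suc k := u))) \<partial>lborel)"
      unfolding G_def by (rule nn_integral_cmult[symmetric]) measurable
    also have "\<dots> = (\<integral>\<^sup>+u. ennreal (f\<^sub>1 k ?h u * (?p + (1 - ?p) * \<theta>)) * F (?h(Suc k := u)) \<partial>lborel)"
      using p \<theta> f\<^sub>1_nonneg[OF h] by (intro nn_integral_cong) (simp add: ennreal_mult' mult_ac)
    finally show "ennreal ?p * G ?h + ennreal \<theta> * (ennreal (1 - ?p) * G ?h) =
      (\<integral>\<^sup>+u. ennreal (f\<^sub>1 k ?h u * (?p + (1 - ?p) * \<theta>)) * F (?h(Suc k := u)) \<partial>lborel)" .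
  qed
  finally show ?thesis .
qed

lemma filter_no_attack:
  assumes filt: "is_filter k" and F: "F \<in> borel_measurable (hist_space (Suc k))"
  shows "(\<integral>\<^sup>+\<omega>. indicator {Suc k<..} (t \<omega>) * F (history zt (Suc k) \<omega>) \<partial>M) =
    (\<integral>\<^sup>+\<omega>. (\<integral>\<^sup>+u. ennreal ((1 - belief k (history zt k \<omega>)) * (1 - \<theta>) * f\<^sub>0 u) *
      F ((history zt k \<omega>)(Suc k := u)) \<partial>lborel) \<partial>M)"
proof -
  note [measurable] = F and [measurable (raw)] = measurable_extension[OF F]
  define G where "G h = (\<integral>\<^sup>+u. ennreal (f\<^sub>0 u) * F (h(Suc k := u)) \<partial>lborel)" for h
  have G[measurable]: "G \<in> borel_measurable (hist_space k)" unfolding G_def[abs_def] by measurable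
  have "(\<integral>\<^sup>+\<omega>. indicator {Suc k<..} (t \<omega>) * F (history zt (Suc k) \<omega>) \<partial>M) =
      ennreal (1 - \<theta>) * (\<integral>\<^sup>+\<omega>. ennreal (1 - belief k (history zt k \<omega>)) * G (history zt k \<omega>) \<partial>M)"
    unfolding integral_no_attack[OF F] G_def[symmetric] survival[OF G]
    using filt G by (simp add: is_filter_def)
  also have "\<dots> = (\<integral>\<^sup>+\<omega>. ennreal (1 - \<theta>) * (ennreal (1 - belief k (history zt k \<omega>)) * G (history zt k \<omega>)) \<partial>M)"
    by (simp add: nn_integral_cmult)
  also have "\<dots> = (\<integral>\<^sup>+\<omega>. (\<integral>\<^sup>+u. ennreal ((1 - belief k (history zt k \<omega>)) * (1 - \<theta>) * f\<^sub>0 u) *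
      F ((history zt k \<omega>)(Suc k := u)) \<partial>lborel) \<partial>M)"
  proof (rule nn_integral_cong)
    fix \<omega> assume "\<omega> \<in> space M"
    then have h[measurable]: "history zt k \<omega> \<in> space (hist_space k)" by (rule history_in_space)
    let ?h = "history zt k \<omega>"
    let ?p = "belief k ?h"
    have p: "0 \<le> ?p" "?p \<le> 1" using belief_bounds[OF h] by auto
    have "ennreal (1 - \<theta>) * (ennreal (1 - ?p) * G ?h) = ennreal ((1 - ?p) * (1 - \<theta>)) * G ?h"
      using p \<theta> by (simp add: ennreal_mult'' mult_ac)
    also have "\<dots> = (\<integral>\<^sup>+u. ennreal ((1 - ?p) * (1 - \<theta>)) * (ennreal (f\<^sub>0 u) * F (?h(Suc k := u))) \<partial>lborel)"
      unfolding G_def by (rule nn_integral_cmult[symmetric]) measurable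
    also have "\<dots> = (\<integral>\<^sup>+u. ennreal ((1 - ?p) * (1 - \<theta>) * f\<^sub>0 u) * F (?h(Suc k := u)) \<partial>lborel)"
      using f\<^sub>0_nonneg by (intro nn_integral_cong) (simp add: ennreal_mult'' mult.assoc[symmetric])
    finally show "ennreal (1 - \<theta>) * (ennreal (1 - ?p) * G ?h) =
      (\<integral>\<^sup>+u. ennreal ((1 - ?p) * (1 - \<theta>) * f\<^sub>0 u) * F (?h(Suc k := u)) \<partial>lborel)" .
  qed
  finally show ?thesis .
qed

text \<open>Adding the two cases shows that the predictive density at the current belief is the true
  conditional density of the next innovation. This links the abstract decision process to the
  probability space.\<close>

lemma filter_step:
  assumes filt: "is_filter k" and F: "F \<in> borel_measurable (hist_space (Suc k))"
  shows "(\<integral>\<^sup>+\<omega>. F (history zt (Suc k) \<omega>) \<partial>M) =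
    (\<integral>\<^sup>+\<omega>. (\<integral>\<^sup>+u. ennreal (predictive_density \<theta> f\<^sub>1 f\<^sub>0 k (belief k (history zt k \<omega>)) (history zt k \<omega>) u) *
      F ((history zt k \<omega>)(Suc k := u)) \<partial>lborel) \<partial>M)"
proof -
  note [measurable] = F and [measurable (raw)] = measurable_extension[OF F]
  have "(\<integral>\<^sup>+\<omega>. F (history zt (Suc k) \<omega>) \<partial>M) =
      (\<integral>\<^sup>+\<omega>. indicator {..Suc k} (t \<omega>) * F (history zt (Suc k) \<omega>) + indicator {Suc k<..} (t \<omega>) * F (history zt (Suc k) \<omega>) \<partial>M)"
    by (intro nn_integral_cong) (auto simp: indicator_def)
  also have "\<dots> = (\<integral>\<^sup>+\<omega>. indicator {..Suc k} (t \<omega>) * F (history zt (Suc k) \<omega>) \<partial>M) +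
      (\<integral>\<^sup>+\<omega>. indicator {Suc k<..} (t \<omega>) * F (history zt (Suc k) \<omega>) \<partial>M)"
    by (rule nn_integral_add) measurable
  also have "\<dots> = (\<integral>\<^sup>+\<omega>. (\<integral>\<^sup>+u. ennreal (f\<^sub>1 k (history zt k \<omega>) u *
        (belief k (history zt k \<omega>) + (1 - belief k (history zt k \<omega>)) * \<theta>)) *
      F ((history zt k \<omega>)(Suc k := u)) \<partial>lborel) +
      (\<integral>\<^sup>+u. ennreal ((1 - belief k (history zt k \<omega>)) * (1 - \<theta>) * f\<^sub>0 u) *
      F ((history zt k \<omega>)(Suc k := u)) \<partial>lborel) \<partial>M)"
    unfolding filter_attack[OF filt F] filter_no_attack[OF filt F]
    by (rule nn_integral_add[symmetric]) measurable
  also have "\<dots> = (\<integral>\<^sup>+\<omega>. (\<integral>\<^sup>+u. ennreal (predictive_density \<theta> f\<^sub>1 f\<^sub>0 k (belief k (history zt k \<omega>)) (history zt k \<omega>) u) *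
      F ((history zt k \<omega>)(Suc k := u)) \<partial>lborel) \<partial>M)"
  proof (rule nn_integral_cong)
    fix \<omega> assume "\<omega> \<in> space M"
    then have h[measurable]: "history zt k \<omega> \<in> space (hist_space k)" by (rule history_in_space)
    let ?h = "history zt k \<omega>"
    let ?p = "belief k ?h"
    have p: "?p \<in> {0..1}" using belief_bounds[OF h] by simp
    have "(\<integral>\<^sup>+u. ennreal (f\<^sub>1 k ?h u * (?p + (1 - ?p) * \<theta>)) * F (?h(Suc k := u)) \<partial>lborel) +
        (\<integral>\<^sup>+u. ennreal ((1 - ?p) * (1 - \<theta>) * f\<^sub>0 u) * F (?h(Suc k := u)) \<partial>lborel) =
      (\<integral>\<^sup>+u. ennreal (f\<^sub>1 k ?h u * (?p + (1 - ?p) * \<theta>)) * F (?h(Suc k := u)) +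
        ennreal ((1 - ?p) * (1 - \<theta>) * f\<^sub>0 u) * F (?h(Suc k := u)) \<partial>lborel)"
      by (rule nn_integral_add[symmetric]) measurable
    also have "\<dots> = (\<integral>\<^sup>+u. ennreal (predictive_density \<theta> f\<^sub>1 f\<^sub>0 k ?p ?h u) * F (?h(Suc k := u)) \<partial>lborel)"
    proof (rule nn_integral_cong)
      fix u
      have "predictive_density \<theta> f\<^sub>1 f\<^sub>0 k ?p ?h u = f\<^sub>1 k ?h u * (?p + (1 - ?p) * \<theta>) + (1 - ?p) * (1 - \<theta>) * f\<^sub>0 u"
        by (simp add: predictive_density_def)
      moreover have "0 \<le> (1 - ?p) * (1 - \<theta>) * f\<^sub>0 u" using p \<theta> f\<^sub>0_nonneg by auto
      ultimately show "ennreal (f\<^sub>1 k ?h u * (?p + (1 - ?p) * \<theta>)) * F (?h(Suc k := u)) +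
          ennreal ((1 - ?p) * (1 - \<theta>) * f\<^sub>0 u) * F (?h(Suc k := u)) =
          ennreal (predictive_density \<theta> f\<^sub>1 f\<^sub>0 k ?p ?h u) * F (?h(Suc k := u))"
        using predictive_density_ge(1)[OF p h, of u] by (simp add: distrib_right)
    qed
    finally show "(\<integral>\<^sup>+u. ennreal (f\<^sub>1 k ?h u * (?p + (1 - ?p) * \<theta>)) * F (?h(Suc k := u)) \<partial>lborel) +
        (\<integral>\<^sup>+u. ennreal ((1 - ?p) * (1 - \<theta>) * f\<^sub>0 u) * F (?h(Suc k := u)) \<partial>lborel) =
      (\<integral>\<^sup>+u. ennreal (predictive_density \<theta> f\<^sub>1 f\<^sub>0 k ?p ?h u) * F (?h(Suc k := u)) \<partial>lborel)" .
  qed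
  finally show ?thesis .
qed

text \<open>At time 0 both equations hold because \<open>t\<close> is almost surely positive. The
  induction step is Bayes' rule in integrated form.\<close>

lemma is_filter: "is_filter k"
proof (induction k)
  case 0
  have "(\<integral>\<^sup>+\<omega>. indicator {..0} (t \<omega>) * G (history zt 0 \<omega>) \<partial>M) = 0" for G :: "_ \<Rightarrow> ennreal"
    using t_positive by (subst nn_integral_0_iff_AE[symmetric] nn_integral_cong_AE[where v="\<lambda>_. 0"]) auto
  moreover have "(\<integral>\<^sup>+\<omega>. indicator {0<..} (t \<omega>) * G (history zt 0 \<omega>) \<partial>M) = (\<integral>\<^sup>+\<omega>. G (history zt 0 \<omega>) \<partial>M)" for G
    using t_positive by (intro nn_integral_cong_AE) auto
  ultimately show ?case by (simp add: is_filter_def)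
next
  case (Suc k)
  show ?case
    unfolding is_filter_def
  proof (intro ballI conjI)
    fix G :: "(nat \<Rightarrow> real^'m) \<Rightarrow> ennreal" assume G[measurable]: "G \<in> borel_measurable (hist_space (Suc k))"
    note [measurable (raw)] = measurable_extension[OF G]
    have "(\<integral>\<^sup>+\<omega>. ennreal (belief (Suc k) (history zt (Suc k) \<omega>)) * G (history zt (Suc k) \<omega>) \<partial>M) =
      (\<integral>\<^sup>+\<omega>. (\<integral>\<^sup>+u. ennreal (f\<^sub>1 k (history zt k \<omega>) u *
          (belief k (history zt k \<omega>) + (1 - belief k (history zt k \<omega>)) * \<theta>)) *
        G ((history zt k \<omega>)(Suc k := u)) \<partial>lborel) \<partial>M)"
    \<comment> \<open>The predictive density brought in by \<open>filter_step\<close> cancels the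
      denominator of the next belief, leaving the integrand of \<open>filter_attack\<close>.\<close>
    proof (subst filter_step[OF Suc], measurable, intro nn_integral_cong)
      fix \<omega> u assume "\<omega> \<in> space M"
      then have h: "history zt k \<omega> \<in> space (hist_space k)" by (rule history_in_space)
      let ?h = "history zt k \<omega>"
      have p: "belief k ?h \<in> {0..1}" using belief_bounds[OF h] by simp
      show "ennreal (predictive_density \<theta> f\<^sub>1 f\<^sub>0 k (belief k ?h) ?h u) *
          (ennreal (belief (Suc k) (?h(Suc k := u))) * G (?h(Suc k := u))) =
        ennreal (f\<^sub>1 k ?h u * (belief k ?h + (1 - belief k ?h) * \<theta>)) * G (?h(Suc k := u))"
        unfolding predictive_density_mult_next_belief[OF p h, symmetric] belief_from_extend[OF le0 h]
        using predictive_density_ge(3)[OF p h] by (simp add: ennreal_mult' mult.assoc)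
    qed
    then show "(\<integral>\<^sup>+\<omega>. indicator {..Suc k} (t \<omega>) * G (history zt (Suc k) \<omega>) \<partial>M) =
       (\<integral>\<^sup>+\<omega>. ennreal (belief (Suc k) (history zt (Suc k) \<omega>)) * G (history zt (Suc k) \<omega>) \<partial>M)"
      unfolding filter_attack[OF Suc G] by (rule sym)
    have "(\<integral>\<^sup>+\<omega>. ennreal (1 - belief (Suc k) (history zt (Suc k) \<omega>)) * G (history zt (Suc k) \<omega>) \<partial>M) =
      (\<integral>\<^sup>+\<omega>. (\<integral>\<^sup>+u. ennreal ((1 - belief k (history zt k \<omega>)) * (1 - \<theta>) * f\<^sub>0 u) *
        G ((history zt k \<omega>)(Suc k := u)) \<partial>lborel) \<partial>M)"
    proof (subst filter_step[OF Suc], measurable, intro nn_integral_cong)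
      fix \<omega> u assume "\<omega> \<in> space M"
      then have h: "history zt k \<omega> \<in> space (hist_space k)" by (rule history_in_space)
      let ?h = "history zt k \<omega>"
      let ?p = "belief k ?h"
      have p: "?p \<in> {0..1}" using belief_bounds[OF h] by simp
      have "(1 - ?p) * (1 - \<theta>) * f\<^sub>0 u = predictive_density \<theta> f\<^sub>1 f\<^sub>0 k ?p ?h u - f\<^sub>1 k ?h u * (?p + (1 - ?p) * \<theta>)"
        by (simp add: predictive_density_def)
      also have "\<dots> = predictive_density \<theta> f\<^sub>1 f\<^sub>0 k ?p ?h u * (1 - next_belief \<theta> f\<^sub>1 f\<^sub>0 k ?p ?h u)"
        unfolding predictive_density_mult_next_belief[OF p h, symmetric] by (simp add: algebra_simps)
      finally show "ennreal (predictive_density \<theta> f\<^sub>1 f\<^sub>0 k ?p ?h u) *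
          (ennreal (1 - belief (Suc k) (?h(Suc k := u))) * G (?h(Suc k := u))) =
        ennreal ((1 - ?p) * (1 - \<theta>) * f\<^sub>0 u) * G (?h(Suc k := u))"
        unfolding belief_from_extend[OF le0 h]
        using predictive_density_ge(3)[OF p h] by (simp add: ennreal_mult' mult.assoc)
    qed
    then show "(\<integral>\<^sup>+\<omega>. indicator {Suc k<..} (t \<omega>) * G (history zt (Suc k) \<omega>) \<partial>M) =
       (\<integral>\<^sup>+\<omega>. ennreal (1 - belief (Suc k) (history zt (Suc k) \<omega>)) * G (history zt (Suc k) \<omega>) \<partial>M)"
      unfolding filter_no_attack[OF Suc G] by (rule sym)
  qed
qed

text \<open>Testing \<open>is_filter\<close> on indicators of history events gives the
  characterization of the conditional expectation; being a version of it, \<open>posterior\<close>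
  is determined only up to null sets.\<close>

lemma posterior_eq_belief: "AE \<omega> in M. posterior M t zt k \<omega> = belief k (history zt k \<omega>)"
proof -
  let ?F = "vimage_algebra (space M) (history zt k) (hist_space k)"
  have hs: "history zt k \<in> space M \<rightarrow> space (hist_space k)" using history_in_space by auto
  have "A \<in> sets M" if "A \<in> sets ?F" for A
  proof -
    obtain B where "B \<in> sets (hist_space k)" "A = history zt k -` B \<inter> space M"
      using \<open>A \<in> sets ?F\<close> unfolding sets_vimage_algebra2[OF hs] by blast
    then show ?thesis by (simp only: measurable_sets[OF measurable_history])
  qed
  then have "subalgebra M ?F" by (intro subalgebra_def[THEN iffD2] conjI subsetI) simp_all
  then interpret finite_measure_subalgebra M ?F by unfold_locales
  have [measurable]: "Measurable.pred M (\<lambda>\<omega>. t \<omega> \<le> k)" by measurable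
  show ?thesis
    unfolding posterior_def
  proof (rule real_cond_exp_charact)
    fix A assume "A \<in> sets ?F"
    then obtain B where B[measurable]: "B \<in> sets (hist_space k)" and A: "A = history zt k -` B \<inter> space M"
      unfolding sets_vimage_algebra2[OF hs] by blast
    have "(LINT \<omega>:A|M. indicator {\<omega>. t \<omega> \<le> k} \<omega> :: real) = enn2real (\<integral>\<^sup>+\<omega>. indicator {..k} (t \<omega>) * indicator B (history zt k \<omega>) \<partial>M)"
      unfolding set_lebesgue_integral_def
    proof (subst integral_eq_nn_integral)
      show "(\<lambda>\<omega>. indicator A \<omega> *\<^sub>R indicator {\<omega>. t \<omega> \<le> k} \<omega> :: real) \<in> borel_measurable M"
        unfolding A indicator_def by measurable
    qed (auto intro!: arg_cong[where f=enn2real] nn_integral_cong simp: A indicator_def)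
    also have "(\<integral>\<^sup>+\<omega>. indicator {..k} (t \<omega>) * indicator B (history zt k \<omega>) \<partial>M) =
        (\<integral>\<^sup>+\<omega>. ennreal (belief k (history zt k \<omega>)) * indicator B (history zt k \<omega>) \<partial>M)"
      using is_filter[of k] by (simp add: is_filter_def)
    also have "enn2real \<dots> = (LINT \<omega>:A|M. belief k (history zt k \<omega>))"
      unfolding set_lebesgue_integral_def
    proof (subst integral_eq_nn_integral)
      show "(\<lambda>\<omega>. indicator A \<omega> *\<^sub>R belief k (history zt k \<omega>)) \<in> borel_measurable M"
        unfolding A indicator_def by measurable
    qed (use history_in_space belief_bounds in
        \<open>auto intro!: arg_cong[where f=enn2real] nn_integral_cong simp: A indicator_def\<close>)
    finally show "(LINT \<omega>:A|M. indicator {\<omega>. t \<omega> \<le> k} \<omega> :: real) = (LINT \<omega>:A|M. belief k (history zt k \<omega>))" .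
  next
    show "integrable M (indicator {\<omega>. t \<omega> \<le> k} :: _ \<Rightarrow> real)"
      by (rule integrable_const_bound[of _ 1]) (auto simp: indicator_def)
    show "integrable M (\<lambda>\<omega>. belief k (history zt k \<omega>))"
      using history_in_space belief_bounds by (intro integrable_const_bound[of _ 1]) auto
    show "(\<lambda>\<omega>. belief k (history zt k \<omega>)) \<in> borel_measurable ?F"
      by (rule measurable_compose[OF measurable_vimage_algebra1[OF hs] belief_from_measurable])
  qed
qed

section \<open>Expected costs along the beliefs\<close>

text \<open>Whether the policy is still running is read off from the current history, whose
  restrictions are the earlier histories; this makes it a legitimate factor in
  \<open>filter_step\<close> and \<open>is_filter\<close>.\<close>

definition alive :: "(nat \<Rightarrow> (nat \<Rightarrow> real^'m) \<Rightarrow> action) \<Rightarrow> nat \<Rightarrow> (nat \<Rightarrow> real^'m) \<Rightarrow> bool" where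
  "alive \<mu> k h \<longleftrightarrow> (\<forall>j<k. \<mu> j (restrict h {1..j}) = Continue)"

lemma alive_history: "alive \<mu> k (history zt k \<omega>) \<longleftrightarrow> (\<forall>j<k. \<mu> j (history zt j \<omega>) = Continue)"
  by (auto simp: alive_def restrict_history_le)

lemma alive_extend:
  assumes "h \<in> space (hist_space k)"
  shows "alive \<mu> (Suc k) (h(Suc k := u)) \<longleftrightarrow> alive \<mu> k h \<and> \<mu> k h = Continue"
proof -
  have "restrict (h(Suc k := u)) {1..j} = restrict h {1..j}" if "j \<le> k" for j
    using that by (auto simp: restrict_def fun_eq_iff)
  then show ?thesis
    using restrict_history[OF assms] by (auto simp: alive_def less_Suc_eq)
qed

lemma measurable_policy: "\<mu> \<in> policies \<Longrightarrow> \<mu> k \<in> measurable (hist_space k) (count_space UNIV)"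
  by (simp add: policies_def)

lemma measurable_alive [measurable]:
  assumes "\<mu> \<in> policies"
  shows "Measurable.pred (hist_space k) (alive \<mu> k)"
proof -
  have [measurable]: "(\<lambda>h. \<mu> j (restrict h {1..j})) \<in> measurable (hist_space k) (count_space UNIV)" if "j < k" for j
    by (rule measurable_compose[OF measurable_restrict_subset measurable_policy[OF assms]]) (use that in auto)
  show ?thesis unfolding alive_def[abs_def] by measurable
qed

definition stage_value :: "(nat \<Rightarrow> (nat \<Rightarrow> real^'m) \<Rightarrow> action) \<Rightarrow> nat \<Rightarrow> (nat \<Rightarrow> real^'m) \<Rightarrow> ennreal" where
  "stage_value \<mu> k h = (if alive \<mu> k h then
     (case \<mu> k h of Continue \<Rightarrow> ennreal (belief k h) | Stop \<Rightarrow> ennreal (lam * (1 - belief k h))) else 0)"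

lemma measurable_case_action [measurable (raw)]:
  fixes a b :: "_ \<Rightarrow> ennreal"
  assumes [measurable]: "d \<in> measurable N (count_space UNIV)"
    and [measurable]: "a \<in> borel_measurable N" "b \<in> borel_measurable N"
  shows "(\<lambda>h. case d h of Continue \<Rightarrow> a h | Stop \<Rightarrow> b h) \<in> borel_measurable N"
proof -
  have "(\<lambda>h. case d h of Continue \<Rightarrow> a h | Stop \<Rightarrow> b h) = (\<lambda>h. if d h = Continue then a h else b h)"
    by (auto split: action.split)
  then show ?thesis by simp
qed

lemma measurable_stage_value:
  assumes "\<mu> \<in> policies"
  shows "stage_value \<mu> k \<in> borel_measurable (hist_space k)"
proof -
  note [measurable] = measurable_policy[OF assms] measurable_alive[OF assms]
  show ?thesis unfolding stage_value_def[abs_def] by measurable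
qed

text \<open>The decision at time \<open>k\<close> depends on the history only, so
  \<open>is_filter\<close> may replace the indicators of attack and no attack by the belief and its
  complement, stage by stage.\<close>

lemma detection_cost_eq:
  assumes \<mu>: "\<mu> \<in> policies"
  shows "detection_cost M t zt lam \<mu> = (\<Sum>k. \<integral>\<^sup>+\<omega>. stage_value \<mu> k (history zt k \<omega>) \<partial>M)"
proof -
  note [measurable] = measurable_policy[OF \<mu>] measurable_alive[OF \<mu>]
  let ?s = "\<lambda>k \<omega>. stage zt \<mu> (\<lambda>k. indicator {..k} (t \<omega>)) (\<lambda>k. ennreal lam * indicator {k<..} (t \<omega>)) k \<omega>"
  define G where "G k h = (if alive \<mu> k h \<and> \<mu> k h = Continue then 1 else 0 :: ennreal)" for k h
  define G' where "G' k h = (if alive \<mu> k h \<and> \<mu> k h = Stop then ennreal lam else 0)" for k h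
  have G[measurable]: "G k \<in> borel_measurable (hist_space k)" "G' k \<in> borel_measurable (hist_space k)" for k
    unfolding G_def[abs_def] G'_def[abs_def] by measurable
  have s: "?s k \<omega> = indicator {..k} (t \<omega>) * G k (history zt k \<omega>) + indicator {k<..} (t \<omega>) * G' k (history zt k \<omega>)" for k \<omega>
    by (cases "\<mu> k (history zt k \<omega>)") (auto simp: stage_def G_def G'_def alive_history mult.commute)
  have "(\<integral>\<^sup>+\<omega>. ?s k \<omega> \<partial>M) = (\<integral>\<^sup>+\<omega>. stage_value \<mu> k (history zt k \<omega>) \<partial>M)" for k
  proof -
    have "(\<integral>\<^sup>+\<omega>. ?s k \<omega> \<partial>M) = (\<integral>\<^sup>+\<omega>. indicator {..k} (t \<omega>) * G k (history zt k \<omega>) \<partial>M) +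
        (\<integral>\<^sup>+\<omega>. indicator {k<..} (t \<omega>) * G' k (history zt k \<omega>) \<partial>M)"
      unfolding s by (rule nn_integral_add) measurable
    also have "\<dots> = (\<integral>\<^sup>+\<omega>. ennreal (belief k (history zt k \<omega>)) * G k (history zt k \<omega>) \<partial>M) +
        (\<integral>\<^sup>+\<omega>. ennreal (1 - belief k (history zt k \<omega>)) * G' k (history zt k \<omega>) \<partial>M)"
      using is_filter[of k] G by (simp add: is_filter_def)
    also have "\<dots> = (\<integral>\<^sup>+\<omega>. ennreal (belief k (history zt k \<omega>)) * G k (history zt k \<omega>) +
        ennreal (1 - belief k (history zt k \<omega>)) * G' k (history zt k \<omega>) \<partial>M)"
      by (rule nn_integral_add[symmetric]) measurable
    also have "\<dots> = (\<integral>\<^sup>+\<omega>. stage_value \<mu> k (history zt k \<omega>) \<partial>M)"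
    proof (rule nn_integral_cong)
      fix \<omega> assume "\<omega> \<in> space M"
      then show "ennreal (belief k (history zt k \<omega>)) * G k (history zt k \<omega>) +
          ennreal (1 - belief k (history zt k \<omega>)) * G' k (history zt k \<omega>) = stage_value \<mu> k (history zt k \<omega>)"
        using lam belief_bounds[OF history_in_space]
        by (cases "\<mu> k (history zt k \<omega>)") (auto simp: stage_value_def G_def G'_def ennreal_mult' mult.commute)
    qed
    finally show ?thesis .
  qed
  moreover have "detection_cost M t zt lam \<mu> = (\<Sum>k. \<integral>\<^sup>+\<omega>. ?s k \<omega> \<partial>M)"
    unfolding detection_cost_def detection_cost_integrand
    by (rule nn_integral_suminf) (simp add: s)
  ultimately show ?thesis by simp
qed

text \<open>Posterior and belief differ on a null set for each \<open>k\<close>; the union over all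
  \<open>k\<close> is still null, so the whole sums agree almost surely.\<close>

lemma belief_cost_eq:
  assumes \<mu>: "\<mu> \<in> policies"
  shows "belief_cost M t zt lam \<mu> = (\<Sum>k. \<integral>\<^sup>+\<omega>. stage_value \<mu> k (history zt k \<omega>) \<partial>M)"
proof -
  have "belief_cost M t zt lam \<mu> = (\<integral>\<^sup>+\<omega>. (\<Sum>k. stage zt \<mu> (\<lambda>k. ennreal (posterior M t zt k \<omega>))
      (\<lambda>k. ennreal (lam * (1 - posterior M t zt k \<omega>))) k \<omega>) \<partial>M)"
    unfolding belief_cost_def suminf_stage ..
  also have "\<dots> = (\<integral>\<^sup>+\<omega>. (\<Sum>k. stage_value \<mu> k (history zt k \<omega>)) \<partial>M)"
  proof (rule nn_integral_cong_AE)
    have "AE \<omega> in M. \<forall>k. posterior M t zt k \<omega> = belief k (history zt k \<omega>)"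
      using posterior_eq_belief by (simp add: AE_all_countable)
    then show "AE \<omega> in M. (\<Sum>k. stage zt \<mu> (\<lambda>k. ennreal (posterior M t zt k \<omega>))
        (\<lambda>k. ennreal (lam * (1 - posterior M t zt k \<omega>))) k \<omega>) = (\<Sum>k. stage_value \<mu> k (history zt k \<omega>))"
      by eventually_elim (simp add: stage_def stage_value_def alive_history)
  qed
  also have "\<dots> = (\<Sum>k. \<integral>\<^sup>+\<omega>. stage_value \<mu> k (history zt k \<omega>) \<partial>M)"
    by (intro nn_integral_suminf measurable_compose[OF measurable_history measurable_stage_value[OF \<mu>]])
  finally show ?thesis .
qed

section \<open>Telescoping and optimality\<close>

text \<open>The remainder of the telescoping sums: the expected value \<open>W\<close> still ahead
  on those paths that have not stopped before time \<open>k\<close>.\<close>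

definition value_alive ::
    "(nat \<Rightarrow> real \<Rightarrow> (nat \<Rightarrow> real^'m) \<Rightarrow> ennreal) \<Rightarrow> (nat \<Rightarrow> (nat \<Rightarrow> real^'m) \<Rightarrow> action) \<Rightarrow> nat \<Rightarrow> ennreal" where
  "value_alive W \<mu> k = (\<integral>\<^sup>+\<omega>. (if alive \<mu> k (history zt k \<omega>)
     then W k (belief k (history zt k \<omega>)) (history zt k \<omega>) else 0) \<partial>M)"

text \<open>\<open>filter_step\<close> pulls the expectation at time \<open>Suc k\<close> back to
  \<open>next_expectation\<close> at time \<open>k\<close>. \<open>W\<close> is kept general because
  it is used both for a finite iterate and for the limit.\<close>

lemma value_alive_step:
  assumes \<mu>: "\<mu> \<in> policies"
    and W: "\<And>k. (\<lambda>(\<pi>, h). W k \<pi> h) \<in> borel_measurable (borel \<Otimes>\<^sub>M hist_space k)"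
  shows "(\<integral>\<^sup>+\<omega>. stage_value \<mu> k (history zt k \<omega>) \<partial>M) + value_alive W \<mu> (Suc k) =
    (\<integral>\<^sup>+\<omega>. (if alive \<mu> k (history zt k \<omega>) then
      (case \<mu> k (history zt k \<omega>) of
         Continue \<Rightarrow> ennreal (belief k (history zt k \<omega>)) +
           next_expectation \<theta> f\<^sub>1 f\<^sub>0 k (belief k (history zt k \<omega>)) (history zt k \<omega>) (W (Suc k))
       | Stop \<Rightarrow> ennreal (lam * (1 - belief k (history zt k \<omega>)))) else 0) \<partial>M)"
proof -
  note [measurable] = measurable_policy[OF \<mu>] measurable_alive[OF \<mu>]
  note W' = W[of "Suc k"]
  have [measurable]: "(\<lambda>h. W (Suc k) (belief (Suc k) h) h) \<in> borel_measurable (hist_space (Suc k))"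
    using measurable_compose[OF measurable_Pair[OF belief_from_measurable measurable_ident] W']
    by (simp only: prod.case id_apply)
  define F where "F h = (if alive \<mu> (Suc k) h then W (Suc k) (belief (Suc k) h) h else 0)" for h
  have F[measurable]: "F \<in> borel_measurable (hist_space (Suc k))" unfolding F_def[abs_def] by measurable
  define N where "N h = (if alive \<mu> k h \<and> \<mu> k h = Continue
      then next_expectation \<theta> f\<^sub>1 f\<^sub>0 k (belief k h) h (W (Suc k)) else 0)" for h
  have N[measurable]: "N \<in> borel_measurable (hist_space k)"
    unfolding N_def[abs_def] using W' by measurable
  have "value_alive W \<mu> (Suc k) = (\<integral>\<^sup>+\<omega>. F (history zt (Suc k) \<omega>) \<partial>M)"
    unfolding value_alive_def F_def ..
  also have "\<dots> = (\<integral>\<^sup>+\<omega>. N (history zt k \<omega>) \<partial>M)"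
    unfolding filter_step[OF is_filter F]
  proof (rule nn_integral_cong)
    fix \<omega> assume "\<omega> \<in> space M"
    then have h: "history zt k \<omega> \<in> space (hist_space k)" by (rule history_in_space)
    show "(\<integral>\<^sup>+u. ennreal (predictive_density \<theta> f\<^sub>1 f\<^sub>0 k (belief k (history zt k \<omega>)) (history zt k \<omega>) u) *
        F ((history zt k \<omega>)(Suc k := u)) \<partial>lborel) = N (history zt k \<omega>)"
      unfolding F_def N_def alive_extend[OF h] belief_from_extend[OF le0 h] next_expectation_def
      by (cases "alive \<mu> k (history zt k \<omega>) \<and> \<mu> k (history zt k \<omega>) = Continue")
        (simp_all only: simp_thms if_True if_False mult_zero_right mult_zero_left nn_integral_const)
  qed
  finally have "(\<integral>\<^sup>+\<omega>. stage_value \<mu> k (history zt k \<omega>) \<partial>M) + value_alive W \<mu> (Suc k) =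
      (\<integral>\<^sup>+\<omega>. stage_value \<mu> k (history zt k \<omega>) + N (history zt k \<omega>) \<partial>M)"
    using measurable_stage_value[OF \<mu>, of k] by (simp add: nn_integral_add)
  also have "\<dots> = (\<integral>\<^sup>+\<omega>. (if alive \<mu> k (history zt k \<omega>) then
      (case \<mu> k (history zt k \<omega>) of
         Continue \<Rightarrow> ennreal (belief k (history zt k \<omega>)) +
           next_expectation \<theta> f\<^sub>1 f\<^sub>0 k (belief k (history zt k \<omega>)) (history zt k \<omega>) (W (Suc k))
       | Stop \<Rightarrow> ennreal (lam * (1 - belief k (history zt k \<omega>)))) else 0) \<partial>M)"
    by (intro nn_integral_cong) (auto simp: stage_value_def N_def split: action.split)
  finally show ?thesis .
qed

lemma value_alive_0: "value_alive W \<mu> 0 = W 0 0 (\<lambda>_. undefined)"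
proof -
  have "history zt 0 \<omega> = (\<lambda>_. undefined)" for \<omega> by (auto simp: history_def)
  then show ?thesis by (simp add: value_alive_def alive_def emeasure_space_1)
qed

text \<open>Each iterate is telescoped over exactly as many stages as it looks ahead, so the
  remainder is the iterate 0 and vanishes. With \<open>value_limit\<close> one would have to show
  separately that the remainder tends to 0.\<close>

lemma value_limit_le_detection_cost:
  assumes \<mu>: "\<mu> \<in> policies"
  shows "value_limit 0 0 (\<lambda>_. undefined) \<le> detection_cost M t zt lam \<mu>"
proof -
  let ?c = "\<lambda>k. \<integral>\<^sup>+\<omega>. stage_value \<mu> k (history zt k \<omega>) \<partial>M"
  have step: "value_alive (value_iteration (Suc n)) \<mu> k \<le> ?c k + value_alive (value_iteration n) \<mu> (Suc k)" for n k
    unfolding value_alive_step[where W = "value_iteration n", OF \<mu> value_iteration_measurable]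
    unfolding value_alive_def
    by (intro nn_integral_mono) (auto split: action.split)
  have "value_alive (value_iteration n) \<mu> k \<le> (\<Sum>j<n. ?c (k + j))" for n k
  proof (induction n arbitrary: k)
    case (Suc n)
    have "value_alive (value_iteration (Suc n)) \<mu> k \<le> ?c k + (\<Sum>j<n. ?c (Suc k + j))"
      using step[of n k] Suc[of "Suc k"] by (meson add_left_mono order_trans)
    then show ?case by (simp add: sum.lessThan_Suc_shift del: sum.lessThan_Suc value_iteration.simps)
  qed (simp add: value_alive_def cong: if_cong)
  from this[of _ 0] have "value_iteration n 0 0 (\<lambda>_. undefined) \<le> (\<Sum>j<n. ?c j)" for n
    by (simp add: value_alive_0)
  also have "(\<Sum>j<n. ?c j) \<le> detection_cost M t zt lam \<mu>" for n
    unfolding detection_cost_eq[OF \<mu>] by (rule sum_le_suminf) auto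
  finally show ?thesis unfolding value_limit_def by (rule SUP_least)
qed

text \<open>Optimal actions turn the Bellman inequality into an equality at every stage. The
  remainder is nonnegative and is simply dropped, so all partial sums stay below the initial
  value.\<close>

lemma optimal_detection_cost:
  assumes \<mu>: "\<mu> \<in> policies"
    and opt: "\<And>k. AE \<omega> in M. \<mu> k (history zt k \<omega>) \<in>
      optimal_actions lam \<theta> f\<^sub>1 f\<^sub>0 k (belief k (history zt k \<omega>)) (history zt k \<omega>)"
  shows "detection_cost M t zt lam \<mu> \<le> value_limit 0 0 (\<lambda>_. undefined)"
proof -
  let ?c = "\<lambda>k. \<integral>\<^sup>+\<omega>. stage_value \<mu> k (history zt k \<omega>) \<partial>M"
  have step: "?c k + value_alive value_limit \<mu> (Suc k) = value_alive value_limit \<mu> k" for k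
    unfolding value_alive_step[where W = value_limit, OF \<mu> value_limit_measurable]
    unfolding value_alive_def
  proof (rule nn_integral_cong_AE)
    show "AE \<omega> in M. (if alive \<mu> k (history zt k \<omega>) then
      (case \<mu> k (history zt k \<omega>) of
         Continue \<Rightarrow> ennreal (belief k (history zt k \<omega>)) +
           next_expectation \<theta> f\<^sub>1 f\<^sub>0 k (belief k (history zt k \<omega>)) (history zt k \<omega>) (value_limit (Suc k))
       | Stop \<Rightarrow> ennreal (lam * (1 - belief k (history zt k \<omega>)))) else 0) =
      (if alive \<mu> k (history zt k \<omega>) then value_limit k (belief k (history zt k \<omega>)) (history zt k \<omega>) else 0)"
      using opt[of k] AE_space
    proof eventually_elim
      fix \<omega> assume a: "\<mu> k (history zt k \<omega>) \<in>
          optimal_actions lam \<theta> f\<^sub>1 f\<^sub>0 k (belief k (history zt k \<omega>)) (history zt k \<omega>)" and "\<omega> \<in> space M"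
      then have h: "history zt k \<omega> \<in> space (hist_space k)" by (intro history_in_space)
      then have p: "belief k (history zt k \<omega>) \<in> {0..1}" using belief_bounds by simp
      show "(if alive \<mu> k (history zt k \<omega>) then
      (case \<mu> k (history zt k \<omega>) of
         Continue \<Rightarrow> ennreal (belief k (history zt k \<omega>)) +
           next_expectation \<theta> f\<^sub>1 f\<^sub>0 k (belief k (history zt k \<omega>)) (history zt k \<omega>) (value_limit (Suc k))
       | Stop \<Rightarrow> ennreal (lam * (1 - belief k (history zt k \<omega>)))) else 0) =
      (if alive \<mu> k (history zt k \<omega>) then value_limit k (belief k (history zt k \<omega>)) (history zt k \<omega>) else 0)"
        using optimal_action_value[OF p h a] by (simp only: continuation_def)
    qed
  qed
  have sum: "(\<Sum>j<n. ?c j) + value_alive value_limit \<mu> n = value_limit 0 0 (\<lambda>_. undefined)" for n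
  proof (induction n)
    case (Suc n)
    have "(\<Sum>j<Suc n. ?c j) + value_alive value_limit \<mu> (Suc n) =
        (\<Sum>j<n. ?c j) + (?c n + value_alive value_limit \<mu> (Suc n))"
      by (simp add: add.assoc)
    then show ?case unfolding step using Suc by (rule trans)
  qed (simp add: value_alive_0)
  have "(\<Sum>j<n. ?c j) \<le> value_limit 0 0 (\<lambda>_. undefined)" for n
    unfolding sum[of n, symmetric] by simp
  then show ?thesis
    unfolding detection_cost_eq[OF \<mu>] suminf_eq_SUP by (rule SUP_least)
qed

lemma optimal_threshold_policies:
  shows "(\<forall>\<mu>\<in>policies. detection_cost M t zt lam \<mu> = belief_cost M t zt lam \<mu>) \<and>
    (\<exists>\<Gamma>.
       (\<forall>k. \<forall>h\<in>space (hist_space k).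
          \<Gamma> k h \<in> {0..1} \<and>
          (\<forall>\<pi>\<in>{0..1}.
             (\<pi> > \<Gamma> k h \<longrightarrow> optimal_actions lam \<theta> f\<^sub>1 f\<^sub>0 k \<pi> h = {Stop}) \<and>
             (\<pi> < \<Gamma> k h \<longrightarrow> optimal_actions lam \<theta> f\<^sub>1 f\<^sub>0 k \<pi> h = {Continue}) \<and>
             (\<pi> = \<Gamma> k h \<longrightarrow> optimal_actions lam \<theta> f\<^sub>1 f\<^sub>0 k \<pi> h = {Stop, Continue}))) \<and>
       threshold_policies M t zt \<Gamma> \<noteq> {} \<and>
       (\<forall>\<mu>\<in>threshold_policies M t zt \<Gamma>. \<forall>\<nu>\<in>policies.
          detection_cost M t zt lam \<mu> \<le> detection_cost M t zt lam \<nu>))"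
proof -
  define sep where "sep k h g \<longleftrightarrow> g \<in> {0..1} \<and> (\<forall>\<pi>\<in>{0..1}.
      (\<pi> > g \<longrightarrow> ennreal (lam * (1 - \<pi>)) < continuation k \<pi> h) \<and>
      (\<pi> < g \<longrightarrow> continuation k \<pi> h < ennreal (lam * (1 - \<pi>))) \<and>
      (\<pi> = g \<longrightarrow> continuation k \<pi> h = ennreal (lam * (1 - \<pi>))))" for k h g
  \<comment> \<open>Chosen for each history separately, with no claim of measurability in
    \<open>h\<close>; existence of a measurable threshold policy therefore has to come from
    elsewhere.\<close>
  define \<Gamma> where "\<Gamma> k h = (SOME g. sep k h g)" for k h
  have sep: "sep k h (\<Gamma> k h)" if "h \<in> space (hist_space k)" for k h
  proof -
    have "\<exists>g. sep k h g" using exists_threshold[OF that] unfolding sep_def by blast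
    then show ?thesis unfolding \<Gamma>_def by (rule someI_ex)
  qed
  have actions: "(\<pi> > \<Gamma> k h \<longrightarrow> optimal_actions lam \<theta> f\<^sub>1 f\<^sub>0 k \<pi> h = {Stop}) \<and>
      (\<pi> < \<Gamma> k h \<longrightarrow> optimal_actions lam \<theta> f\<^sub>1 f\<^sub>0 k \<pi> h = {Continue}) \<and>
      (\<pi> = \<Gamma> k h \<longrightarrow> optimal_actions lam \<theta> f\<^sub>1 f\<^sub>0 k \<pi> h = {Stop, Continue})"
    if h: "h \<in> space (hist_space k)" and \<pi>: "\<pi> \<in> {0..1}" for k h \<pi>
    using sep[OF h, unfolded sep_def, THEN conjunct2, rule_format, OF \<pi>] unfolding optimal_actions_eq[OF \<pi> h] by auto
  have posterior: "AE \<omega> in M. posterior M t zt k \<omega> = belief k (history zt k \<omega>) \<and>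
      history zt k \<omega> \<in> space (hist_space k) \<and> belief k (history zt k \<omega>) \<in> {0..1}" for k
    using posterior_eq_belief[of k] AE_space
    by eventually_elim (simp add: history_in_space belief_bounds)
  have optimal: "detection_cost M t zt lam \<mu> \<le> detection_cost M t zt lam \<nu>"
    if \<mu>: "\<mu> \<in> threshold_policies M t zt \<Gamma>" and \<nu>: "\<nu> \<in> policies" for \<mu> \<nu>
  proof -
    have "detection_cost M t zt lam \<mu> \<le> value_limit 0 0 (\<lambda>_. undefined)"
    proof (rule optimal_detection_cost)
      show "\<mu> \<in> policies" using \<mu> by (simp add: threshold_policies_def)
      fix k
      have "AE \<omega> in M.
          (posterior M t zt k \<omega> > \<Gamma> k (history zt k \<omega>) \<longrightarrow> \<mu> k (history zt k \<omega>) = Stop) \<and>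
          (posterior M t zt k \<omega> < \<Gamma> k (history zt k \<omega>) \<longrightarrow> \<mu> k (history zt k \<omega>) = Continue)"
        using \<mu> by (simp add: threshold_policies_def)
      then show "AE \<omega> in M. \<mu> k (history zt k \<omega>) \<in>
          optimal_actions lam \<theta> f\<^sub>1 f\<^sub>0 k (belief k (history zt k \<omega>)) (history zt k \<omega>)"
        using posterior[of k]
      proof eventually_elim
        case (elim \<omega>)
        then show ?case
          using actions[of "history zt k \<omega>" k "belief k (history zt k \<omega>)"]
          by (cases "\<mu> k (history zt k \<omega>)"; cases "belief k (history zt k \<omega>)" "\<Gamma> k (history zt k \<omega>)" rule: linorder_cases) auto
      qed
    qed
    also have "\<dots> \<le> detection_cost M t zt lam \<nu>"
      using \<nu> by (rule value_limit_le_detection_cost)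
    finally show ?thesis .
  qed
  \<comment> \<open>The greedy policy for the initial state is measurable and, since the sign of the
    cost difference is the side of the threshold, respects every \<open>\<Gamma> k h\<close> on the
    almost sure event where posterior and belief agree.\<close>
  have "greedy 0 0 \<in> threshold_policies M t zt \<Gamma>"
  proof -
    have "AE \<omega> in M.
        (posterior M t zt k \<omega> > \<Gamma> k (history zt k \<omega>) \<longrightarrow> greedy 0 0 k (history zt k \<omega>) = Stop) \<and>
        (posterior M t zt k \<omega> < \<Gamma> k (history zt k \<omega>) \<longrightarrow> greedy 0 0 k (history zt k \<omega>) = Continue)" for k
      using posterior[of k]
    proof eventually_elim
      case (elim \<omega>)
      then show ?case
        using sep[of "history zt k \<omega>" k] unfolding sep_def by (auto simp: greedy_def[of 0 0 k] not_le)
    qed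
    then show ?thesis using greedy_policy by (simp add: threshold_policies_def)
  qed
  then have nonempty: "threshold_policies M t zt \<Gamma> \<noteq> {}" by blast
  show ?thesis
  proof (intro conjI exI[of _ \<Gamma>] ballI allI)
    show "\<Gamma> k h \<in> {0..1}" if "h \<in> space (hist_space k)" for k h
      using sep[OF that] by (simp add: sep_def)
  qed (use actions optimal nonempty in \<open>simp_all add: detection_cost_eq belief_cost_eq\<close>)
qed

end

section \<open>The attacked system\<close>

context attacked_system
begin

section \<open>Measurability of the attacked system\<close>

lemma measurable_noise [measurable]:
  "w k \<in> borel_measurable M" "v k \<in> borel_measurable M" "b k \<in> borel_measurable M"
  using w_gaussian v_gaussian b_gaussian by (auto simp: gaussian_def)

lemmas [measurable] = t_measurable initial_measurable

lemma measurable_state [measurable]: "x k \<in> borel_measurable M"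
proof (induction k)
  case (Suc k)
  note [measurable] = Suc
  have "(\<lambda>\<omega>. A *v x k \<omega> + w k \<omega>) \<in> borel_measurable M" by measurable
  then show ?case by (rule measurable_cong[THEN iffD1, rotated]) (simp add: process)
qed measurable

lemma measurable_observation [measurable]: "y k \<in> borel_measurable M"
proof -
  have "(\<lambda>\<omega>. C *v x k \<omega> + v k \<omega>) \<in> borel_measurable M" by measurable
  then show ?thesis by (rule measurable_cong[THEN iffD1, rotated]) (simp add: observation)
qed

text \<open>Conditional on the estimate because \<open>zt\<close> and \<open>xt\<close> are defined
  by mutual recursion; the induction is carried by the estimates.\<close>

lemma measurable_received_if:
  assumes [measurable]: "xt k \<in> borel_measurable M"
  shows "zt (Suc k) \<in> borel_measurable M"
proof -
  have "(\<lambda>\<omega>. if Suc k < t \<omega> then y (Suc k) \<omega> - C *v (A *v xt k \<omega>)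
      else T *v (y (Suc k) \<omega> - C *v (A *v xt k \<omega>)) + b (Suc k) \<omega>) \<in> borel_measurable M"
    by measurable
  then show ?thesis by (rule measurable_cong[THEN iffD1, rotated]) (simp add: received innovation)
qed

lemma measurable_estimate: "xt k \<in> borel_measurable M"
proof (induction k)
  case (Suc k)
  note [measurable] = Suc measurable_received_if[OF Suc]
  have "(\<lambda>\<omega>. A *v xt k \<omega> + kalman_gain C R P *v zt (Suc k) \<omega>) \<in> borel_measurable M" by measurable
  then show ?case by (rule measurable_cong[THEN iffD1, rotated]) (simp add: estimate)
qed measurable

lemmas measurable_received = measurable_received_if[OF measurable_estimate]

section \<open>The system before the attack and independence of the attack time\<close>

text \<open>If \<open>k < t \<omega>\<close>, every innovation used up to time \<open>k\<close> was
  received untampered, so both filters have run on the same data from the same start.\<close>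

lemma estimate_before_attack:
  "\<omega> \<in> space M \<Longrightarrow> k < t \<omega> \<Longrightarrow> xt k \<omega> = xn k \<omega>"
proof (induction k)
  case (Suc k)
  then show ?case
    by (simp add: estimate received innovation no_attack_estimate no_attack_innovation)
qed (simp add: no_attack_initial)

lemma received_before_attack:
  "\<omega> \<in> space M \<Longrightarrow> Suc k < t \<omega> \<Longrightarrow> zt (Suc k) \<omega> = zn (Suc k) \<omega>"
  using estimate_before_attack[of \<omega> k] by (simp add: received innovation no_attack_innovation)

lemma history_before_attack:
  assumes "\<omega> \<in> space M" "k < t \<omega>"
  shows "history zt k \<omega> = history zn k \<omega>"
proof -
  have "zt i \<omega> = zn i \<omega>" if "i \<in> {1..k}" for i
    using that assms received_before_attack[of \<omega> "i - 1"] by auto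
  then show ?thesis by (auto simp: history_def restrict_def)
qed

text \<open>Generated by every source of randomness except the attack time. The attack-free filter
  is measurable with respect to it, whereas the received innovations involve
  \<open>t\<close>.\<close>

definition noise_algebra :: "'a measure" where
  "noise_algebra = sigma (space M) (\<Union>s\<in>- {Attack_time}. source_events M (x 0) (xt 0) w v b t s)"

lemma source_events_subset: "source_events M (x 0) (xt 0) w v b t s \<subseteq> Pow (space M)"
  using sets.space_closed by (cases s) (fastforce simp: space_vimage_algebra)+

lemma space_sets_noise_algebra [simp]:
  "space noise_algebra = space M"
  "sets noise_algebra = sigma_sets (space M) (\<Union>s\<in>- {Attack_time}. source_events M (x 0) (xt 0) w v b t s)"
proof -
  have "(\<Union>s\<in>- {Attack_time}. source_events M (x 0) (xt 0) w v b t s) \<subseteq> Pow (space M)"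
    using source_events_subset by blast
  then show "space noise_algebra = space M"
    "sets noise_algebra = sigma_sets (space M) (\<Union>s\<in>- {Attack_time}. source_events M (x 0) (xt 0) w v b t s)"
    by (simp_all add: noise_algebra_def)
qed

lemma measurable_noise_algebraI:
  assumes "\<And>X. X \<in> sets N \<Longrightarrow> f -` X \<inter> space M \<in> source_events M (x 0) (xt 0) w v b t s"
    and "s \<noteq> Attack_time" "f \<in> measurable M N"
  shows "f \<in> measurable noise_algebra N"
  using assms measurable_space[OF assms(3)] by (intro measurableI) (auto intro!: sigma_sets.Basic)

lemma noise_algebra_sources:
  "w k \<in> borel_measurable noise_algebra" "v k \<in> borel_measurable noise_algebra"
  "(\<lambda>\<omega>. (x 0 \<omega>, xt 0 \<omega>)) \<in> borel_measurable noise_algebra"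
proof -
  show "w k \<in> borel_measurable noise_algebra"
    by (rule measurable_noise_algebraI[where s="Process_noise k"]) (auto intro: in_vimage_algebra)
  show "v k \<in> borel_measurable noise_algebra"
    by (rule measurable_noise_algebraI[where s="Sensor_noise k"]) (auto intro: in_vimage_algebra)
  have "(\<lambda>\<omega>. (x 0 \<omega>, xt 0 \<omega>)) \<in> borel_measurable M" by measurable
  then show "(\<lambda>\<omega>. (x 0 \<omega>, xt 0 \<omega>)) \<in> borel_measurable noise_algebra"
    by (rule measurable_noise_algebraI[where s=Initial, rotated 2]) (auto intro: in_vimage_algebra)
qed

lemma noise_algebra_initial:
  "x 0 \<in> borel_measurable noise_algebra" "xt 0 \<in> borel_measurable noise_algebra"
  using measurable_compose[OF noise_algebra_sources(3), of fst borel]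
    measurable_compose[OF noise_algebra_sources(3), of snd borel]
  by (simp_all add: borel_prod[symmetric])

lemma noise_algebra_state: "x k \<in> borel_measurable noise_algebra"
proof (induction k)
  case (Suc k)
  note [measurable] = Suc noise_algebra_sources
  have "(\<lambda>\<omega>. A *v x k \<omega> + w k \<omega>) \<in> borel_measurable noise_algebra" by measurable
  then show ?case by (rule measurable_cong[THEN iffD1, rotated]) (simp add: process)
qed (rule noise_algebra_initial)

lemma noise_algebra_observation: "y k \<in> borel_measurable noise_algebra"
proof -
  note [measurable] = noise_algebra_state noise_algebra_sources
  have "(\<lambda>\<omega>. C *v x k \<omega> + v k \<omega>) \<in> borel_measurable noise_algebra" by measurable
  then show ?thesis by (rule measurable_cong[THEN iffD1, rotated]) (simp add: observation)
qed

lemma noise_algebra_innovation_if: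
  assumes [measurable]: "xn k \<in> borel_measurable noise_algebra"
  shows "zn (Suc k) \<in> borel_measurable noise_algebra"
proof -
  note [measurable] = noise_algebra_observation
  have "(\<lambda>\<omega>. y (Suc k) \<omega> - C *v (A *v xn k \<omega>)) \<in> borel_measurable noise_algebra" by measurable
  then show ?thesis by (rule measurable_cong[THEN iffD1, rotated]) (simp add: no_attack_innovation)
qed

lemma noise_algebra_estimate: "xn k \<in> borel_measurable noise_algebra"
proof (induction k)
  case 0
  show ?case
    using noise_algebra_initial(2) by (rule measurable_cong[THEN iffD1, rotated]) (simp add: no_attack_initial)
next
  case (Suc k)
  note [measurable] = Suc noise_algebra_innovation_if[OF Suc]
  have "(\<lambda>\<omega>. A *v xn k \<omega> + kalman_gain C R P *v zn (Suc k) \<omega>) \<in> borel_measurable noise_algebra" by measurable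
  then show ?case by (rule measurable_cong[THEN iffD1, rotated]) (simp add: no_attack_estimate)
qed

lemmas noise_algebra_innovation = noise_algebra_innovation_if[OF noise_algebra_estimate]

lemma noise_algebra_history: "history zn k \<in> measurable noise_algebra (hist_space k)"
  unfolding history_def[abs_def]
proof (rule measurable_restrict)
  fix i :: nat assume "i \<in> {1..k}"
  then show "zn i \<in> borel_measurable noise_algebra" using noise_algebra_innovation[of "i - 1"] by auto
qed

lemma sets_noise_algebra_le: "sets noise_algebra \<subseteq> sets M"
proof -
  have "source_events M (x 0) (xt 0) w v b t s \<subseteq> sets M" for s
    using sources_indep by (auto simp: indep_sets_def)
  then show ?thesis by (simp add: UN_least sets.sigma_sets_subset)
qed

lemma measurable_noise_algebraD: "f \<in> measurable noise_algebra N \<Longrightarrow> f \<in> measurable M N"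
  using sets_noise_algebra_le by (auto simp: measurable_def)

lemma measurable_indicator_attack_time [measurable]:
  "(\<lambda>\<omega>. indicator D (t \<omega>) :: ennreal) \<in> borel_measurable M"
  by (rule measurable_compose[OF t_measurable]) simp

text \<open>Each source contributes a \<sigma>-algebra, hence an intersection-stable system, so
  independence survives grouping the sources into two blocks.\<close>

lemma prob_attack_time_indep:
  assumes F: "F \<in> sets noise_algebra"
  shows "prob ({\<omega> \<in> space M. t \<omega> \<in> D} \<inter> F) = prob {\<omega> \<in> space M. t \<omega> \<in> D} * prob F"
proof -
  let ?src = "source_events M (x 0) (xt 0) w v b t"
  \<comment> \<open>\<open>indep_set\<close> is an independent family over the Booleans, hence the
    two blocks are indexed by \<open>bool\<close>.\<close>
  let ?I = "\<lambda>c. if c then {Attack_time} else - {Attack_time}"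
  have "indep_sets (\<lambda>j. sigma_sets (space M) (\<Union>i\<in>?I j. ?src i)) UNIV"
  proof (rule indep_sets_collect_sigma)
    have "(\<Union>j. ?I j) = UNIV" by auto
    then show "indep_sets ?src (\<Union>j. ?I j)" using sources_indep by simp
    show "Int_stable (?src i)" for i by (cases i) (auto intro: sets.Int_stable)
    show "disjoint_family ?I" by (auto simp: disjoint_family_on_def)
  qed
  then have ind: "indep_set (sigma_sets (space M) (\<Union>i\<in>?I True. ?src i)) (sigma_sets (space M) (\<Union>i\<in>?I False. ?src i))"
    unfolding indep_set_def by (rule indep_sets_cong[THEN iffD1, rotated 2]) (auto split: bool.split)
  have tD: "{\<omega> \<in> space M. t \<omega> \<in> D} \<in> ?src Attack_time"
  proof -
    have "{\<omega> \<in> space M. t \<omega> \<in> D} = t -` D \<inter> space M" by auto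
    then show ?thesis by (auto intro: in_vimage_algebra)
  qed
  show ?thesis
    by (rule indep_setD[OF ind]) (use tD F in \<open>auto intro: sigma_sets.Basic\<close>)
qed

text \<open>From events to integrals: the law of \<open>X\<close> weighted by the indicator of
  \<open>t\<close> in \<open>D\<close> is a constant multiple of the law of
  \<open>X\<close>.\<close>

lemma integral_attack_time_indep:
  assumes X: "X \<in> measurable noise_algebra N" and [measurable]: "G \<in> borel_measurable N"
  shows "(\<integral>\<^sup>+\<omega>. indicator D (t \<omega>) * G (X \<omega>) \<partial>M) =
    emeasure M {\<omega> \<in> space M. t \<omega> \<in> D} * (\<integral>\<^sup>+\<omega>. G (X \<omega>) \<partial>M)"
proof -
  note XM[measurable] = measurable_noise_algebraD[OF X]
  let ?c = "emeasure M {\<omega> \<in> space M. t \<omega> \<in> D}"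
  have "distr (density M (\<lambda>\<omega>. indicator D (t \<omega>))) N X = density (distr M N X) (\<lambda>_. ?c)"
  proof (rule measure_eqI)
    fix B assume "B \<in> sets (distr (density M (\<lambda>\<omega>. indicator D (t \<omega>))) N X)"
    then have [measurable]: "B \<in> sets N" by simp
    have tD: "{\<omega> \<in> space M. t \<omega> \<in> D} \<in> sets M" by measurable
    have B: "X -` B \<inter> space M \<in> sets noise_algebra"
      using measurable_sets[OF X, of B] by simp
    have "emeasure (distr (density M (\<lambda>\<omega>. indicator D (t \<omega>))) N X) B =
        (\<integral>\<^sup>+\<omega>. indicator D (t \<omega>) * indicator (X -` B \<inter> space M) \<omega> \<partial>M)"
      by (simp add: emeasure_distr emeasure_density)
    also have "\<dots> = (\<integral>\<^sup>+\<omega>. indicator ({\<omega> \<in> space M. t \<omega> \<in> D} \<inter> (X -` B \<inter> space M)) \<omega> \<partial>M)"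
      by (rule nn_integral_cong) (simp add: indicator_def)
    also have "\<dots> = emeasure M ({\<omega> \<in> space M. t \<omega> \<in> D} \<inter> (X -` B \<inter> space M))"
      by (rule nn_integral_indicator) (intro sets.Int[OF tD] measurable_sets[OF XM], simp)
    also have "\<dots> = ?c * emeasure M (X -` B \<inter> space M)"
      by (simp add: emeasure_eq_measure prob_attack_time_indep[OF B] ennreal_mult)
    also have "\<dots> = emeasure (density (distr M N X) (\<lambda>_. ?c)) B"
      by (simp add: emeasure_density_const emeasure_distr)
    finally show "emeasure (distr (density M (\<lambda>\<omega>. indicator D (t \<omega>))) N X) B =
        emeasure (density (distr M N X) (\<lambda>_. ?c)) B" .
  qed simp
  then have "(\<integral>\<^sup>+a. G a \<partial>distr (density M (\<lambda>\<omega>. indicator D (t \<omega>))) N X) = (\<integral>\<^sup>+a. G a \<partial>density (distr M N X) (\<lambda>_. ?c))"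
    by simp
  then show ?thesis
    by (simp add: nn_integral_distr nn_integral_density nn_integral_cmult)
qed

lemma prob_no_attack_yet:
  assumes "0 < \<theta>" "\<theta> < 1"
  shows "emeasure M {\<omega> \<in> space M. t \<omega> \<in> {k<..}} = ennreal ((1 - \<theta>) ^ k)"
    and "emeasure M {\<omega> \<in> space M. t \<omega> \<in> {Suc k}} = ennreal (\<theta> * (1 - \<theta>) ^ k)"
proof -
  have *: "prob {\<omega> \<in> space M. t \<omega> \<in> {k<..}} = (1 - \<theta>) ^ k" for k
  proof -
    have "{\<omega> \<in> space M. t \<omega> \<in> {k<..}} = space M - {\<omega> \<in> space M. t \<omega> \<le> k}" by auto
    then show ?thesis by (simp add: prob_compl t_geometric)
  qed
  have "{\<omega> \<in> space M. t \<omega> \<in> {k<..}} = {\<omega> \<in> space M. t \<omega> \<in> {Suc k}} \<union> {\<omega> \<in> space M. t \<omega> \<in> {Suc k<..}}" by auto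
  moreover have "prob ({\<omega> \<in> space M. t \<omega> \<in> {Suc k}} \<union> {\<omega> \<in> space M. t \<omega> \<in> {Suc k<..}}) =
      prob {\<omega> \<in> space M. t \<omega> \<in> {Suc k}} + prob {\<omega> \<in> space M. t \<omega> \<in> {Suc k<..}}"
    by (rule finite_measure_Union) auto
  ultimately have "prob {\<omega> \<in> space M. t \<omega> \<in> {Suc k}} = \<theta> * (1 - \<theta>) ^ k"
    using *[of k] *[of "Suc k"] by (simp add: algebra_simps)
  then show "emeasure M {\<omega> \<in> space M. t \<omega> \<in> {Suc k}} = ennreal (\<theta> * (1 - \<theta>) ^ k)"
    by (simp add: emeasure_eq_measure)
  show "emeasure M {\<omega> \<in> space M. t \<omega> \<in> {k<..}} = ennreal ((1 - \<theta>) ^ k)"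
    using *[of k] by (simp add: emeasure_eq_measure)
qed

text \<open>On this event the history is the attack-free one, which is independent of
  \<open>t\<close>. Comparing the sets \<open>{Suc k}\<close>, \<open>{Suc k<..}\<close> and
  \<open>{k<..}\<close> reduces \<open>hazard\<close> and \<open>survival\<close> to ratios of
  geometric probabilities.\<close>

lemma integral_history_before_attack:
  assumes D: "D \<subseteq> {k<..}" and G: "G \<in> borel_measurable (hist_space k)"
  shows "(\<integral>\<^sup>+\<omega>. indicator D (t \<omega>) * G (history zt k \<omega>) \<partial>M) =
    emeasure M {\<omega> \<in> space M. t \<omega> \<in> D} * (\<integral>\<^sup>+\<omega>. G (history zn k \<omega>) \<partial>M)"
proof -
  have "(\<integral>\<^sup>+\<omega>. indicator D (t \<omega>) * G (history zt k \<omega>) \<partial>M) = (\<integral>\<^sup>+\<omega>. indicator D (t \<omega>) * G (history zn k \<omega>) \<partial>M)"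
    using D by (intro nn_integral_cong) (auto simp: indicator_def history_before_attack)
  then show ?thesis
    using integral_attack_time_indep[OF noise_algebra_history G] by simp
qed

section \<open>Conditional law of the innovation before the attack\<close>

lemma innovation_density:
  "distr M borel (zn (Suc k)) = density lborel (gaussian_density (innovation_cov C R P))"
  and det_innovation_cov_pos: "0 < det (innovation_cov C R P)"
  using gaussian_distr_eq_density[OF steady_state_innovations(1)
      det_innovation_cov_nonzero[OF P_pos_semidef R_pos_def]] by auto

text \<open>On this event received and attack-free innovations coincide. The next attack-free
  innovation is independent of the earlier ones, and the attack time is independent of them jointly,
  so the conditional law is the unconditional Gaussian one.\<close>

lemma conditional_density_before_attack:
  "conditional_density M zt {\<omega>. Suc k < t \<omega>} k (\<lambda>_. gaussian_density (innovation_cov C R P))"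
proof -
  let ?f = "gaussian_density (innovation_cov C R P)"
  note [measurable] = gaussian_density_measurable[of "innovation_cov C R P"]
  have f_law: "(\<integral>\<^sup>+u. indicator D u * ennreal (?f u) \<partial>lborel) = emeasure M (zn (Suc k) -` D \<inter> space M)"
    if [measurable]: "D \<in> sets borel" for D
  proof -
    have "emeasure M (zn (Suc k) -` D \<inter> space M) = emeasure (density lborel ?f) D"
      unfolding innovation_density[of k, symmetric]
      using measurable_noise_algebraD[OF noise_algebra_innovation] by (subst emeasure_distr) auto
    then show ?thesis by (simp add: emeasure_density mult.commute)
  qed
  have f1: "(\<integral>\<^sup>+u. ennreal (?f u) \<partial>lborel) = 1"
    using f_law[of UNIV] by (simp add: emeasure_space_1)
  have law: "emeasure M {\<omega> \<in> space M. Suc k < t \<omega> \<and> history zt k \<omega> \<in> B \<and> zt (Suc k) \<omega> \<in> D} =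
        (\<integral>\<^sup>+\<omega>. indicator {\<omega>. Suc k < t \<omega> \<and> history zt k \<omega> \<in> B} \<omega> *
              (\<integral>\<^sup>+u. indicator D u * ennreal (?f u) \<partial>lborel) \<partial>M)"
    if [measurable]: "B \<in> sets (hist_space k)" "D \<in> sets borel" for B D
  proof -
    let ?c = "emeasure M {\<omega> \<in> space M. t \<omega> \<in> {Suc k<..}}"
    have X: "(\<lambda>\<omega>. (history zn k \<omega>, zn (Suc k) \<omega>)) \<in> measurable noise_algebra (hist_space k \<Otimes>\<^sub>M borel)"
      using noise_algebra_history noise_algebra_innovation by (rule measurable_Pair)
    note XM[measurable] = measurable_noise_algebraD[OF X]
    have [measurable]: "Measurable.pred M (\<lambda>\<omega>. Suc k < t \<omega>)" by measurable
    note [measurable] = measurable_noise_algebraD[OF noise_algebra_history] measurable_noise_algebraD[OF noise_algebra_innovation]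
    \<comment> \<open>\<open>indep_var_restrict\<close> speaks of restrictions to index sets, so the
      innovation at \<open>Suc k\<close> is treated as a function on \<open>{Suc k}\<close> and
      \<open>D\<close> is lifted accordingly.\<close>
    define D' where "D' = {h \<in> space (PiM {Suc k} (\<lambda>_. borel)). h (Suc k) \<in> D}"
    have D': "D' \<in> sets (PiM {Suc k} (\<lambda>_. borel))"
      unfolding D'_def by measurable
    have "indep_var (hist_space k) (\<lambda>\<omega>. restrict (\<lambda>i. zn i \<omega>) {1..k})
        (PiM {Suc k} (\<lambda>_. borel)) (\<lambda>\<omega>. restrict (\<lambda>i. zn i \<omega>) {Suc k})"
      by (rule indep_var_restrict[OF steady_state_innovations(2)]) auto
    then have "prob ((\<lambda>\<omega>. (restrict (\<lambda>i. zn i \<omega>) {1..k}, restrict (\<lambda>i. zn i \<omega>) {Suc k})) -` (B \<times> D') \<inter> space M) =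
        prob ((\<lambda>\<omega>. restrict (\<lambda>i. zn i \<omega>) {1..k}) -` B \<inter> space M) *
        prob ((\<lambda>\<omega>. restrict (\<lambda>i. zn i \<omega>) {Suc k}) -` D' \<inter> space M)"
      by (rule indep_varD) (simp_all add: D')
    moreover have "restrict (\<lambda>i. zn i \<omega>) {Suc k} \<in> D' \<longleftrightarrow> zn (Suc k) \<omega> \<in> D" for \<omega>
      by (auto simp: D'_def space_PiM)
    ultimately have "emeasure M ((\<lambda>\<omega>. (history zn k \<omega>, zn (Suc k) \<omega>)) -` (B \<times> D) \<inter> space M) =
        emeasure M (history zn k -` B \<inter> space M) * emeasure M (zn (Suc k) -` D \<inter> space M)"
      by (simp add: emeasure_eq_measure ennreal_mult vimage_def history_def[abs_def])
    note split = this
    have "emeasure M {\<omega> \<in> space M. Suc k < t \<omega> \<and> history zt k \<omega> \<in> B \<and> zt (Suc k) \<omega> \<in> D} =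
        emeasure M {\<omega> \<in> space M. Suc k < t \<omega> \<and> history zn k \<omega> \<in> B \<and> zn (Suc k) \<omega> \<in> D}"
      by (intro arg_cong[where f="emeasure M"]) (auto simp: history_before_attack received_before_attack)
    also have "\<dots> = (\<integral>\<^sup>+\<omega>. indicator {\<omega> \<in> space M. Suc k < t \<omega> \<and> history zn k \<omega> \<in> B \<and> zn (Suc k) \<omega> \<in> D} \<omega> \<partial>M)"
      by (rule nn_integral_indicator[symmetric]) measurable
    also have "\<dots> = (\<integral>\<^sup>+\<omega>. indicator {Suc k<..} (t \<omega>) * indicator (B \<times> D) (history zn k \<omega>, zn (Suc k) \<omega>) \<partial>M)"
      by (intro nn_integral_cong) (auto simp: indicator_def)
    also have "\<dots> = ?c * (\<integral>\<^sup>+\<omega>. indicator (B \<times> D) (history zn k \<omega>, zn (Suc k) \<omega>) \<partial>M)"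
      by (rule integral_attack_time_indep[OF X]) measurable
    also have "(\<integral>\<^sup>+\<omega>. indicator (B \<times> D) (history zn k \<omega>, zn (Suc k) \<omega>) \<partial>M) =
        (\<integral>\<^sup>+\<omega>. indicator ((\<lambda>\<omega>. (history zn k \<omega>, zn (Suc k) \<omega>)) -` (B \<times> D) \<inter> space M) \<omega> \<partial>M)"
      by (intro nn_integral_cong) (auto simp: indicator_def)
    also have "\<dots> = emeasure M (history zn k -` B \<inter> space M) * emeasure M (zn (Suc k) -` D \<inter> space M)"
      by (subst nn_integral_indicator) (auto simp: split intro: measurable_sets[OF XM])
    also have "emeasure M (history zn k -` B \<inter> space M) = (\<integral>\<^sup>+\<omega>. indicator B (history zn k \<omega>) \<partial>M)"
    proof -
      have "(\<integral>\<^sup>+\<omega>. indicator B (history zn k \<omega>) \<partial>M) = (\<integral>\<^sup>+\<omega>. indicator (history zn k -` B \<inter> space M) \<omega> \<partial>M)"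
        by (rule nn_integral_cong) (simp add: indicator_def)
      then show ?thesis by simp
    qed
    also have "?c * (\<dots> * emeasure M (zn (Suc k) -` D \<inter> space M)) =
        (?c * (\<integral>\<^sup>+\<omega>. indicator B (history zn k \<omega>) \<partial>M)) * (\<integral>\<^sup>+u. indicator D u * ennreal (?f u) \<partial>lborel)"
      by (simp add: f_law mult.assoc)
    also have "?c * (\<integral>\<^sup>+\<omega>. indicator B (history zn k \<omega>) \<partial>M) = (\<integral>\<^sup>+\<omega>. indicator {Suc k<..} (t \<omega>) * indicator B (history zn k \<omega>) \<partial>M)"
      by (rule integral_attack_time_indep[OF noise_algebra_history, symmetric]) measurable
    also have "\<dots> * (\<integral>\<^sup>+u. indicator D u * ennreal (?f u) \<partial>lborel) =
        (\<integral>\<^sup>+\<omega>. indicator {Suc k<..} (t \<omega>) * indicator B (history zn k \<omega>) * (\<integral>\<^sup>+u. indicator D u * ennreal (?f u) \<partial>lborel) \<partial>M)"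
      by (rule nn_integral_multc[symmetric]) measurable
    also have "\<dots> = (\<integral>\<^sup>+\<omega>. indicator {\<omega>. Suc k < t \<omega> \<and> history zt k \<omega> \<in> B} \<omega> *
              (\<integral>\<^sup>+u. indicator D u * ennreal (?f u) \<partial>lborel) \<partial>M)"
      by (intro nn_integral_cong arg_cong2[where f="(*)"] refl) (auto simp: indicator_def history_before_attack)
    finally show ?thesis .
  qed
  show ?thesis
    unfolding conditional_density_def
    using law f1 gaussian_density_nonneg[OF less_imp_le[OF det_innovation_cov_pos]] by auto
qed

lemma attacked_system_filtered_detection:
  assumes "0 < lam" and \<theta>: "0 < \<theta>" "\<theta> < 1"
    and f: "\<And>k. conditional_density M zt {\<omega>. t \<omega> \<le> Suc k} k (f\<^sub>1 k)"
  shows "filtered_detection M lam \<theta> f\<^sub>1 (gaussian_density (innovation_cov C R P)) t zt"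
proof
  show "(\<lambda>(h, u). f\<^sub>1 k h u) \<in> borel_measurable (hist_space k \<Otimes>\<^sub>M borel)" for k
    using f[of k] by (simp add: conditional_density_def)
  show "0 \<le> f\<^sub>1 k h u" if "h \<in> space (hist_space k)" for k h u
    using f[of k] that by (simp add: conditional_density_def)
  show "(\<integral>\<^sup>+u. ennreal (f\<^sub>1 k h u) \<partial>lborel) = 1" if "h \<in> space (hist_space k)" for k h
    using f[of k] that by (simp add: conditional_density_def)
  show "0 \<le> gaussian_density (innovation_cov C R P) u" for u
    by (intro gaussian_density_nonneg less_imp_le det_innovation_cov_pos)
  \<comment> \<open>Normalization in \<open>conditional_density\<close> is stated per history; the
    empty history at time 0 serves as an instance.\<close>
  have "(\<lambda>_. undefined) \<in> space (hist_space 0)" by (auto simp: space_PiM)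
  then show "(\<integral>\<^sup>+u. ennreal (gaussian_density (innovation_cov C R P) u) \<partial>lborel) = 1"
    using conditional_density_before_attack[of 0] by (auto simp: conditional_density_def)
  have "prob {\<omega> \<in> space M. t \<omega> \<le> 0} = 0" using t_geometric[of 0] by simp
  then have "AE \<omega> in M. \<not> t \<omega> \<le> 0" by (subst AE_iff_measurable) (auto simp: emeasure_eq_measure)
  then show "AE \<omega> in M. 0 < t \<omega>" by simp
  \<comment> \<open>Both sides factor with the same integral of \<open>G\<close> over the
    attack-free history, leaving \<open>\<theta> * (1 - \<theta>) ^ k\<close> against
    \<open>\<theta>\<close> times \<open>(1 - \<theta>) ^ k\<close>.\<close>
  show "(\<integral>\<^sup>+\<omega>. indicator {Suc k} (t \<omega>) * G (history zt k \<omega>) \<partial>M) =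
      ennreal \<theta> * (\<integral>\<^sup>+\<omega>. indicator {k<..} (t \<omega>) * G (history zt k \<omega>) \<partial>M)"
    if G: "G \<in> borel_measurable (hist_space k)" for k G
    using \<theta> integral_history_before_attack[OF _ G, of "{Suc k}"] integral_history_before_attack[OF _ G, of "{k<..}"]
    unfolding prob_no_attack_yet[OF \<theta>] by (simp add: ennreal_mult' mult.assoc)
  show "(\<integral>\<^sup>+\<omega>. indicator {Suc k<..} (t \<omega>) * G (history zt k \<omega>) \<partial>M) =
      ennreal (1 - \<theta>) * (\<integral>\<^sup>+\<omega>. indicator {k<..} (t \<omega>) * G (history zt k \<omega>) \<partial>M)"
    if G: "G \<in> borel_measurable (hist_space k)" for k G
    using \<theta> integral_history_before_attack[OF _ G, of "{Suc k<..}"] integral_history_before_attack[OF _ G, of "{k<..}"]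
    unfolding prob_no_attack_yet[OF \<theta>] by (simp add: ennreal_mult' mult.assoc subset_eq)
qed (use assms in \<open>auto intro: measurable_received gaussian_density_measurable conditional_density_before_attack t_measurable\<close>)

end

theorem theorem3:
  fixes M :: "'a measure"
    and A Q P :: "real^'q^'q" and C :: "real^'q^'m" and R T \<Sigma>\<^sub>b :: "real^'m^'m"
    and sensor :: "'m \<Rightarrow> 's::finite" and safe :: "'s set"
    and x w xt xn :: "nat \<Rightarrow> 'a \<Rightarrow> real^'q" and y v b z zt zn :: "nat \<Rightarrow> 'a \<Rightarrow> real^'m"
    and t :: "'a \<Rightarrow> nat" and \<theta> lam :: real
    and f\<^sub>1 :: "nat \<Rightarrow> (nat \<Rightarrow> real^'m) \<Rightarrow> real^'m \<Rightarrow> real" and f\<^sub>0 :: "real^'m \<Rightarrow> real"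
  assumes lam: "lam > 0"
    and \<theta>: "0 < \<theta>" "\<theta> < 1"
    and system: "attacked_system M A Q C R sensor P safe T \<Sigma>\<^sub>b \<theta> x y w v b t z zt xt zn xn"
    and f\<^sub>1: "\<And>k. conditional_density M zt {\<omega>. t \<omega> \<le> Suc k} k (f\<^sub>1 k)"
    and f\<^sub>0: "f\<^sub>0 = gaussian_density (innovation_cov C R P)"
  shows "(\<forall>\<mu>\<in>policies. detection_cost M t zt lam \<mu> = belief_cost M t zt lam \<mu>) \<and>
    (\<exists>\<Gamma>.
       (\<forall>k. \<forall>h\<in>space (hist_space k).
          \<Gamma> k h \<in> {0..1} \<and>
          (\<forall>\<pi>\<in>{0..1}.
             (\<pi> > \<Gamma> k h \<longrightarrow> optimal_actions lam \<theta> f\<^sub>1 f\<^sub>0 k \<pi> h = {Stop}) \<and>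
             (\<pi> < \<Gamma> k h \<longrightarrow> optimal_actions lam \<theta> f\<^sub>1 f\<^sub>0 k \<pi> h = {Continue}) \<and>
             (\<pi> = \<Gamma> k h \<longrightarrow> optimal_actions lam \<theta> f\<^sub>1 f\<^sub>0 k \<pi> h = {Stop, Continue}))) \<and>
       threshold_policies M t zt \<Gamma> \<noteq> {} \<and>
       (\<forall>\<mu>\<in>threshold_policies M t zt \<Gamma>. \<forall>\<nu>\<in>policies.
          detection_cost M t zt lam \<mu> \<le> detection_cost M t zt lam \<nu>))"
  using filtered_detection.optimal_threshold_policies
    [OF attacked_system.attacked_system_filtered_detection[OF system lam \<theta> f\<^sub>1]]
  unfolding f\<^sub>0 .

end
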